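(* Let $(X,\mu,S)$ be a finitely generated multiplicative system. Then for any $F\in L^2(X)$ and any $f\in\mathcal{M}^{\mathrm c}_{\mathrm{fg}}$, $$\lim_{N\to\infty}\frac{1}{N}\sum_{n=1}^N\overline{f(n)}\,S_nF=\prod_{p\in\mathcal{P}}\Big(1-\frac1p\Big)\sum_{n\in\mathcal{Q}_{\mathcal{P}^{\mathrm c}}}\frac{\overline{f(n)}}{n}S_n(P_fF)\qquad\text{in }L^2(X),$$ where $\mathcal{P}=\{p\in\mathbb{P}: S_p(P_fF)\neq f(p)P_fF\}$.
   Context: $\mathbb{N}=\{1,2,\dots\}$, $\mathbb{P}$ is the set of primes, $\mathbb{S}^1$ the complex unit circle. Every probability space $(X,\mu)$ is assumed regular: $X$ is a compact metric space with its Borel $\sigma$-algebra. A multiplicative system $(X,\mu,S)$ consists of a probability space $(X,\mu)$ and a sequence $S=(S_n)_{n\in\mathbb{N}}$ of commuting invertible measure-preserving transformations of $(X,\mu)$ with $S_{nm}=S_n\circ S_m$ for all $n,m\in\mathbb{N}$. It is finitely generated if $\{S_p:p\in\mathbb{P}\}$ is finite. For $F\in L^2(X)$, $S_nF=F\circ S_n$. $\mathcal{M}^{\mathrm c}_{\mathrm{fg}}$ is the set of completely multiplicative $f:\mathbb{N}\to\mathbb{S}^1$ with $\{f(p):p\in\mathbb{P}\}$ finite. For $F\in L^2(X)$, $\mathbb{D}_F(S,f)=\big(\frac12\sum_{p\in\mathbb{P}}\frac{\|S_pF-f(p)F\|_2^2}{p}\big)^{1/2}\in[0,\infty]$ and $\mathcal{H}_f=\{F\in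 L^2(X):\mathbb{D}_F(S,f)<\infty\}$, which is a linear subspace of $L^2(X)$; $P_f:L^2(X)\to\overline{\mathcal{H}_f}$ is the orthogonal projection onto its closure. For $\mathcal{P}\subseteq\mathbb{P}$, $\mathcal{P}^{\mathrm c}=\mathbb{P}\setminus\mathcal{P}$ and $\mathcal{Q}_{\mathcal{P}}=\{n\in\mathbb{N}: \text{no prime divisor of } n \text{ lies in } \mathcal{P}\}$; thus $\mathcal{Q}_{\mathcal{P}^{\mathrm c}}$ is the set of $n$ all of whose prime divisors lie in $\mathcal{P}$. *)

theory Defs
  imports "HOL-Probability.Probability" "HOL-Computational_Algebra.Primes"
begin

section \<open>Multiplicative systems\<close>

text \<open>
  The underlying compact metric space is \<^term>\<open>space M\<close>, a compact subset of the ambient metric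
  type. The index \<open>0\<close> is not part of the system; \<open>S 0\<close> is arbitrary.
\<close>

locale multiplicative_system = prob_space M
  for M :: "'a::metric_space measure" and S :: "nat \<Rightarrow> 'a \<Rightarrow> 'a" +
  assumes compact_space: "compact (space M)"
    and sets_borel: "sets M = sets (restrict_space borel (space M))"
    and bij: "n \<ge> 1 \<Longrightarrow> bij_betw (S n) (space M) (space M)"
    and measurable: "n \<ge> 1 \<Longrightarrow> S n \<in> measurable M M"
    and measurable_inv: "n \<ge> 1 \<Longrightarrow> the_inv_into (space M) (S n) \<in> measurable M M"
    and preserving: "n \<ge> 1 \<Longrightarrow> distr M M (S n) = M"
    and commute: "n \<ge> 1 \<Longrightarrow> m \<ge> 1 \<Longrightarrow> x \<in> space M \<Longrightarrow> S n (S m x) = S m (S n x)"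
    and mult: "n \<ge> 1 \<Longrightarrow> m \<ge> 1 \<Longrightarrow> x \<in> space M \<Longrightarrow> S (n * m) x = S n (S m x)"

text \<open>Transformations of \<open>X\<close> are compared on \<^term>\<open>space M\<close> only, hence the restriction.\<close>

locale fg_multiplicative_system = multiplicative_system +
  assumes finitely_generated: "finite ((\<lambda>p. restrict (S p) (space M)) ` {p. prime p})"

definition Mfg_c :: "(nat \<Rightarrow> complex) set" where
  "Mfg_c = {f. (\<forall>n\<ge>1. cmod (f n) = 1) \<and> (\<forall>m\<ge>1. \<forall>n\<ge>1. f (m * n) = f m * f n)
             \<and> finite (f ` {p. prime p})}"


section \<open>The space \<open>L\<^sup>2\<close>\<close>

text \<open>
  Elements of \<open>L\<^sup>2(X)\<close> are represented by square-integrable functions; equality in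
  \<open>L\<^sup>2(X)\<close> is equality almost everywhere.
\<close>

definition L2 :: "'a measure \<Rightarrow> ('a \<Rightarrow> complex) set" where
  "L2 M = {F \<in> borel_measurable M. integrable M (\<lambda>x. (cmod (F x))\<^sup>2)}"

definition L2_norm :: "'a measure \<Rightarrow> ('a \<Rightarrow> complex) \<Rightarrow> real" where
  "L2_norm M F = sqrt (\<integral>x. (cmod (F x))\<^sup>2 \<partial>M)"

definition L2_inner :: "'a measure \<Rightarrow> ('a \<Rightarrow> complex) \<Rightarrow> ('a \<Rightarrow> complex) \<Rightarrow> complex" where
  "L2_inner M F G = (\<integral>x. F x * cnj (G x) \<partial>M)"

definition L2_tendsto ::
  "'a measure \<Rightarrow> ('i \<Rightarrow> 'a \<Rightarrow> complex) \<Rightarrow> ('a \<Rightarrow> complex) \<Rightarrow> 'i filter \<Rightarrow> bool" where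
  "L2_tendsto M u G \<F> \<longleftrightarrow> G \<in> L2 M \<and> (\<forall>\<^sub>F i in \<F>. u i \<in> L2 M)
     \<and> ((\<lambda>i. L2_norm M (\<lambda>x. u i x - G x)) \<longlongrightarrow> 0) \<F>"

definition L2_closure :: "'a measure \<Rightarrow> ('a \<Rightarrow> complex) set \<Rightarrow> ('a \<Rightarrow> complex) set" where
  "L2_closure M V = {G \<in> L2 M. \<forall>\<epsilon>>0. \<exists>H\<in>V. L2_norm M (\<lambda>x. G x - H x) < \<epsilon>}"

text \<open>
  Orthogonal projection onto a closed subspace \<open>W\<close>. The conditions determine \<open>G\<close> up to equality
  almost everywhere, and \<open>SOME\<close> picks a representative.
\<close>

definition L2_proj ::
  "'a measure \<Rightarrow> ('a \<Rightarrow> complex) set \<Rightarrow> ('a \<Rightarrow> complex) \<Rightarrow> 'a \<Rightarrow> complex" where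
  "L2_proj M W F = (SOME G. G \<in> W \<and> (\<forall>H\<in>W. L2_inner M (\<lambda>x. F x - G x) H = 0))"

text \<open>
  Unordered sums in \<open>L\<^sup>2(X)\<close>, in analogy with \<^const>\<open>has_sum\<close>, \<^const>\<open>summable_on\<close> and
  \<^const>\<open>infsum\<close>; again the sum is determined up to equality almost everywhere.
\<close>

definition has_L2_sum ::
  "'a measure \<Rightarrow> ('i \<Rightarrow> 'a \<Rightarrow> complex) \<Rightarrow> ('a \<Rightarrow> complex) \<Rightarrow> 'i set \<Rightarrow> bool" where
  "has_L2_sum M u G A \<longleftrightarrow> L2_tendsto M (\<lambda>B x. \<Sum>i\<in>B. u i x) G (finite_subsets_at_top A)"

definition L2_summable_on :: "'a measure \<Rightarrow> ('i \<Rightarrow> 'a \<Rightarrow> complex) \<Rightarrow> 'i set \<Rightarrow> bool" where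
  "L2_summable_on M u A \<longleftrightarrow> (\<exists>G. has_L2_sum M u G A)"

definition L2_infsum :: "'a measure \<Rightarrow> ('i \<Rightarrow> 'a \<Rightarrow> complex) \<Rightarrow> 'i set \<Rightarrow> 'a \<Rightarrow> complex" where
  "L2_infsum M u A = (SOME G. has_L2_sum M u G A)"


section \<open>The distance \<open>\<D>\<^sub>F(S, f)\<close> and the projection \<open>P\<^sub>f\<close>\<close>

definition dist_D ::
  "'a measure \<Rightarrow> (nat \<Rightarrow> 'a \<Rightarrow> 'a) \<Rightarrow> (nat \<Rightarrow> complex) \<Rightarrow> ('a \<Rightarrow> complex) \<Rightarrow> ennreal" where
  "dist_D M S f F =
     (let t = (\<lambda>p. (L2_norm M (\<lambda>x. F (S p x) - f p * F x))\<^sup>2 / real p)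
      in if t summable_on {p. prime p}
         then ennreal (sqrt (1/2 * (\<Sum>\<^sub>\<infinity>p\<in>{p. prime p}. t p))) else \<infinity>)"

definition H_space ::
  "'a measure \<Rightarrow> (nat \<Rightarrow> 'a \<Rightarrow> 'a) \<Rightarrow> (nat \<Rightarrow> complex) \<Rightarrow> ('a \<Rightarrow> complex) set" where
  "H_space M S f = {F \<in> L2 M. dist_D M S f F < \<infinity>}"

definition P_proj ::
  "'a measure \<Rightarrow> (nat \<Rightarrow> 'a \<Rightarrow> 'a) \<Rightarrow> (nat \<Rightarrow> complex) \<Rightarrow> ('a \<Rightarrow> complex) \<Rightarrow> 'a \<Rightarrow> complex" where
  "P_proj M S f F = L2_proj M (L2_closure M (H_space M S f)) F"


section \<open>Integers without prime divisors in a given set\<close>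

definition Q_set :: "nat set \<Rightarrow> nat set" where
  "Q_set P = {n. n \<ge> 1 \<and> (\<forall>p. prime p \<and> p dvd n \<longrightarrow> p \<notin> P)}"

end

(*
  Twist the system by cnj f, so that the primes act through finitely many commuting isometries
  ("colours"). Call a prime heavy if the reciprocals of the primes of its colour have infinite sum.
  The space H_f consists of the vectors fixed by all heavy primes, and it is closed.

  Let a(x) be the mean of the twisted orbit of a vector up to x. By the Turan-Kubilius inequality,
  a(x) is close to a weighted mean of T_p a(x / p) over any finite set of primes p with large
  reciprocal sum. Suppose there are many disjoint pairs (p, q) of primes of equal colour with q / p
  close to a fixed exp t. Comparing the two resulting approximations gives a(exp t * x) ~ a(x).
  Such pairs exist for arbitrarily small t > 0: take a maximal matching of same-coloured primes at
  moderate multiplicative distance; the unmatched primes cluster in short intervals, which contain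
  few primes because these primes divide one binomial coefficient. Hence a is slowly varying, and
  then the Turan-Kubilius inequality for one heavy colour shows T_p a(x) - a(x) -> 0 for heavy p.
  So the means of coboundaries of heavy primes vanish asymptotically, and with them those of every
  vector orthogonal to H_f.

  For a vector G in H_f, the primes moving G have a convergent reciprocal sum, G is constant along
  integers composed of the other primes, and the mean is evaluated by dominated convergence from
  the density of the integers free of the moving primes.
*)

theory Submission
  imports Defs
begin

section \<open>Primes in short intervals\<close>

text \<open>The obstacle is scale. The Turan-Kubilius inequality relates the mean at x to means at x
  / p, and these scales vary with p, while the Lipschitz bound for the mean in ln x does not improve
  as x grows. So slow variation must be established before a single isometry T_p can be isolated.
  Two choices make this work. First, the shift t may be taken arbitrarily small, but it is bounded
  below independently of the accuracy to which q / p approximates exp t; hence the number of shifts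
  that make up a given factor is known before the accuracy is fixed. Second, each prime q gets the
  weight kappa * q / p, so that the two approximations carry identical coefficients kappa / p and
  can be subtracted term by term; kappa keeps the weights at most 1. The supply of pairs rests on a
  comparison of constants: Euler's argument gives the primes up to N a reciprocal sum of at least
  (1/2) ln ln N, while the unmatched primes account for at most (1/4) ln ln N + O(1).\<close>

lemma prod_primes_dvd:
  fixes n :: nat
  assumes "finite A" and "\<And>p. p \<in> A \<Longrightarrow> prime p \<and> p dvd n"
  shows "\<Prod>A dvd n"
  using assms
proof (induction A rule: finite_induct)
  case (insert p A)
  have "coprime p (\<Prod>A)"
    using insert by (intro prod_coprime_right) (metis insertCI primes_coprime)
  then show ?case
    using insert by (simp add: divides_mult)
qed simp

text \<open>From \<open>b choose d\<close> <= (e b / d)^d and 1 + ln u <= 2 sqrt u with u = b / d.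
  What counts later is that the exponent is o(b) as soon as d is o(b).\<close>

lemma binomial_le_exp_sqrt:
  assumes "d \<le> b" "1 \<le> d"
  shows "real (b choose d) \<le> exp (2 * sqrt (real b * real d))"
proof -
  have b: "0 < real b" "0 < real d" using assms by auto
  have "real d ^ d / fact d \<le> exp (real d)"
  proof -
    have "(\<Sum>k\<in>{d}. real d ^ k /\<^sub>R fact k) \<le> (\<Sum>k. real d ^ k /\<^sub>R fact k)"
      by (intro sum_le_suminf summable_exp_generic) auto
    then show ?thesis
      by (simp add: exp_def field_simps)
  qed
  then have 1: "real d ^ d \<le> exp (real d) * fact d"
    by (simp add: field_simps)
  have "real (b choose d) * fact d \<le> real b ^ d"
    using binomial_fact_pow[of b d] by (metis of_nat_fact of_nat_le_iff of_nat_mult of_nat_power)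
  then have "real (b choose d) * fact d * real d ^ d \<le> real b ^ d * (exp (real d) * fact d)"
    using 1 by (intro mult_mono) auto
  then have "real (b choose d) * real d ^ d \<le> real b ^ d * exp (real d)"
    by (simp add: field_simps)
  then have "real (b choose d) \<le> (real b / real d) ^ d * exp (real d)"
    using b by (simp add: field_simps power_divide)
  also have "\<dots> = exp (real d * (1 + ln (real b / real d)))"
    using b by (simp add: exp_add algebra_simps flip: ln_realpow)
  also have "\<dots> \<le> exp (2 * sqrt (real b * real d))"
  proof -
    define s where "s = sqrt (real b / real d)"
    have s: "s > 0" "real b / real d = s ^ 2" using b by (auto simp: s_def)
    have "ln (real b / real d) = 2 * ln s" using s by (simp add: ln_realpow)
    also have "\<dots> \<le> 2 * (s - 1)" using ln_le_minus_one[OF s(1)] by simp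
    finally have "real d * (1 + ln (real b / real d)) \<le> real d * (2 * s)"
      using b by (intro mult_left_mono) auto
    also have "\<dots> = 2 * (real d * s)" by simp
    also have "real d * s = sqrt (real b * real d)"
      using b by (simp add: s_def real_sqrt_divide real_sqrt_mult field_simps)
    finally show ?thesis by simp
  qed
  finally show ?thesis .
qed

text \<open>The primes in \<open>{m..b}\<close> all divide \<open>b choose (b + 1 - m)\<close>.\<close>

lemma card_primes_interval_le:
  fixes A :: "nat set"
  assumes A: "\<And>p. p \<in> A \<Longrightarrow> prime p \<and> m \<le> p \<and> p \<le> b" and m: "1 \<le> m" "m \<le> b" "b + 1 < 2 * m"
  shows "real (card A) * ln (real m) \<le> 2 * sqrt (real b * (real b + 1 - real m))"
proof -
  define d where "d = b + 1 - m"
  have d: "d \<le> b" "1 \<le> d" "d < m" using m by (auto simp: d_def)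
  have fin: "finite A"
    by (rule finite_subset[of _ "{..b}"]) (use A in auto)
  have "p dvd b choose d" if "p \<in> A" for p
  proof -
    have p: "prime p" "m \<le> p" "p \<le> b" using A that by auto
    have "p dvd fact b" using p by (simp add: prime_dvd_fact_iff)
    then have "p dvd fact d * fact (b - d) * (b choose d)"
      using binomial_fact_lemma[OF d(1)] by simp
    \<comment> \<open>Here b - d = m - 1, and \<open>b + 1 < 2 * m\<close> says d < m, so both
      factorials stop short of p.\<close>
    moreover have "\<not> p dvd fact d" "\<not> p dvd fact (b - d)"
      using p d m by (auto simp: prime_dvd_fact_iff d_def)
    ultimately show ?thesis using p by (simp add: prime_dvd_mult_iff)
  qed
  then have "\<Prod>A dvd b choose d" using A fin by (intro prod_primes_dvd) auto
  then have "\<Prod>A \<le> b choose d" using d by (intro dvd_imp_le) auto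
  moreover have "m ^ card A \<le> \<Prod>A"
    using prod_mono[of A "\<lambda>_. m" "\<lambda>p. p"] A by simp
  ultimately have "m ^ card A \<le> b choose d" by linarith
  then have "real m ^ card A \<le> real (b choose d)"
    by (metis of_nat_le_iff of_nat_power)
  also have "\<dots> \<le> exp (2 * sqrt (real b * real d))"
    using d by (intro binomial_le_exp_sqrt) auto
  finally have "ln (real m ^ card A) \<le> ln (exp (2 * sqrt (real b * real d)))"
    using m by (intro ln_mono) auto
  then show ?thesis using m d by (simp add: ln_realpow d_def of_nat_diff add.commute)
qed

text \<open>Points with pairwise ratio at most \<open>exp \<tau>\<close> lie in one interval that is
  short compared with its endpoints, so the binomial bound makes their number small against b / ln
  m. As \<open>\<tau>\<close> and \<open>X\<close> depend on \<open>\<epsilon>\<close> alone, the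
  bound can be used at all scales at once.\<close>

lemma card_clustered_primes_le:
  assumes "\<epsilon> > 0"
  obtains \<tau> X where "\<tau> > 0" "X \<ge> 2"
    "\<And>(A :: nat set) b. finite A \<Longrightarrow> A \<noteq> {} \<Longrightarrow> (\<And>p. p \<in> A \<Longrightarrow> prime p \<and> X \<le> real p \<and> real p \<le> b) \<Longrightarrow>
       (\<And>p q. p \<in> A \<Longrightarrow> q \<in> A \<Longrightarrow> real q \<le> exp \<tau> * real p) \<Longrightarrow>
       real (card A) * ln (Min A) \<le> \<epsilon> * b"
proof -
  \<comment> \<open>2 sqrt \<delta> <= \<epsilon> gives the final constant, and \<delta> <= 1/2
    keeps the interval short enough for \<open>card_primes_interval_le\<close>. Half of \<delta> is
    spent on the ratio \<open>exp \<tau>\<close>, the other half absorbs the \<open>+ 1\<close> in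
    the length, which needs m >= 2 / \<delta>.\<close>
  define \<delta> where "\<delta> = min (\<epsilon>\<^sup>2 / 4) (1 / 2)"
  have \<delta>: "\<delta> > 0" "\<delta> \<le> \<epsilon>\<^sup>2 / 4" "\<delta> \<le> 1 / 2" using assms by (auto simp: \<delta>_def)
  define \<tau> where "\<tau> = ln (1 + \<delta> / 2)"
  define X where "X = 2 / \<delta>"
  have X: "X \<ge> 2" "X > 0" using \<delta> by (auto simp: X_def field_simps)
  show ?thesis
  proof (rule that)
    show "\<tau> > 0" using \<delta> by (simp add: \<tau>_def)
    show "X \<ge> 2" by fact
    fix A :: "nat set" and b :: real
    assume A: "finite A" "A \<noteq> {}" "\<And>p. p \<in> A \<Longrightarrow> prime p \<and> X \<le> real p \<and> real p \<le> b"
      "\<And>p q. p \<in> A \<Longrightarrow> q \<in> A \<Longrightarrow> real q \<le> exp \<tau> * real p"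
    define m n where "m = Min A" and "n = Max A"
    have mn: "m \<in> A" "n \<in> A" "m \<le> n" using A by (auto simp: m_def n_def)
    have "real n \<le> (1 + \<delta> / 2) * real m" using A(4)[OF mn(1,2)] \<delta> by (simp add: \<tau>_def)
    moreover have "1 \<le> \<delta> / 2 * real m" using A(3)[OF mn(1)] \<delta> by (simp add: X_def field_simps)
    ultimately have le: "real n + 1 - real m \<le> \<delta> * real m" by (simp add: algebra_simps)
    have m1: "real m \<ge> 2" using A(3)[OF mn(1)] X by linarith
    have "\<delta> * real m \<le> 1/2 * real m" using \<delta> by (intro mult_right_mono) auto
    then have "real n + 1 < 2 * real m" using le m1 by linarith
    then have "n + 1 < 2 * m" by linarith
    then have "real (card A) * ln (real m) \<le> 2 * sqrt (real n * (real n + 1 - real m))"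
      using A mn m1 by (intro card_primes_interval_le) (auto simp: m_def n_def)
    also have "\<dots> \<le> 2 * sqrt (real n * (\<epsilon>\<^sup>2 / 4 * real n))"
    proof -
      have "\<delta> * real m \<le> \<epsilon>\<^sup>2 / 4 * real n" using \<delta> mn by (intro mult_mono) auto
      then have "real n * (real n + 1 - real m) \<le> real n * (\<epsilon>\<^sup>2 / 4 * real n)"
        using le by (intro mult_left_mono) auto
      then show ?thesis by simp
    qed
    also have "real n * (\<epsilon>\<^sup>2 / 4 * real n) = (\<epsilon> / 2 * real n)\<^sup>2" by (simp add: power2_eq_square)
    also have "2 * sqrt ((\<epsilon> / 2 * real n)\<^sup>2) = \<epsilon> * real n" using assms by (simp add: real_sqrt_abs)
    also have "\<dots> \<le> \<epsilon> * b" using A(3)[OF mn(2)] assms by auto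
    finally show "real (card A) * ln (real (Min A)) \<le> \<epsilon> * b" by (simp add: m_def)
  qed
qed

section \<open>Reciprocal sums over smooth integers and over primes\<close>

lemma sum_inverse_smooth_le:
  fixes P :: "nat set"
  assumes "finite P" "\<And>p. p \<in> P \<Longrightarrow> prime p"
  shows "(\<Sum>n\<in>Q_set ({p. prime p} - P) \<inter> {..N}. 1 / real n) \<le> (\<Prod>p\<in>P. 1 / (1 - 1 / real p))"
  using assms
proof (induction P rule: finite_induct)
  case empty
  have "Q_set {p. prime p} \<inter> {..N} \<subseteq> {1}"
    by (auto simp: Q_set_def) (metis One_nat_def prime_factor_nat)
  then have "(\<Sum>n\<in>Q_set {p. prime p} \<inter> {..N}. 1 / real n) \<le> (\<Sum>n\<in>{1}. 1 / real n)"
    by (intro sum_mono2) auto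
  then show ?case by simp
next
  case (insert q P)
  define s where "s = (\<lambda>P. \<Sum>n\<in>Q_set ({p. prime p} - P) \<inter> {..N}. 1 / real n)"
  have q: "prime q" "2 \<le> q" using insert prime_ge_2_nat by auto
  have IH: "s P \<le> (\<Prod>p\<in>P. 1 / (1 - 1 / real p))" using insert by (auto simp: s_def)
  have sub: "Q_set ({p. prime p} - insert q P) \<inter> {..N} \<subseteq>
     (Q_set ({p. prime p} - P) \<inter> {..N}) \<union> times q ` (Q_set ({p. prime p} - insert q P) \<inter> {..N})"
  proof
    fix n assume n: "n \<in> Q_set ({p. prime p} - insert q P) \<inter> {..N}"
    show "n \<in> (Q_set ({p. prime p} - P) \<inter> {..N}) \<union> times q ` (Q_set ({p. prime p} - insert q P) \<inter> {..N})"
    proof (cases "q dvd n")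
      case True
      then obtain k where k: "n = q * k" by (elim dvdE)
      have "1 \<le> k" using n k by (cases k) (auto simp: Q_set_def)
      moreover have "k \<le> N" using n k q by (auto intro: order_trans[of _ "q * k"])
      ultimately have "k \<in> Q_set ({p. prime p} - insert q P) \<inter> {..N}"
        using n k by (auto simp: Q_set_def)
      then show ?thesis using k by auto
    next
      case False
      then show ?thesis using n by (auto simp: Q_set_def)
    qed
  qed
  \<comment> \<open>A smooth integer is either free of q or q times another one, so the new sum s'
    satisfies s' <= s + s' / q. The cutoff \<open>N\<close> makes s' finite, so that this can be
    solved for s'.\<close>
  have "s (insert q P) \<le> (\<Sum>n\<in>(Q_set ({p. prime p} - P) \<inter> {..N}) \<union>
        times q ` (Q_set ({p. prime p} - insert q P) \<inter> {..N}). 1 / real n)"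
    unfolding s_def by (rule sum_mono2[OF _ sub]) auto
  also have "\<dots> \<le> s P + (\<Sum>n\<in>times q ` (Q_set ({p. prime p} - insert q P) \<inter> {..N}). 1 / real n)"
    unfolding s_def by (subst sum_Un) (auto intro!: sum_nonneg)
  also have "(\<Sum>n\<in>times q ` (Q_set ({p. prime p} - insert q P) \<inter> {..N}). 1 / real n) =
      s (insert q P) / real q"
    unfolding s_def using q
    by (subst sum.reindex) (auto simp: inj_on_def sum_divide_distrib field_simps)
  finally have "s (insert q P) * (1 - 1 / real q) \<le> s P" by (simp add: algebra_simps)
  then have "s (insert q P) \<le> s P * (1 / (1 - 1 / real q))"
    using q by (simp add: field_simps)
  also have "\<dots> \<le> (\<Prod>p\<in>P. 1 / (1 - 1 / real p)) * (1 / (1 - 1 / real q))"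
    using IH q by (intro mult_right_mono) (auto simp: field_simps)
  finally show ?case using insert by (simp add: s_def mult.commute)
qed

lemma inverse_one_minus_le_exp:
  fixes u :: real
  assumes "0 \<le> u" "u \<le> 1 / 2"
  shows "1 / (1 - u) \<le> exp (2 * u)"
proof -
  have "1 \<le> (1 + 2 * u) * (1 - u)" using mult_left_mono[OF assms(2) assms(1)]
    by (simp add: algebra_simps power2_eq_square)
  also have "\<dots> \<le> exp (2 * u) * (1 - u)" using assms by (intro mult_right_mono) auto
  finally show ?thesis using assms by (simp add: field_simps)
qed

lemma prod_euler_le_exp:
  assumes "finite P" "\<And>p. p \<in> P \<Longrightarrow> prime p"
  shows "(\<Prod>p\<in>P. 1 / (1 - 1 / real p)) \<le> exp (2 * (\<Sum>p\<in>P. 1 / real p))"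
proof -
  have "(\<Prod>p\<in>P. 1 / (1 - 1 / real p)) \<le> (\<Prod>p\<in>P. exp (2 * (1 / real p)))"
  proof (intro prod_mono conjI)
    fix p assume "p \<in> P"
    then have "2 \<le> p" using assms prime_ge_2_nat by auto
    then show "0 \<le> 1 / (1 - 1 / real p)" by (auto simp: field_simps)
    show "1 / (1 - 1 / real p) \<le> exp (2 * (1 / real p))"
      using \<open>2 \<le> p\<close> by (intro inverse_one_minus_le_exp) (auto simp: field_simps)
  qed
  also have "\<dots> = exp (2 * (\<Sum>p\<in>P. 1 / real p))"
    using assms by (simp add: exp_sum sum_distrib_left)
  finally show ?thesis .
qed

text \<open>Euler's argument: every n <= N is a product of primes up to N, so ln N is at most the
  Euler product. The growth rate matters, not just divergence, because the clustered primes to be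
  subtracted later also have a bound of order ln ln N.\<close>

lemma sum_inverse_primes_ge:
  assumes "N \<ge> 2"
  shows "ln (ln (real N)) / 2 \<le> (\<Sum>p | prime p \<and> p \<le> N. 1 / real p)"
proof -
  let ?P = "{p. prime p \<and> p \<le> N}"
  have fin: "finite ?P" by simp
  have eq: "Q_set ({p. prime p} - ?P) \<inter> {..N} = {1..N}"
    by (auto simp: Q_set_def dest: dvd_imp_le)
  have "ln (real N) \<le> ln (real N + 1)" using assms by simp
  also have "\<dots> \<le> harm N" by (rule ln_le_harm)
  also have "\<dots> = (\<Sum>n\<in>Q_set ({p. prime p} - ?P) \<inter> {..N}. 1 / real n)"
    unfolding eq by (simp add: harm_def field_simps)
  also have "\<dots> \<le> (\<Prod>p\<in>?P. 1 / (1 - 1 / real p))"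
    by (rule sum_inverse_smooth_le) auto
  also have "\<dots> \<le> exp (2 * (\<Sum>p\<in>?P. 1 / real p))" by (rule prod_euler_le_exp) auto
  finally have le: "ln (real N) \<le> exp (2 * (\<Sum>p\<in>?P. 1 / real p))" .
  have "0 < ln (real N)" using assms by simp
  then have "ln (ln (real N)) \<le> 2 * (\<Sum>p\<in>?P. 1 / real p)"
    using le by (metis ln_exp ln_mono)
  then show ?thesis by simp
qed

section \<open>Pairs of primes of equal colour\<close>

text \<open>A point may be the first entry of one pair and the second entry of another. Injectivity
  in each coordinate is the right notion, since the first and the second entries are fed into two
  separate Turan-Kubilius sums.\<close>

lemma maximal_matching:
  fixes E :: "('a \<times> 'a) set"
  obtains R where "R \<subseteq> E" "inj_on fst R" "inj_on snd R"
    "\<And>p q. p \<notin> fst ` R \<union> snd ` R \<Longrightarrow> q \<notin> fst ` R \<union> snd ` R \<Longrightarrow> (p, q) \<notin> E"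
proof -
  define \<A> where "\<A> = {R. R \<subseteq> E \<and> inj_on fst R \<and> inj_on snd R}"
  have "\<exists>R\<in>\<A>. \<forall>R'\<in>\<A>. R \<subseteq> R' \<longrightarrow> R' = R"
  proof (rule subset_Zorn')
    fix \<C> assume "subset.chain \<A> \<C>"
    then have C: "\<And>R. R \<in> \<C> \<Longrightarrow> R \<subseteq> E \<and> inj_on fst R \<and> inj_on snd R"
      "\<And>R R'. R \<in> \<C> \<Longrightarrow> R' \<in> \<C> \<Longrightarrow> R \<subseteq> R' \<or> R' \<subseteq> R"
      by (auto simp: subset_chain_def \<A>_def)
    have "inj_on fst (\<Union>R\<in>\<C>. R)" "inj_on snd (\<Union>R\<in>\<C>. R)"
      by (rule inj_on_UNION_chain; use C in blast)+
    then show "\<Union>\<C> \<in> \<A>" using C by (auto simp: \<A>_def)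
  qed
  then obtain R where R: "R \<in> \<A>" "\<And>R'. R' \<in> \<A> \<Longrightarrow> R \<subseteq> R' \<Longrightarrow> R' = R" by blast
  show ?thesis
  proof (rule that)
    show "R \<subseteq> E" "inj_on fst R" "inj_on snd R" using R by (auto simp: \<A>_def)
    fix p q assume pq: "p \<notin> fst ` R \<union> snd ` R" "q \<notin> fst ` R \<union> snd ` R"
    show "(p, q) \<notin> E"
    proof
      assume "(p, q) \<in> E"
      moreover have "inj_on fst (insert (p, q) R)" "inj_on snd (insert (p, q) R)"
        using R pq by (auto simp: \<A>_def)
      ultimately have "insert (p, q) R \<in> \<A>" using R by (auto simp: \<A>_def)
      then have "(p, q) \<in> R" using R(2)[of "insert (p, q) R"] by auto
      then show False using pq by force
    qed
  qed
qed

lemma summable_on_finite_partition: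
  fixes h :: "'a \<Rightarrow> real"
  assumes "finite J" "idx ` R \<subseteq> J" "\<And>j. j \<in> J \<Longrightarrow> h summable_on {r \<in> R. idx r = j}"
  shows "h summable_on R"
proof -
  have "h summable_on (\<Union>j\<in>J'. {r \<in> R. idx r = j})" if "J' \<subseteq> J" for J'
    using finite_subset[OF that assms(1)] that
  proof (induction J' rule: finite_induct)
    case (insert j J')
    then have "h summable_on {r \<in> R. idx r = j} \<union> (\<Union>j\<in>J'. {r \<in> R. idx r = j})"
      using assms by (intro summable_on_Un_disjoint) auto
    then show ?case by simp
  qed simp
  from this[of J] show ?thesis
    using assms(2) by (auto elim!: back_subst[of "\<lambda>A. h summable_on A"])
qed

text \<open>Cut the primes into windows of logarithmic length \<open>W\<close>. Inside one window
  the hypothesis forces the primes of \<open>U\<close> of one colour into a cluster of ratio below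
  \<open>exp \<tau>\<close>, where \<open>card_clustered_primes_le\<close> applies. Summing over
  windows yields a harmonic sum with about ln N / W terms.\<close>

lemma sum_inverse_unseparated_le:
  fixes col :: "nat \<Rightarrow> 'c"
  assumes fin: "finite (col ` {p. prime p})" and W: "W > 0"
  obtains \<tau> X where "\<tau> > 0" "\<And>U N. U \<subseteq> {p. prime p} \<Longrightarrow> real N \<ge> exp W \<Longrightarrow>
     (\<And>p q. p \<in> U \<Longrightarrow> q \<in> U \<Longrightarrow> col p = col q \<Longrightarrow> ln (real q / real p) \<le> W \<Longrightarrow>
        ln (real q / real p) < \<tau>) \<Longrightarrow>
     (\<Sum>p | p \<in> U \<and> X \<le> real p \<and> p \<le> N. 1 / real p) \<le> ln (ln (real N)) / 4 + (1 + \<bar>ln W\<bar>) / 4"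
proof -
  define C where "C = col ` {p. prime p}"
  have "col 2 \<in> C" by (auto simp: C_def)
  then have k: "card C > 0" using fin by (auto simp: C_def card_gt_0_iff)
  \<comment> \<open>One colour in window m then has at most \<epsilon> exp ((m + 1) W) / (m W)
    primes with reciprocals at most exp (- m W), which amounts to 1 / (4 * card C * m). The sum over
    all colours is 1 / (4 m).\<close>
  define \<epsilon> where "\<epsilon> = W / (4 * card C * exp W)"
  have \<epsilon>: "\<epsilon> > 0" using k W by (auto simp: \<epsilon>_def)
  obtain \<tau> X0 where \<tau>: "\<tau> > 0" "X0 \<ge> 2"
    "\<And>(A::nat set) b. finite A \<Longrightarrow> A \<noteq> {} \<Longrightarrow> (\<And>p. p \<in> A \<Longrightarrow> prime p \<and> X0 \<le> real p \<and> real p \<le> b) \<Longrightarrow>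
       (\<And>p q. p \<in> A \<Longrightarrow> q \<in> A \<Longrightarrow> real q \<le> exp \<tau> * real p) \<Longrightarrow>
       real (card A) * ln (Min A) \<le> \<epsilon> * b"
    using card_clustered_primes_le[OF \<epsilon>] by blast
  define X where "X = max X0 (exp W)"
  have X: "X \<ge> X0" "X \<ge> exp W" by (auto simp: X_def)
  show ?thesis
  proof (rule that[OF \<tau>(1)])
    fix U N assume U: "U \<subseteq> {p. prime p}" and N: "real N \<ge> exp W"
      and sep: "\<And>p q. p \<in> U \<Longrightarrow> q \<in> U \<Longrightarrow> col p = col q \<Longrightarrow> ln (real q / real p) \<le> W \<Longrightarrow>
        ln (real q / real p) < \<tau>"
    \<comment> \<open>The window containing p. Since p >= X >= exp W, its index is at least 1, as
      the bound 1 / m requires.\<close>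
    define w where "w = (\<lambda>p::nat. nat \<lfloor>ln (real p) / W\<rfloor>)"
    define K where "K = w N"
    define S where "S = {p. p \<in> U \<and> X \<le> real p \<and> p \<le> N}"
    have finS: "finite S" by (rule finite_subset[of _ "{..N}"]) (auto simp: S_def)
    have wge: "real (w p) * W \<le> ln (real p)" "ln (real p) < (real (w p) + 1) * W" "w p \<ge> 1"
      if "real p \<ge> exp W" for p
    proof -
      have "ln (real p) \<ge> W" using that by (metis exp_gt_zero ln_exp ln_mono)
      then have *: "ln (real p) / W \<ge> 1" using W by simp
      then have "real (w p) \<le> ln (real p) / W" "ln (real p) / W < real (w p) + 1"
        by (auto simp: w_def)
      then show "real (w p) * W \<le> ln (real p)" "ln (real p) < (real (w p) + 1) * W"
        using W by (auto simp: field_simps)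
      show "w p \<ge> 1" using * by (simp add: w_def le_nat_iff)
    qed
    have sub: "(\<lambda>p. (w p, col p)) ` S \<subseteq> {1..K} \<times> C"
    proof (clarsimp simp: S_def)
      fix p assume p: "p \<in> U" "X \<le> real p" "p \<le> N"
      have "real p > 0" using p(2) X \<tau> by linarith
      then have "ln (real p) / W \<le> ln (real N) / W" using p W by (intro divide_right_mono) auto
      then have "w p \<le> K" unfolding w_def K_def by (intro nat_mono floor_mono)
      then show "Suc 0 \<le> w p \<and> w p \<le> K \<and> col p \<in> C"
        using wge(3)[of p] p X U by (auto simp: C_def)
    qed
    have part: "(\<Sum>p\<in>{p \<in> S. (w p, col p) = mc}. 1 / real p) \<le> 1 / (4 * card C) * (1 / real (fst mc))"
      if mc: "mc \<in> {1..K} \<times> C" for mc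
    proof -
      define m where "m = fst mc"
      define A where "A = {p \<in> S. (w p, col p) = mc}"
      have m: "m \<ge> 1" using mc by (auto simp: m_def)
      have A: "finite A" "A \<subseteq> S" using finS by (auto simp: A_def)
      have lb: "exp (real m * W) \<le> real p" "real p \<le> exp ((real m + 1) * W)" "real p > 0" if "p \<in> A" for p
      proof -
        have p: "real p \<ge> exp W" "m = w p" using that X by (auto simp: A_def S_def m_def)
        show "real p > 0" using p(1) by (meson exp_gt_zero order_less_le_trans)
        show "exp (real m * W) \<le> real p"
          using wge(1)[OF p(1)] p(2) \<open>real p > 0\<close> by (simp add: ln_ge_iff)
        show "real p \<le> exp ((real m + 1) * W)"
          using wge(2)[OF p(1)] p(2) \<open>real p > 0\<close> by (metis exp_le_cancel_iff exp_ln less_imp_le)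
      qed
      have "(\<Sum>p\<in>A. 1 / real p) \<le> (\<Sum>p\<in>A. 1 / exp (real m * W))"
        using lb by (intro sum_mono divide_left_mono) auto
      also have "\<dots> = card A / exp (real m * W)" by simp
      also have "\<dots> \<le> 1 / (4 * card C) * (1 / real m)"
      proof (cases "A = {}")
        case False
        have "real (card A) * ln (Min A) \<le> \<epsilon> * exp ((real m + 1) * W)"
        proof (rule \<tau>(3)[OF A(1) False])
          fix p assume p: "p \<in> A"
          then show "prime p \<and> X0 \<le> real p \<and> real p \<le> exp ((real m + 1) * W)"
            using U X lb by (auto simp: A_def S_def)
          fix q assume q: "q \<in> A"
          have pq: "p \<in> U" "q \<in> U" "col p = col q" "w p = m" "w q = m" "real p \<ge> exp W" "real q \<ge> exp W"
            using p q X by (auto simp: A_def S_def m_def)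
          have "ln (real q / real p) \<le> W"
            using lb(3)[OF p] lb(3)[OF q] wge(1)[OF pq(6)] wge(2)[OF pq(7)] pq
            by (simp add: ln_div algebra_simps)
          then have "ln (real q / real p) < \<tau>" using sep pq by blast
          then have "real q / real p < exp \<tau>"
            using lb(3)[OF p] lb(3)[OF q] by (metis divide_pos_pos exp_less_mono exp_ln)
          then show "real q \<le> exp \<tau> * real p" using lb(3)[OF p] by (simp add: field_simps)
        qed
        moreover have "ln (real (Min A)) \<ge> real m * W"
          using lb[of "Min A"] False A by (subst ln_ge_iff) auto
        then have "real (card A) * (real m * W) \<le> real (card A) * ln (real (Min A))"
          by (intro mult_left_mono) auto
        ultimately have "real (card A) * (real m * W) \<le> \<epsilon> * exp ((real m + 1) * W)" by linarith
        also have "\<dots> = W / (4 * card C) * exp (real m * W)"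
          by (simp add: \<epsilon>_def algebra_simps exp_add)
        finally show ?thesis using W m k by (simp add: field_simps)
      qed simp
      finally show ?thesis by (simp add: A_def m_def)
    qed
    have NW: "ln (real N) \<ge> W" using N by (metis exp_gt_zero ln_exp ln_mono)
    have K1: "K \<ge> 1" using wge(3)[OF N] by (simp add: K_def)
    have "(\<Sum>p\<in>S. 1 / real p) = (\<Sum>mc\<in>{1..K} \<times> C. \<Sum>p\<in>{p \<in> S. (w p, col p) = mc}. 1 / real p)"
      using sub finS fin by (subst sum.group) (auto simp: C_def)
    also have "\<dots> \<le> (\<Sum>mc\<in>{1..K} \<times> C. 1 / (4 * card C) * (1 / real (fst mc)))"
      by (rule sum_mono) (rule part)
    also have "\<dots> = (\<Sum>m\<in>{1..K}. \<Sum>c\<in>C. 1 / (4 * card C) * (1 / real m))"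
      by (subst sum.cartesian_product) (auto simp: case_prod_beta)
    also have "\<dots> = (\<Sum>m\<in>{1..K}. 1 / 4 * (1 / real m))"
      using k by (intro sum.cong) (auto simp: field_simps)
    also have "\<dots> = 1 / 4 * harm K"
      by (simp add: harm_def sum_distrib_left inverse_eq_divide)
    also have "harm K \<le> 1 + ln (real K)"
    proof -
      have "harm K - ln (real K) \<le> harm 1 - ln (real 1)"
        using decseqD[OF decseq_harm_diff_ln, of 0 "K - 1"] K1 by simp
      then show ?thesis by (simp add: harm_def)
    qed
    also have "ln (real K) \<le> ln (ln (real N) / W)"
      using wge(1)[OF N] K1 W by (intro ln_mono) (auto simp: K_def field_simps)
    also have "ln (ln (real N) / W) \<le> ln (ln (real N)) + \<bar>ln W\<bar>"
      using NW W by (simp add: ln_div)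
    finally have "(\<Sum>p\<in>S. 1 / real p) \<le> 1 / 4 * (1 + (ln (ln (real N)) + \<bar>ln W\<bar>))" by simp
    then show "(\<Sum>p | p \<in> U \<and> X \<le> real p \<and> p \<le> N. 1 / real p) \<le> ln (ln (real N)) / 4 + (1 + \<bar>ln W\<bar>) / 4"
      by (simp add: S_def field_simps)
  qed
qed

text \<open>If the sum over \<open>R\<close> converged, so would the reciprocal sum of all matched
  primes, because q > p in each pair. The unmatched primes contain no pair of \<open>E\<close>, so
  they contribute at most a quarter of ln ln N, and the total falls short of the half required by
  \<open>sum_inverse_primes_ge\<close>.\<close>

lemma prime_pairs_same_colour_aux:
  fixes col :: "nat \<Rightarrow> 'c"
  assumes fin: "finite (col ` {p. prime p})" and W: "W > 0"
  obtains \<tau> R where "\<tau> > 0" "inj_on fst R" "inj_on snd R"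
    "\<And>p q. (p, q) \<in> R \<Longrightarrow> prime p \<and> prime q \<and> col p = col q \<and>
      \<tau> \<le> ln (real q / real p) \<and> ln (real q / real p) \<le> W"
    "\<not> (\<lambda>r. 1 / real (fst r)) summable_on R"
proof -
  obtain \<tau> X where \<tau>: "\<tau> > 0" "\<And>U N. U \<subseteq> {p. prime p} \<Longrightarrow> real N \<ge> exp W \<Longrightarrow>
     (\<And>p q. p \<in> U \<Longrightarrow> q \<in> U \<Longrightarrow> col p = col q \<Longrightarrow> ln (real q / real p) \<le> W \<Longrightarrow>
        ln (real q / real p) < \<tau>) \<Longrightarrow>
     (\<Sum>p | p \<in> U \<and> X \<le> real p \<and> p \<le> N. 1 / real p) \<le> ln (ln (real N)) / 4 + (1 + \<bar>ln W\<bar>) / 4"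
    using sum_inverse_unseparated_le[OF assms] by blast
  define E where "E = {(p, q). prime p \<and> prime q \<and> col p = col q \<and>
      \<tau> \<le> ln (real q / real p) \<and> ln (real q / real p) \<le> W}"
  obtain R where R: "R \<subseteq> E" "inj_on fst R" "inj_on snd R"
    "\<And>p q. p \<notin> fst ` R \<union> snd ` R \<Longrightarrow> q \<notin> fst ` R \<union> snd ` R \<Longrightarrow> (p, q) \<notin> E"
    by (rule maximal_matching[of E]) (rule that)
  define D where "D = fst ` R \<union> snd ` R"
  define h where "h = (\<lambda>p::nat. 1 / real p)"
  have "\<not> (\<lambda>r. 1 / real (fst r)) summable_on R"
  proof
    assume "(\<lambda>r. 1 / real (fst r)) summable_on R"
    then have s1: "(h \<circ> fst) summable_on R" by (simp add: h_def o_def)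
    then have "h summable_on fst ` R" using R by (simp add: summable_on_reindex)
    moreover have "(h \<circ> snd) summable_on R"
    proof (rule summable_on_comparison_test[OF s1])
      fix r assume "r \<in> R"
      then have r: "prime (fst r)" "prime (snd r)" "0 < ln (real (snd r) / real (fst r))"
        using R \<tau> by (auto simp: E_def)
      have "0 < real (fst r)" "0 < real (snd r)" using r by (auto simp: prime_gt_0_nat)
      moreover from this have "real (snd r) / real (fst r) > 1" using r(3) by (simp add: ln_gt_zero_iff)
      ultimately show "(h \<circ> snd) r \<le> (h \<circ> fst) r" by (simp add: h_def field_simps)
    qed (auto simp: h_def)
    then have "h summable_on snd ` R" using R by (simp add: summable_on_reindex)
    ultimately have sD: "h summable_on D"
      unfolding D_def by (rule summable_on_union)
    define B where "B = infsum h D"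
    define B1 where "B1 = (\<Sum>p | prime p \<and> real p < X. h p)"
    define B2 where "B2 = (1 + \<bar>ln W\<bar>) / 4"
    define C0 where "C0 = B + B1 + B2"
    have finX: "finite {p. prime p \<and> real p < X}"
      by (rule finite_subset[of _ "{..nat \<lceil>X\<rceil>}"]) (auto, linarith)
    have bound: "ln (ln (real N)) \<le> 4 * C0" if N: "real N \<ge> exp W" "N \<ge> 2" for N
    proof -
      let ?A = "{p. p \<in> D \<and> p \<le> N}" and ?B = "{p. prime p \<and> real p < X}"
      let ?C = "{p. p \<in> {p. prime p} - D \<and> X \<le> real p \<and> p \<le> N}"
      have fins: "finite ?A" "finite ?C" by (auto intro: finite_subset[of _ "{..N}"])
      have "ln (ln (real N)) / 2 \<le> (\<Sum>p | prime p \<and> p \<le> N. h p)"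
        unfolding h_def by (rule sum_inverse_primes_ge[OF N(2)])
      also have "\<dots> \<le> (\<Sum>p\<in>(?A \<union> ?B) \<union> ?C. h p)"
        using fins finX by (intro sum_mono2) (auto simp: h_def)
      also have "\<dots> \<le> (\<Sum>p\<in>?A \<union> ?B. h p) + (\<Sum>p\<in>?C. h p)"
        using fins finX by (subst sum_Un) (auto simp: h_def intro!: sum_nonneg)
      also have "(\<Sum>p\<in>?A \<union> ?B. h p) \<le> (\<Sum>p\<in>?A. h p) + (\<Sum>p\<in>?B. h p)"
        using fins finX by (subst sum_Un) (auto simp: h_def intro!: sum_nonneg)
      also have "(\<Sum>p\<in>?A. h p) \<le> B"
        unfolding B_def using sD fins by (intro finite_sum_le_infsum) (auto simp: h_def)
      also have "(\<Sum>p\<in>?C. h p) \<le> ln (ln (real N)) / 4 + (1 + \<bar>ln W\<bar>) / 4"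
        unfolding h_def
      proof (rule \<tau>(2)[OF _ N(1)])
        fix p q assume "p \<in> {p. prime p} - D" "q \<in> {p. prime p} - D" "col p = col q" "ln (real q / real p) \<le> W"
        moreover from this have "(p, q) \<notin> E" using R(4) by (auto simp: D_def)
        ultimately show "ln (real q / real p) < \<tau>" by (auto simp: E_def)
      qed auto
      finally have "ln (ln (real N)) / 2 \<le> B + B1 + (ln (ln (real N)) / 4 + B2)"
        unfolding B1_def B2_def by this simp_all
      then show ?thesis unfolding C0_def by argo
    qed
    \<comment> \<open>Large enough for ln ln N > 4 * C0 and N >= exp W simultaneously.\<close>
    define N where "N = nat \<lceil>exp (exp (\<bar>4 * C0\<bar> + 1 + W))\<rceil>"
    have N1: "real N \<ge> exp (exp (\<bar>4 * C0\<bar> + 1 + W))" unfolding N_def by linarith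
    have "exp (\<bar>4 * C0\<bar> + 1 + W) \<ge> 1 + (\<bar>4 * C0\<bar> + 1 + W)" by (rule exp_ge_add_one_self)
    then have *: "exp (\<bar>4 * C0\<bar> + 1 + W) \<ge> W" "exp (\<bar>4 * C0\<bar> + 1 + W) \<ge> 1" using W by auto
    have N2: "real N \<ge> exp W" using N1 *(1) by (meson exp_le_cancel_iff order_trans)
    have "real N \<ge> exp 1" using N1 *(2) by (meson exp_le_cancel_iff order_trans)
    then have "N \<ge> 2" using exp_ge_add_one_self[of 1] by linarith
    moreover have "ln (real N) \<ge> exp (\<bar>4 * C0\<bar> + 1 + W)" using N1 by (metis exp_gt_zero ln_exp ln_mono)
    then have "ln (ln (real N)) \<ge> \<bar>4 * C0\<bar> + 1 + W" by (metis exp_gt_zero ln_exp ln_mono)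
    ultimately show False using bound[OF N2] W by linarith
  qed
  then show ?thesis using R \<tau>(1) by (intro that[of \<tau> R]) (auto simp: E_def)
qed

text \<open>Pigeonhole: cut the range of the logarithmic ratios into finitely many cells of length
  \<open>\<eta>\<close>; one of them still carries a divergent sum. The order of quantifiers is the
  point: \<open>\<tau>\<^sub>0\<close> does not depend on \<open>\<eta>\<close>.\<close>

lemma prime_pairs_same_colour:
  fixes col :: "nat \<Rightarrow> 'c"
  assumes fin: "finite (col ` {p. prime p})" and W: "W > 0"
  obtains \<tau>\<^sub>0 where "\<tau>\<^sub>0 > 0" "\<And>\<eta>. \<eta> > 0 \<Longrightarrow> \<exists>\<tau> R. \<tau>\<^sub>0 \<le> \<tau> \<and> \<tau> \<le> W \<and> inj_on fst R \<and> inj_on snd R \<and>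
    (\<forall>(p, q)\<in>R. prime p \<and> prime q \<and> col p = col q \<and>
      \<tau> \<le> ln (real q / real p) \<and> ln (real q / real p) \<le> \<tau> + \<eta>) \<and>
    \<not> (\<lambda>r. 1 / real (fst r)) summable_on R"
proof -
  obtain \<tau>0 R where R: "\<tau>0 > 0" "inj_on fst R" "inj_on snd R"
    "\<And>p q. (p, q) \<in> R \<Longrightarrow> prime p \<and> prime q \<and> col p = col q \<and>
      \<tau>0 \<le> ln (real q / real p) \<and> ln (real q / real p) \<le> W"
    "\<not> (\<lambda>r. 1 / real (fst r)) summable_on R"
    using prime_pairs_same_colour_aux[OF assms] by blast
  show ?thesis
  proof (rule that[OF R(1)])
    fix \<eta> :: real assume \<eta>: "\<eta> > 0"
    define l where "l = (\<lambda>r::nat \<times> nat. ln (real (snd r) / real (fst r)))"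
    define idx where "idx = (\<lambda>r. nat \<lfloor>(l r - \<tau>0) / \<eta>\<rfloor>)"
    define J where "J = {..nat \<lfloor>(W - \<tau>0) / \<eta>\<rfloor>}"
    have l: "\<tau>0 \<le> l r" "l r \<le> W" if "r \<in> R" for r using R(4)[of "fst r" "snd r"] that by (auto simp: l_def)
    have "idx ` R \<subseteq> J"
      using l \<eta> by (auto simp: idx_def J_def intro!: nat_mono floor_mono divide_right_mono)
    then obtain j where j: "\<not> (\<lambda>r. 1 / real (fst r)) summable_on {r \<in> R. idx r = j}"
      using summable_on_finite_partition[of J idx R "\<lambda>r. 1 / real (fst r)"] R(5) by (auto simp: J_def)
    have lj: "\<tau>0 + j * \<eta> \<le> l r" "l r \<le> \<tau>0 + j * \<eta> + \<eta>" if "r \<in> R" "idx r = j" for r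
    proof -
      have "(l r - \<tau>0) / \<eta> \<ge> 0" using l that \<eta> by auto
      then have "real j \<le> (l r - \<tau>0) / \<eta>" "(l r - \<tau>0) / \<eta> \<le> real j + 1"
        using that(2) by (auto simp: idx_def)
      then show "\<tau>0 + j * \<eta> \<le> l r" "l r \<le> \<tau>0 + j * \<eta> + \<eta>" using \<eta> by (auto simp: field_simps)
    qed
    obtain r where r: "r \<in> R" "idx r = j"
      using j by (metis (mono_tags, lifting) empty_Collect_eq summable_on_empty)
    show "\<exists>\<tau> R. \<tau>0 \<le> \<tau> \<and> \<tau> \<le> W \<and> inj_on fst R \<and> inj_on snd R \<and>
      (\<forall>(p, q)\<in>R. prime p \<and> prime q \<and> col p = col q \<and>
        \<tau> \<le> ln (real q / real p) \<and> ln (real q / real p) \<le> \<tau> + \<eta>) \<and>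
      \<not> (\<lambda>r. 1 / real (fst r)) summable_on R"
    proof (intro exI conjI)
      show "\<tau>0 \<le> \<tau>0 + j * \<eta>" using \<eta> by simp
      show "\<tau>0 + j * \<eta> \<le> W" using lj[OF r] l[OF r(1)] by linarith
      show "inj_on fst {r \<in> R. idx r = j}" "inj_on snd {r \<in> R. idx r = j}"
        using R by (auto elim!: inj_on_subset)
      show "\<forall>(p, q)\<in>{r \<in> R. idx r = j}. prime p \<and> prime q \<and> col p = col q \<and>
        \<tau>0 + j * \<eta> \<le> ln (real q / real p) \<and> ln (real q / real p) \<le> \<tau>0 + j * \<eta> + \<eta>"
      proof clarify
        fix p q assume "(p, q) \<in> R" "j = idx (p, q)"
        then show "prime p \<and> prime q \<and> col p = col q \<and>
          \<tau>0 + idx (p, q) * \<eta> \<le> ln (real q / real p) \<and> ln (real q / real p) \<le> \<tau>0 + idx (p, q) * \<eta> + \<eta>"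
          using R(4)[of p q] lj[of "(p, q)"] by (auto simp: l_def)
      qed
      show "\<not> (\<lambda>r. 1 / real (fst r)) summable_on {r \<in> R. idx r = j}" by (rule j)
    qed
  qed
qed

section \<open>The Turan-Kubilius inequality\<close>

text \<open>A real argument lets the scales \<open>x / p\<close> and \<open>exp \<tau> * x\<close>
  be used without rounding, and dividing by x itself makes the mean over the multiples of p an exact
  dilation of a mean at \<open>x / p\<close>.\<close>

definition avg :: "(nat \<Rightarrow> 'b::real_normed_vector) \<Rightarrow> real \<Rightarrow> 'b" where
  "avg g x = (1 / x) *\<^sub>R (\<Sum>n\<in>{1..nat \<lfloor>x\<rfloor>}. g n)"

text \<open>The new terms and the change of normalisation each contribute 1 - x / y <= ln (y / x),
  whence the factor 2. The summand 1 / y comes from the at most y - x + 1 integers in the half-open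
  interval from x to y.\<close>

lemma avg_lipschitz:
  assumes g: "\<And>n. norm (g n) \<le> C" and x: "0 < x" "x \<le> y"
  shows "norm (avg g y - avg g x) \<le> C * (2 * ln (y / x) + 1 / y)"
proof -
  have C: "C \<ge> 0" using g[of 0] norm_ge_zero order_trans by blast
  define M N where "M = nat \<lfloor>x\<rfloor>" and "N = nat \<lfloor>y\<rfloor>"
  have MN: "M \<le> N" "real M \<le> x" "real N \<le> y" "x < real M + 1"
    using x by (auto simp: M_def N_def intro!: nat_mono floor_mono)
  define A B where "A = (\<Sum>n\<in>{1..M}. g n)" and "B = (\<Sum>n\<in>{M<..N}. g n)"
  have AB: "(\<Sum>n\<in>{1..N}. g n) = A + B"
    unfolding A_def B_def using MN by (subst sum.union_disjoint[symmetric]) (auto intro!: sum.cong)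
  have "norm A \<le> (\<Sum>n\<in>{1..M}. C)" unfolding A_def using g by (intro sum_norm_le) auto
  then have nA: "norm A \<le> x * C" using MN C by (auto intro: order_trans mult_right_mono)
  have "norm B \<le> (\<Sum>n\<in>{M<..N}. C)" unfolding B_def using g by (intro sum_norm_le) auto
  also have "\<dots> = (real N - real M) * C" using MN by (simp add: of_nat_diff)
  also have "\<dots> \<le> (y - x + 1) * C" using MN C by (intro mult_right_mono) auto
  finally have nB: "norm B \<le> (y - x + 1) * C" .
  have le: "1 - x / y \<le> ln (y / x)"
    using ln_le_minus_one[of "x / y"] x by (simp add: ln_div)
  have "avg g y - avg g x = (1 / y) *\<^sub>R B - (1 / x - 1 / y) *\<^sub>R A"
    unfolding avg_def M_def[symmetric] N_def[symmetric] AB A_def[symmetric]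
    by (simp add: algebra_simps)
  also have "norm \<dots> \<le> norm ((1 / y) *\<^sub>R B) + norm ((1 / x - 1 / y) *\<^sub>R A)"
    by (rule norm_triangle_ineq4)
  also have "norm ((1 / y) *\<^sub>R B) \<le> (1 / y) * ((y - x + 1) * C)"
    using nB x by (auto intro!: mult_left_mono divide_right_mono)
  also have "norm ((1 / x - 1 / y) *\<^sub>R A) = (1 / x - 1 / y) * norm A"
    using x by (simp add: field_simps)
  also have "\<dots> \<le> (1 / x - 1 / y) * (x * C)"
    using nA x by (intro mult_left_mono) (auto simp: field_simps)
  also have "(1 / y) * ((y - x + 1) * C) + (1 / x - 1 / y) * (x * C) = C * (2 * (1 - x / y) + 1 / y)"
    using x by (simp add: field_simps)
  also have "\<dots> \<le> C * (2 * ln (y / x) + 1 / y)"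
    using le C by (intro mult_left_mono) auto
  finally show ?thesis by simp
qed

lemma sum_over_multiples:
  fixes h :: "nat \<Rightarrow> 'b::comm_monoid_add"
  assumes "d > 0"
  shows "(\<Sum>n\<in>{1..N}. if d dvd n then h n else 0) = (\<Sum>m\<in>{1..N div d}. h (d * m))"
proof -
  have eq: "{n \<in> {1..N}. d dvd n} = times d ` {1..N div d}"
  proof (intro equalityI subsetI)
    fix n assume n: "n \<in> {n \<in> {1..N}. d dvd n}"
    then obtain k where k: "n = d * k" by auto
    have "1 \<le> k" using n k by (cases k) auto
    moreover have "k \<le> N div d" using n k assms by (auto simp: less_eq_div_iff_mult_less_eq mult.commute)
    ultimately show "n \<in> times d ` {1..N div d}" using k by auto
  qed (use assms in \<open>auto simp: less_eq_div_iff_mult_less_eq mult.commute Suc_le_eq\<close>)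
  have "(\<Sum>n\<in>{1..N}. if d dvd n then h n else 0) = (\<Sum>n\<in>{n \<in> {1..N}. d dvd n}. h n)"
    by (rule sum.inter_filter[symmetric]) simp
  also have "\<dots> = (\<Sum>m\<in>{1..N div d}. h (d * m))"
    unfolding eq using assms by (subst sum.reindex) (auto simp: inj_on_def)
  finally show ?thesis .
qed

text \<open>The index set is abstract so that one set of pairs can serve twice, through its first
  and its second coordinates. The weights allow the two resulting sums to be given the same
  coefficients.\<close>

locale weighted_primes =
  fixes I :: "'i set" and \<pi> :: "'i \<Rightarrow> nat" and c :: "'i \<Rightarrow> real"
  assumes fin: "finite I" and inj: "inj_on \<pi> I" and pr: "\<And>i. i \<in> I \<Longrightarrow> prime (\<pi> i)"
    and c: "\<And>i. i \<in> I \<Longrightarrow> 0 \<le> c i \<and> c i \<le> 1"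
begin

definition L :: real where "L = (\<Sum>i\<in>I. c i / real (\<pi> i))"

text \<open>A weighted count of the prime divisors of n among the \<open>\<pi> i\<close>; its mean
  value over n is \<open>L\<close>.\<close>

definition w :: "nat \<Rightarrow> real" where "w n = (\<Sum>i\<in>I. if \<pi> i dvd n then c i else 0)"

lemma pi_pos: "i \<in> I \<Longrightarrow> \<pi> i > 0"
  using pr prime_gt_0_nat by blast

lemma L_nonneg: "L \<ge> 0"
  unfolding L_def using c by (auto intro!: sum_nonneg divide_nonneg_nonneg)

lemma sum_w_ge: "real N * L - real (card I) \<le> (\<Sum>n\<in>{1..N}. w n)"
proof -
  have "real N * L - real (card I) = (\<Sum>i\<in>I. real N * (c i / real (\<pi> i)) - 1)"
    by (simp add: L_def sum_distrib_left sum_subtractf)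
  also have "\<dots> \<le> (\<Sum>i\<in>I. c i * real (N div \<pi> i))"
  proof (rule sum_mono)
    fix i assume i: "i \<in> I"
    have "real N / real (\<pi> i) - 1 \<le> real (N div \<pi> i)"
      using floor_divide_of_nat_eq[of N "\<pi> i", where ?'a = real] by linarith
    then have "c i * (real N / real (\<pi> i) - 1) \<le> c i * real (N div \<pi> i)"
      using c[OF i] by (intro mult_left_mono) auto
    then show "real N * (c i / real (\<pi> i)) - 1 \<le> c i * real (N div \<pi> i)"
      using c[OF i] by (simp add: algebra_simps)
  qed
  also have "\<dots> = (\<Sum>i\<in>I. \<Sum>n\<in>{1..N}. if \<pi> i dvd n then c i else 0)"
  proof (rule sum.cong[OF refl])
    fix i assume "i \<in> I"
    then show "c i * real (N div \<pi> i) = (\<Sum>n\<in>{1..N}. if \<pi> i dvd n then c i else 0)"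
      using sum_over_multiples[OF pi_pos, of i "\<lambda>_. c i" N] by (simp add: mult.commute)
  qed
  also have "\<dots> = (\<Sum>n\<in>{1..N}. w n)" unfolding w_def by (rule sum.swap)
  finally show ?thesis .
qed

text \<open>Two distinct primes divide n iff their product does, so the off-diagonal terms stay
  below N L^2. The diagonal adds at most N L because c_i^2 <= c_i.\<close>

lemma sum_w_square_le: "(\<Sum>n\<in>{1..N}. (w n)\<^sup>2) \<le> real N * (L\<^sup>2 + L)"
proof -
  have cnt: "(\<Sum>n\<in>{1..N}. if \<pi> i dvd n \<and> \<pi> j dvd n then c i * c j else 0)
      \<le> real N * (c i / real (\<pi> i) * (c j / real (\<pi> j)) + (if i = j then c i / real (\<pi> i) else 0))"
    (is "?l \<le> _") if ij: "i \<in> I" "j \<in> I" for i j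
  proof (cases "i = j")
    case True
    have "?l = real (N div \<pi> i) * (c i * c i)"
      using sum_over_multiples[OF pi_pos[OF ij(1)], of "\<lambda>_. c i * c i" N] unfolding True by simp
    also have "\<dots> \<le> (real N / real (\<pi> i)) * (c i * 1)"
      using c[OF ij(1)] by (intro mult_mono) (auto simp: of_nat_div_le_of_nat)
    also have "\<dots> \<le> real N * (c i / real (\<pi> i) * (c j / real (\<pi> j)) + c i / real (\<pi> i))"
      using c[OF ij(1)] c[OF ij(2)] by (simp add: algebra_simps)
    finally show ?thesis using True by simp
  next
    case False
    then have "coprime (\<pi> i) (\<pi> j)" using pr ij inj by (auto intro!: primes_coprime dest: inj_onD)
    then have eq: "\<pi> i dvd n \<and> \<pi> j dvd n \<longleftrightarrow> \<pi> i * \<pi> j dvd n" for n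
      by (metis divides_mult dvd_mult_left dvd_mult_right)
    have "?l = real (N div (\<pi> i * \<pi> j)) * (c i * c j)"
      unfolding eq using sum_over_multiples[of "\<pi> i * \<pi> j" "\<lambda>_. c i * c j" N] pi_pos ij by simp
    also have "\<dots> \<le> (real N / real (\<pi> i * \<pi> j)) * (c i * c j)"
      using c[OF ij(1)] c[OF ij(2)] by (intro mult_right_mono of_nat_div_le_of_nat) auto
    finally show ?thesis using False by (simp add: algebra_simps)
  qed
  have "(\<Sum>n\<in>{1..N}. (w n)\<^sup>2) = (\<Sum>n\<in>{1..N}. \<Sum>i\<in>I. \<Sum>j\<in>I. if \<pi> i dvd n \<and> \<pi> j dvd n then c i * c j else 0)"
    unfolding w_def power2_eq_square sum_product by (intro sum.cong refl) auto
  also have "\<dots> = (\<Sum>i\<in>I. \<Sum>j\<in>I. \<Sum>n\<in>{1..N}. if \<pi> i dvd n \<and> \<pi> j dvd n then c i * c j else 0)"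
    by (subst sum.swap, intro sum.cong refl, subst sum.swap) simp
  also have "\<dots> \<le> (\<Sum>i\<in>I. \<Sum>j\<in>I. real N * (c i / real (\<pi> i) * (c j / real (\<pi> j)) + (if i = j then c i / real (\<pi> i) else 0)))"
    by (intro sum_mono cnt)
  also have "\<dots> = real N * ((\<Sum>i\<in>I. \<Sum>j\<in>I. c i / real (\<pi> i) * (c j / real (\<pi> j))) +
      (\<Sum>i\<in>I. \<Sum>j\<in>I. if i = j then c i / real (\<pi> i) else 0))"
    by (simp only: sum_distrib_left[symmetric] sum.distrib)
  also have "\<dots> = real N * (L\<^sup>2 + L)"
    using fin by (simp add: L_def power2_eq_square sum_product)
  finally show ?thesis .
qed

text \<open>On expanding the square, the terms N L^2 cancel, leaving a variance of order L. This
  combines the upper bound for the second moment with the lower bound for the first.\<close>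

lemma turan_kubilius: "(\<Sum>n\<in>{1..N}. (w n - L)\<^sup>2) \<le> real N * L + 2 * L * real (card I)"
proof -
  have "(\<Sum>n\<in>{1..N}. (w n - L)\<^sup>2) = (\<Sum>n\<in>{1..N}. (w n)\<^sup>2) - 2 * L * (\<Sum>n\<in>{1..N}. w n) + real N * L\<^sup>2"
    by (simp add: power2_diff sum.distrib sum_subtractf sum_distrib_left algebra_simps)
  also have "\<dots> \<le> real N * (L\<^sup>2 + L) - 2 * L * (real N * L - real (card I)) + real N * L\<^sup>2"
    using sum_w_square_le sum_w_ge L_nonneg by (intro add_mono diff_mono mult_left_mono) auto
  finally show ?thesis by (simp add: algebra_simps power2_eq_square)
qed

text \<open>The difference is the mean of (L - w n) g n, and Cauchy-Schwarz bounds it by C times the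
  square root of the variance. An error of order sqrt L stands against a main term of order L, so it
  becomes negligible once L is large.\<close>

lemma avg_approx:
  fixes g :: "nat \<Rightarrow> 'b::real_normed_vector"
  assumes g: "\<And>n. norm (g n) \<le> C"
  shows "\<forall>\<^sub>F x in at_top. norm (L *\<^sub>R avg g x -
     (\<Sum>i\<in>I. (c i / real (\<pi> i)) *\<^sub>R avg (\<lambda>m. g (\<pi> i * m)) (x / real (\<pi> i)))) \<le> C * sqrt (L + 1)"
  \<comment> \<open>From this threshold on, the rounding error 2 L \<open>card I\<close> of
    \<open>turan_kubilius\<close> is at most N, which turns the variance bound into N (L +
    1).\<close>
  using eventually_ge_at_top[of "max 1 (2 * L * real (card I) + 1)"]
proof eventually_elim
  case (elim x)
  have C: "C \<ge> 0" using g[of 0] norm_ge_zero order_trans by blast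
  define N where "N = nat \<lfloor>x\<rfloor>"
  have N: "real N \<le> x" "2 * L * real (card I) \<le> real N" "1 \<le> N"
    using elim unfolding N_def by (linarith, linarith, simp add: le_nat_iff)
  have summand: "(c i / real (\<pi> i)) *\<^sub>R avg (\<lambda>m. g (\<pi> i * m)) (x / real (\<pi> i)) =
      (1 / x) *\<^sub>R (\<Sum>n\<in>{1..N}. (if \<pi> i dvd n then c i else 0) *\<^sub>R g n)" if "i \<in> I" for i
  proof -
    have "\<lfloor>x / real (\<pi> i)\<rfloor> = \<lfloor>x\<rfloor> div int (\<pi> i)"
      using floor_divide_real_eq_div[of "int (\<pi> i)" x] by simp
    then have fl: "nat \<lfloor>x / real (\<pi> i)\<rfloor> = N div \<pi> i"
      unfolding N_def using elim by (simp add: nat_div_distrib)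
    have "(\<Sum>n\<in>{1..N}. (if \<pi> i dvd n then c i else 0) *\<^sub>R g n) =
      (\<Sum>n\<in>{1..N}. if \<pi> i dvd n then c i *\<^sub>R g n else 0)" by (intro sum.cong) auto
    also have "\<dots> = (\<Sum>m\<in>{1..N div \<pi> i}. c i *\<^sub>R g (\<pi> i * m))"
      using pi_pos[OF that] by (rule sum_over_multiples)
    finally show ?thesis
      using pi_pos[OF that] by (simp add: avg_def fl flip: scaleR_sum_right)
  qed
  have "L *\<^sub>R avg g x - (\<Sum>i\<in>I. (c i / real (\<pi> i)) *\<^sub>R avg (\<lambda>m. g (\<pi> i * m)) (x / real (\<pi> i)))
    = L *\<^sub>R avg g x - (\<Sum>i\<in>I. (1 / x) *\<^sub>R (\<Sum>n\<in>{1..N}. (if \<pi> i dvd n then c i else 0) *\<^sub>R g n))"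
    using summand by simp
  also have "(\<Sum>i\<in>I. (1 / x) *\<^sub>R (\<Sum>n\<in>{1..N}. (if \<pi> i dvd n then c i else 0) *\<^sub>R g n)) =
      (1 / x) *\<^sub>R (\<Sum>n\<in>{1..N}. w n *\<^sub>R g n)"
    unfolding w_def scaleR_sum_left by (subst sum.swap) (simp add: scaleR_sum_right)
  also have "L *\<^sub>R avg g x - (1 / x) *\<^sub>R (\<Sum>n\<in>{1..N}. w n *\<^sub>R g n) = (1 / x) *\<^sub>R (\<Sum>n\<in>{1..N}. (L - w n) *\<^sub>R g n)"
    by (simp add: avg_def N_def[symmetric] scaleR_diff_left sum_subtractf scaleR_diff_right scaleR_sum_right mult.commute)
  also have "norm \<dots> \<le> (1 / x) * (C * sqrt (real N * (real N * (L + 1))))"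
  proof -
    have "norm (\<Sum>n\<in>{1..N}. (L - w n) *\<^sub>R g n) \<le> (\<Sum>n\<in>{1..N}. \<bar>w n - L\<bar> * C)"
      using g by (intro sum_norm_le) (auto intro!: mult_mono simp: abs_minus_commute)
    also have "\<dots> = C * (\<Sum>n\<in>{1..N}. \<bar>w n - L\<bar>)" by (simp add: sum_distrib_left mult.commute)
    also have "(\<Sum>n\<in>{1..N}. \<bar>w n - L\<bar>) \<le> sqrt (real N * (real N * (L + 1)))"
    proof (rule real_le_rsqrt)
      have "(\<Sum>n\<in>{1..N}. \<bar>w n - L\<bar>)\<^sup>2 \<le> real N * (\<Sum>n\<in>{1..N}. (w n - L)\<^sup>2)"
        using Cauchy_Schwarz_ineq_sum[of "\<lambda>_. 1" "\<lambda>n. \<bar>w n - L\<bar>" "{1..N}"] by simp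
      also have "\<dots> \<le> real N * (real N * (L + 1))"
        using turan_kubilius[of N] N by (intro mult_left_mono) (auto simp: algebra_simps)
      finally show "(\<Sum>n\<in>{1..N}. \<bar>w n - L\<bar>)\<^sup>2 \<le> real N * (real N * (L + 1))" .
    qed
    finally show ?thesis using C elim by (auto intro!: mult_left_mono divide_right_mono)
  qed
  also have "sqrt (real N * (real N * (L + 1))) = real N * sqrt (L + 1)"
    by (simp add: real_sqrt_mult)
  also have "(1 / x) * (C * (real N * sqrt (L + 1))) = (real N / x) * (C * sqrt (L + 1))" by simp
  also have "\<dots> \<le> 1 * (C * sqrt (L + 1))"
    using N elim C L_nonneg by (intro mult_right_mono) auto
  finally show ?case by simp
qed

end

section \<open>Slow variation of multiplicative means\<close>

lemma nonsummable_finite_sum_ge: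
  fixes h :: "'a \<Rightarrow> real"
  assumes "\<not> h summable_on A" "\<And>x. x \<in> A \<Longrightarrow> h x \<ge> 0"
  obtains B where "finite B" "B \<subseteq> A" "sum h B \<ge> K"
proof (rule ccontr)
  assume "\<not> thesis"
  then have *: "sum h B \<le> K" if "finite B" "B \<subseteq> A" for B
    using that \<open>\<And>B. \<lbrakk>finite B; B \<subseteq> A; K \<le> sum h B\<rbrakk> \<Longrightarrow> thesis\<close>[of B] by linarith
  have "h summable_on A"
  proof (rule nonneg_bdd_above_summable_on)
    show "bdd_above (sum h ` {F. F \<subseteq> A \<and> finite F})"
      using * by (auto intro!: bdd_aboveI[of _ K])
  qed (use assms in auto)
  then show False using assms by simp
qed

lemma sqrt_div_le:
  fixes L \<epsilon> :: real
  assumes "\<epsilon> > 0" "L \<ge> 1" "L \<ge> 2 / \<epsilon>\<^sup>2"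
  shows "sqrt (L + 1) \<le> \<epsilon> * L"
proof (rule real_le_lsqrt)
  have "2 \<le> \<epsilon>\<^sup>2 * L" using assms by (simp add: field_simps)
  then have "2 * L \<le> \<epsilon>\<^sup>2 * L * L" using assms by (intro mult_right_mono) auto
  moreover have "(\<epsilon> * L)\<^sup>2 = \<epsilon>\<^sup>2 * L * L" by (simp add: power2_eq_square)
  ultimately show "L + 1 \<le> (\<epsilon> * L)\<^sup>2" using assms by linarith
qed (use assms in auto)

text \<open>For the twisted orbit of a vector, the mean of g (p * m) is an isometry T_p applied to
  the mean of g, and T_p depends only on the colour of p. \<open>compat\<close> states the
  consequence of this that the argument uses, without naming operators.\<close>

locale multiplicative_sequence =
  fixes g :: "nat \<Rightarrow> 'b::real_normed_vector" and C :: real and col :: "nat \<Rightarrow> 'c"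
  assumes bounded: "norm (g n) \<le> C"
    and finite_col: "finite (col ` {p. prime p})"
    and compat: "prime p \<Longrightarrow> prime q \<Longrightarrow> col p = col q \<Longrightarrow>
      norm (avg (\<lambda>m. g (p * m)) x - avg (\<lambda>m. g (q * m)) y) \<le> norm (avg g x - avg g y)"
begin

lemma C_nonneg: "C \<ge> 0"
  using bounded[of 0] norm_ge_zero order_trans by blast

text \<open>Apply \<open>avg_approx\<close> at x over the primes p and at exp \<tau> * x over the
  primes q. The scales x / p and exp \<tau> * x / q agree up to a factor exp \<eta>. The constant is
  5 = 1 + 3 + 1: an error \<eta> from each approximation, and 3 \<eta> from
  \<open>avg_lipschitz\<close>.\<close>

lemma avg_near_shift:
  assumes R: "inj_on fst R" "inj_on snd R"
    "\<And>p q. (p, q) \<in> R \<Longrightarrow> prime p \<and> prime q \<and> col p = col q \<and>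
      \<tau> \<le> ln (real q / real p) \<and> ln (real q / real p) \<le> \<tau> + \<eta>"
    "\<not> (\<lambda>r. 1 / real (fst r)) summable_on R" and \<eta>: "\<eta> > 0"
  shows "\<forall>\<^sub>F x in at_top. norm (avg g x - avg g (exp \<tau> * x)) \<le> 5 * C * \<eta>"
proof -
  \<comment> \<open>As q / p <= exp (\<tau> + \<eta>), this factor keeps the weights \<kappa> * q /
    p at most 1. It must be the same for all pairs so that the sum over \<open>I\<close> can be made
    large enough to compensate for it.\<close>
  define \<kappa> where "\<kappa> = exp (- \<bar>\<tau>\<bar> - \<eta>)"
  have \<kappa>: "0 < \<kappa>" "\<kappa> \<le> 1" using \<eta> by (auto simp: \<kappa>_def)
  obtain I where I: "finite I" "I \<subseteq> R" "(\<Sum>r\<in>I. 1 / real (fst r)) \<ge> max 1 (2 / \<eta>\<^sup>2) / \<kappa>"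
    using nonsummable_finite_sum_ge[OF R(4)] by auto
  \<comment> \<open>Makes c r / q = \<kappa> / p: the two Turan-Kubilius sums get the same
    coefficients and the same total \<open>L\<close>.\<close>
  define c where "c = (\<lambda>r::nat \<times> nat. \<kappa> * (real (snd r) / real (fst r)))"
  have RI: "prime (fst r)" "prime (snd r)" "col (fst r) = col (snd r)"
    "\<tau> \<le> ln (real (snd r) / real (fst r))" "ln (real (snd r) / real (fst r)) \<le> \<tau> + \<eta>" 
    "real (fst r) > 0" "real (snd r) > 0" if "r \<in> I" for r
  proof -
    have "(fst r, snd r) \<in> R" using that I by auto
    from R(3)[OF this] show "prime (fst r)" "prime (snd r)" "col (fst r) = col (snd r)"
    "\<tau> \<le> ln (real (snd r) / real (fst r))" "ln (real (snd r) / real (fst r)) \<le> \<tau> + \<eta>"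
      "real (fst r) > 0" "real (snd r) > 0" by (auto simp: prime_gt_0_nat)
  qed
  have ratio: "exp \<tau> \<le> real (snd r) / real (fst r)" "real (snd r) / real (fst r) \<le> exp (\<tau> + \<eta>)" if "r \<in> I" for r
    using RI(4-7)[OF that] by (metis divide_pos_pos exp_le_cancel_iff exp_ln)+
  have c1: "0 \<le> c r \<and> c r \<le> 1" if "r \<in> I" for r
  proof -
    have "c r \<le> \<kappa> * exp (\<tau> + \<eta>)" unfolding c_def using ratio[OF that] \<kappa> by (intro mult_left_mono) auto
    also have "\<dots> \<le> 1" by (simp add: \<kappa>_def flip: exp_add)
    finally show ?thesis using \<kappa> by (simp add: c_def)
  qed
  interpret A: weighted_primes I fst "\<lambda>_. \<kappa>"
    using I R \<kappa> RI by unfold_locales (auto elim: inj_on_subset)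
  interpret B: weighted_primes I snd c
    using I R c1 RI by unfold_locales (auto elim: inj_on_subset)
  define L where "L = A.L"
  have AL: "A.L = L" by (simp add: L_def)
  have BL: "B.L = L" unfolding L_def A.L_def B.L_def
    using RI by (intro sum.cong) (auto simp: c_def)
  have "L = \<kappa> * (\<Sum>r\<in>I. 1 / real (fst r))" by (simp add: L_def A.L_def sum_distrib_left)
  also have "\<dots> \<ge> \<kappa> * (max 1 (2 / \<eta>\<^sup>2) / \<kappa>)" using I(3) \<kappa> by (intro mult_left_mono) auto
  finally have L: "L \<ge> 1" "L \<ge> 2 / \<eta>\<^sup>2" using \<kappa> by auto
  have sq: "sqrt (L + 1) \<le> \<eta> * L" by (rule sqrt_div_le) (use L \<eta> in auto)
  \<comment> \<open>Bounds the primes p in \<open>I\<close>; for x >= K / \<eta> the rounding term p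
    / x of \<open>avg_lipschitz\<close> is at most \<eta>.\<close>
  define K where "K = Max (insert 1 ((\<lambda>r. real (fst r)) ` I))"
  have K: "real (fst r) \<le> K" if "r \<in> I" for r using that I by (auto simp: K_def)
  define a where "a = (\<lambda>(r :: nat \<times> nat) x. avg (\<lambda>m. g (fst r * m)) (x / real (fst r)))"
  define b where "b = (\<lambda>(r :: nat \<times> nat) x. avg (\<lambda>m. g (snd r * m)) (exp \<tau> * x / real (snd r)))"
  have "\<forall>\<^sub>F x in at_top. norm (L *\<^sub>R avg g x - (\<Sum>r\<in>I. (\<kappa> / real (fst r)) *\<^sub>R a r x)) \<le> C * sqrt (L + 1)"
    using A.avg_approx[of g C, OF bounded] by (simp add: AL a_def)
  moreover have "\<forall>\<^sub>F x in at_top. norm (L *\<^sub>R avg g (exp \<tau> * x) - (\<Sum>r\<in>I. (\<kappa> / real (fst r)) *\<^sub>R b r x)) \<le> C * sqrt (L + 1)"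
  proof -
    have "filterlim (\<lambda>x. exp \<tau> * x) at_top (at_top :: real filter)"
      by (rule filterlim_tendsto_pos_mult_at_top[OF tendsto_const _ filterlim_ident]) auto
    from eventually_compose_filterlim[OF B.avg_approx[of g C, OF bounded] this]
    have "\<forall>\<^sub>F x in at_top. norm (L *\<^sub>R avg g (exp \<tau> * x) - (\<Sum>r\<in>I. (c r / real (snd r)) *\<^sub>R b r x)) \<le> C * sqrt (L + 1)"
      by (simp add: BL b_def)
    moreover have "(\<Sum>r\<in>I. (c r / real (snd r)) *\<^sub>R b r x) = (\<Sum>r\<in>I. (\<kappa> / real (fst r)) *\<^sub>R b r x)" for x
      using RI by (intro sum.cong) (auto simp: c_def)
    ultimately show ?thesis by simp
  qed
  moreover have "\<forall>\<^sub>F x in at_top. x \<ge> max 1 (K / \<eta>)" by (rule eventually_ge_at_top)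
  ultimately show ?thesis
  proof eventually_elim
    case (elim x)
    have x: "x > 0" "K \<le> \<eta> * x" using elim(3) \<eta> by (auto simp: field_simps)
    have ab: "norm (a r x - b r x) \<le> C * (3 * \<eta>)" if r: "r \<in> I" for r
    proof -
      \<comment> \<open>v / u is q / p divided by exp \<tau>, so it lies between 1 and exp
        \<eta>.\<close>
      define u v where "u = exp \<tau> * x / real (snd r)" and "v = x / real (fst r)"
      have uv: "u > 0" "v > 0" using x RI(6,7)[OF r] by (auto simp: u_def v_def)
      have vu: "v / u = real (snd r) / real (fst r) / exp \<tau>" using x RI(6,7)[OF r] by (simp add: u_def v_def)
      have "u \<le> v" using ratio(1)[OF r] RI(6,7)[OF r] x by (simp add: u_def v_def field_simps)
      have "norm (a r x - b r x) \<le> norm (avg g v - avg g u)"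
        unfolding a_def b_def u_def[symmetric] v_def[symmetric] using RI[OF r] by (intro compat)
      also have "\<dots> \<le> C * (2 * ln (v / u) + 1 / v)" by (rule avg_lipschitz[OF bounded uv(1) \<open>u \<le> v\<close>])
      also have "\<dots> \<le> C * (3 * \<eta>)"
      proof (intro mult_left_mono C_nonneg)
        have "ln (v / u) \<le> \<eta>" unfolding vu using RI(4-7)[OF r] by (simp add: ln_div ln_mult)
        moreover have "1 / v \<le> \<eta>" using K[OF r] x RI(6)[OF r] by (simp add: v_def field_simps)
        ultimately show "2 * ln (v / u) + 1 / v \<le> 3 * \<eta>" by simp
      qed
      finally show ?thesis .
    qed
    let ?A = "\<Sum>r\<in>I. (\<kappa> / real (fst r)) *\<^sub>R a r x" and ?B = "\<Sum>r\<in>I. (\<kappa> / real (fst r)) *\<^sub>R b r x"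
    have "norm (?A - ?B) = norm (\<Sum>r\<in>I. (\<kappa> / real (fst r)) *\<^sub>R (a r x - b r x))"
      by (simp add: sum_subtractf scaleR_diff_right)
    also have "\<dots> \<le> (\<Sum>r\<in>I. (\<kappa> / real (fst r)) * (C * (3 * \<eta>)))"
      using ab \<kappa> by (intro sum_norm_le) (auto intro!: divide_right_mono mult_left_mono)
    also have "\<dots> = L * (C * (3 * \<eta>))" by (simp add: L_def A.L_def sum_distrib_right)
    finally have AB: "norm (?A - ?B) \<le> L * (C * (3 * \<eta>))" .
    have "norm (L *\<^sub>R (avg g x - avg g (exp \<tau> * x))) =
       norm ((L *\<^sub>R avg g x - ?A) + (?A - ?B) - (L *\<^sub>R avg g (exp \<tau> * x) - ?B))"
      by (simp add: scaleR_diff_right)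
    also have "\<dots> \<le> norm (L *\<^sub>R avg g x - ?A) + norm (?A - ?B) + norm (L *\<^sub>R avg g (exp \<tau> * x) - ?B)"
      using norm_triangle_ineq4[of "(L *\<^sub>R avg g x - ?A) + (?A - ?B)" "L *\<^sub>R avg g (exp \<tau> * x) - ?B"]
        norm_triangle_ineq[of "L *\<^sub>R avg g x - ?A" "?A - ?B"] by linarith
    also have "\<dots> \<le> C * sqrt (L + 1) + L * (C * (3 * \<eta>)) + C * sqrt (L + 1)"
      using elim AB by (intro add_mono)
    also have "\<dots> \<le> C * (\<eta> * L) + L * (C * (3 * \<eta>)) + C * (\<eta> * L)"
      using sq C_nonneg L by (intro add_mono mult_left_mono) auto
    also have "\<dots> = L * (5 * C * \<eta>)" by (simp add: algebra_simps)
    finally show ?case using L by simp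
  qed
qed

text \<open>Same-coloured primes \<open>p, q\<close> with \<open>q / p\<close> close to \<open>exp \<tau>\<close> make the averages almost invariant
  under \<open>x \<mapsto> exp \<tau> * x\<close>; since \<open>\<tau>\<close> can be taken arbitrarily small, iterating gives every shift.\<close>

lemma avg_slowly_varying:
  assumes s: "s \<ge> 0"
  shows "((\<lambda>x. avg g (exp s * x) - avg g x) \<longlongrightarrow> 0) at_top"
proof -
  have "\<forall>\<^sub>F x in at_top. norm (avg g (exp s * x) - avg g x) < \<epsilon>" if "\<epsilon> > 0" for \<epsilon>
  proof -
    \<comment> \<open>Error budget: C * 3 W for the last, incomplete shift and C * 5 W for the
      complete ones. Since 8 * C < 9 * (C + 1), the total stays strictly below \<epsilon>, even when
      C = 0.\<close>
    define W where "W = \<epsilon> / (9 * (C + 1))"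
    have W: "W > 0" using that C_nonneg by (simp add: W_def)
    obtain \<tau>0 where \<tau>0: "\<tau>0 > 0" "\<And>\<eta>. \<eta> > 0 \<Longrightarrow> \<exists>\<tau> R. \<tau>0 \<le> \<tau> \<and> \<tau> \<le> W \<and> inj_on fst R \<and> inj_on snd R \<and>
      (\<forall>(p, q)\<in>R. prime p \<and> prime q \<and> col p = col q \<and>
        \<tau> \<le> ln (real q / real p) \<and> ln (real q / real p) \<le> \<tau> + \<eta>) \<and>
      \<not> (\<lambda>r. 1 / real (fst r)) summable_on R"
      by (rule prime_pairs_same_colour[OF finite_col W]) (rule that)
    \<comment> \<open>At most s / \<open>\<tau>0\<close> shifts occur, each costing 5 * C * \<eta>;
      with this \<eta> they cost at most 5 * C * W together. The choice is legitimate because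
      \<open>\<tau>0\<close> was fixed first.\<close>
    define \<eta> where "\<eta> = W * \<tau>0 / (s + 1)"
    have \<eta>: "\<eta> > 0" using W \<tau>0 s by (simp add: \<eta>_def)
    obtain \<tau> R where \<tau>: "\<tau>0 \<le> \<tau>" "\<tau> \<le> W" and R: "inj_on fst R" "inj_on snd R"
      "\<forall>(p, q)\<in>R. prime p \<and> prime q \<and> col p = col q \<and>
        \<tau> \<le> ln (real q / real p) \<and> ln (real q / real p) \<le> \<tau> + \<eta>"
      "\<not> (\<lambda>r. 1 / real (fst r)) summable_on R"
      using \<tau>0(2)[OF \<eta>] by (elim exE conjE) (rule that)
    have "\<forall>\<^sub>F x in at_top. norm (avg g x - avg g (exp \<tau> * x)) \<le> 5 * C * \<eta>"
      by (rule avg_near_shift[OF R(1,2) _ R(4) \<eta>]) (use R(3) in auto)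
    then obtain X where X: "\<And>x. x \<ge> X \<Longrightarrow> norm (avg g x - avg g (exp \<tau> * x)) \<le> 5 * C * \<eta>"
      by (auto simp: eventually_at_top_linorder)
    \<comment> \<open>The number of complete shifts. The remaining factor exp (s - J * \<tau>) is at
      most exp W and is handled by \<open>avg_lipschitz\<close>.\<close>
    define J where "J = nat \<lfloor>s / \<tau>\<rfloor>"
    have \<tau>pos: "\<tau> > 0" using \<tau> \<tau>0 by simp
    have J: "real J \<le> s / \<tau>" "s / \<tau> < real J + 1" using s \<tau>pos by (auto simp: J_def)
    have iter: "norm (avg g x - avg g (exp (real j * \<tau>) * x)) \<le> real j * (5 * C * \<eta>)" if "x \<ge> max X 0" for j x
    proof (induction j)
      case (Suc j)
      have "x * 1 \<le> x * exp (real j * \<tau>)" using that \<tau>pos by (intro mult_left_mono) auto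
      then have "exp (real j * \<tau>) * x \<ge> X" using that by (simp add: mult.commute)
      from X[OF this] have st: "norm (avg g (exp (real j * \<tau>) * x) - avg g (exp (real (Suc j) * \<tau>) * x)) \<le> 5 * C * \<eta>"
        by (simp add: algebra_simps exp_add)
      then show ?case using Suc norm_diff_triangle_le[OF Suc st] by (simp add: algebra_simps)
    qed simp
    show ?thesis
      using eventually_ge_at_top[of "max (max X 1) (1 / W)"]
    proof eventually_elim
      case (elim x)
      define y where "y = exp (real J * \<tau>) * x"
      have x: "x \<ge> max X 0" "x > 0" "1 / x \<le> W" using elim W by (auto simp: field_simps)
      have y0: "y > 0" using x by (simp add: y_def)
      have Js: "real J * \<tau> \<le> s" "s < (real J + 1) * \<tau>" using J \<tau>pos by (auto simp: field_simps)
      have y: "y \<le> exp s * x" using Js x by (simp add: y_def)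
      have "norm (avg g (exp s * x) - avg g y) \<le> C * (2 * ln (exp s * x / y) + 1 / (exp s * x))"
        by (rule avg_lipschitz[OF bounded y0 y])
      also have "exp s * x / y = exp (s - real J * \<tau>)" using x by (simp add: y_def exp_diff)
      also have "C * (2 * ln (exp (s - real J * \<tau>)) + 1 / (exp s * x)) \<le> C * (3 * W)"
      proof (intro mult_left_mono C_nonneg)
        have "x \<le> exp s * x" using s x by simp
        then have "1 / (exp s * x) \<le> 1 / x" using x by (intro divide_left_mono) auto
        moreover have "s - real J * \<tau> \<le> W" using Js \<tau> by (simp add: algebra_simps)
        ultimately show "2 * ln (exp (s - real J * \<tau>)) + 1 / (exp s * x) \<le> 3 * W" using x by simp
      qed
      finally have 1: "norm (avg g (exp s * x) - avg g y) \<le> C * (3 * W)" .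
      have "norm (avg g y - avg g x) \<le> real J * (5 * C * \<eta>)"
        using iter[OF x(1), of J] by (simp add: y_def norm_minus_commute)
      also have "\<dots> \<le> (s / \<tau>0) * (5 * C * \<eta>)"
      proof (intro mult_right_mono)
        have "s / \<tau> \<le> s / \<tau>0" using s \<tau> \<tau>0 \<tau>pos by (intro divide_left_mono) auto
        then show "real J \<le> s / \<tau>0" using J by linarith
      qed (use C_nonneg \<eta> in auto)
      also have "\<dots> = (5 * C * W) * (s / (s + 1))" using \<tau>0 s by (simp add: \<eta>_def)
      also have "\<dots> \<le> (5 * C * W) * 1" using s C_nonneg W by (intro mult_left_mono) auto
      finally have 2: "norm (avg g y - avg g x) \<le> C * (5 * W)" by (simp add: algebra_simps)
      have "norm (avg g (exp s * x) - avg g x) \<le> C * (3 * W) + C * (5 * W)"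
        by (rule norm_diff_triangle_le[OF 1 2])
      also have "\<dots> = (8 * C) * W" by simp
      also have "\<dots> < (9 * (C + 1)) * W" using C_nonneg W by (intro mult_strict_right_mono) auto
      also have "\<dots> = \<epsilon>" using C_nonneg by (simp add: W_def)
      finally show ?case .
    qed
  qed
  then show ?thesis by (auto simp: tendsto_iff dist_norm)
qed

text \<open>All primes p of the colour act like p0, and slow variation replaces the scale x / p by
  x. Hence every term of the Turan-Kubilius sum is close to the same vector, and dividing by L
  identifies it with the mean.\<close>

theorem avg_invariant:
  assumes p0: "prime p0" and heavy: "\<not> (\<lambda>p. 1 / real p) summable_on {p. prime p \<and> col p = col p0}"
  shows "((\<lambda>x. avg (\<lambda>m. g (p0 * m)) x - avg g x) \<longlongrightarrow> 0) at_top"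
proof -
  have "\<forall>\<^sub>F x in at_top. norm (avg (\<lambda>m. g (p0 * m)) x - avg g x) < \<epsilon>" if \<epsilon>: "\<epsilon> > 0" for \<epsilon>
  proof -
    define \<delta> where "\<delta> = \<epsilon> / (2 * (C + 2))"
    have \<delta>: "\<delta> > 0" using \<epsilon> C_nonneg by (simp add: \<delta>_def)
    obtain I where I: "finite I" "I \<subseteq> {p. prime p \<and> col p = col p0}" "(\<Sum>p\<in>I. 1 / real p) \<ge> max 1 (2 / \<delta>\<^sup>2)"
      by (rule nonsummable_finite_sum_ge[OF heavy]) (simp, rule that)
    interpret weighted_primes I "\<lambda>p. p" "\<lambda>_. 1"
      using I by unfold_locales auto
    have L: "L \<ge> 1" "L \<ge> 2 / \<delta>\<^sup>2" using I(3) by (auto simp: L_def)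
    have sq: "sqrt (L + 1) \<le> \<delta> * L" by (rule sqrt_div_le) (use L \<delta> in auto)
    define a where "a = (\<lambda>p x. avg (\<lambda>m. g (p * m)) (x / real p))"
    define a0 where "a0 = (\<lambda>x. avg (\<lambda>m. g (p0 * m)) x)"
    have "\<forall>\<^sub>F x in at_top. norm (L *\<^sub>R avg g x - (\<Sum>p\<in>I. (1 / real p) *\<^sub>R a p x)) \<le> C * sqrt (L + 1)"
      using avg_approx[of g C, OF bounded] by (simp add: a_def)
    moreover have "\<forall>\<^sub>F x in at_top. \<forall>p\<in>I. norm (a p x - a0 x) < \<delta>"
    proof (subst eventually_ball_finite_distrib[OF I(1)], intro ballI)
      fix p assume p: "p \<in> I"
      have p1: "real p \<ge> 1" using I(2) p prime_ge_1_nat[of p] by auto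
      have "filterlim (\<lambda>x. (1 / real p) * x) at_top (at_top :: real filter)"
        using p1 by (intro filterlim_tendsto_pos_mult_at_top[OF tendsto_const _ filterlim_ident]) auto
      \<comment> \<open>Slow variation with s = ln p, started at x / p, leads back to x.\<close>
      then have "((\<lambda>x. avg g (exp (ln (real p)) * ((1 / real p) * x)) - avg g ((1 / real p) * x)) \<longlongrightarrow> 0) at_top"
        using p1 by (intro filterlim_compose[OF avg_slowly_varying]) auto
      then have "\<forall>\<^sub>F x in at_top. norm (avg g x - avg g (x / real p)) < \<delta>"
        using p1 \<delta> by (simp add: tendsto_iff dist_norm)
      then show "\<forall>\<^sub>F x in at_top. norm (a p x - a0 x) < \<delta>"
      proof eventually_elim
        case (elim x)
        have "norm (a p x - a0 x) \<le> norm (avg g (x / real p) - avg g x)"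
          unfolding a_def a0_def using p I p0 by (intro compat) auto
        then show ?case using elim by (simp add: norm_minus_commute)
      qed
    qed
    ultimately show ?thesis
    proof eventually_elim
      case (elim x)
      let ?A = "\<Sum>p\<in>I. (1 / real p) *\<^sub>R a p x"
      have "norm (?A - L *\<^sub>R a0 x) = norm (\<Sum>p\<in>I. (1 / real p) *\<^sub>R (a p x - a0 x))"
        by (simp add: L_def scaleR_sum_left sum_subtractf scaleR_diff_right)
      also have "\<dots> \<le> (\<Sum>p\<in>I. (1 / real p) * \<delta>)"
      proof (rule sum_norm_le)
        fix p assume "p \<in> I"
        then have "norm (a p x - a0 x) \<le> \<delta>" using elim(2) by (simp add: less_imp_le)
        then show "norm ((1 / real p) *\<^sub>R (a p x - a0 x)) \<le> 1 / real p * \<delta>"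
          by (simp add: divide_right_mono)
      qed
      also have "\<dots> = L * \<delta>" by (simp add: L_def sum_distrib_right sum_divide_distrib)
      finally have 2: "norm (?A - L *\<^sub>R a0 x) \<le> L * \<delta>" .
      have "norm (L *\<^sub>R (avg g x - a0 x)) \<le> C * sqrt (L + 1) + L * \<delta>"
        using norm_diff_triangle_le[OF elim(1) 2] by (simp add: scaleR_diff_right)
      also have "\<dots> \<le> C * (\<delta> * L) + L * \<delta>" using sq C_nonneg L by (intro add_mono mult_left_mono) auto
      finally have "\<bar>L\<bar> * norm (avg g x - a0 x) \<le> C * (\<delta> * L) + L * \<delta>" unfolding norm_scaleR .
      then have "L * norm (avg g x - a0 x) \<le> L * ((C + 1) * \<delta>)" using L by (simp add: algebra_simps)
      then have "norm (avg g x - a0 x) \<le> (C + 1) * \<delta>" using L by simp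
      also have "\<dots> < (2 * (C + 2)) * \<delta>" using C_nonneg \<delta> by (intro mult_strict_right_mono) auto
      also have "\<dots> = \<epsilon>" using C_nonneg by (simp add: \<delta>_def)
      finally show ?case by (simp add: a0_def norm_minus_commute)
    qed
  qed
  then show ?thesis by (auto simp: tendsto_iff dist_norm)
qed

end

section \<open>Integers free of a thin set of primes\<close>

lemma real_div_nat_tendsto:
  assumes "q > 0"
  shows "(\<lambda>N. real (N div q) / real N) \<longlonglongrightarrow> 1 / real q"
proof (rule tendsto_sandwich)
  show "\<forall>\<^sub>F N in sequentially. 1 / real q - 1 / real N \<le> real (N div q) / real N"
    using eventually_gt_at_top[of 0]
  proof eventually_elim
    case (elim N)
    have "real N / real q - 1 \<le> real (N div q)"
      using floor_divide_of_nat_eq[of N q, where ?'a = real] by linarith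
    then have "(real N / real q - 1) / real N \<le> real (N div q) / real N"
      by (rule divide_right_mono) simp
    then show ?case using elim by (simp add: diff_divide_distrib)
  qed
  show "\<forall>\<^sub>F N in sequentially. real (N div q) / real N \<le> 1 / real q"
    using eventually_gt_at_top[of 0]
  proof eventually_elim
    case (elim N)
    have "real (N div q) \<le> real N / real q" by (rule of_nat_div_le_of_nat)
    then have "real (N div q) / real N \<le> real N / real q / real N"
      by (rule divide_right_mono) simp
    then show ?case using elim by simp
  qed
  show "(\<lambda>N. 1 / real q - 1 / real N) \<longlonglongrightarrow> 1 / real q"
    using tendsto_diff[OF tendsto_const[of "1 / real q"] lim_1_over_n] by simp
qed simp

lemma filterlim_div_nat:
  assumes "q > (0::nat)"
  shows "filterlim (\<lambda>N. N div q) at_top sequentially"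
  unfolding filterlim_at_top
proof
  fix Z
  show "\<forall>\<^sub>F N in sequentially. Z \<le> N div q"
    using eventually_ge_at_top[of "Z * q"]
    by eventually_elim (use assms in \<open>simp add: less_eq_div_iff_mult_less_eq\<close>)
qed

lemma Q_set_mult_prime:
  assumes "n \<in> Q_set A" "prime p" "p \<notin> A"
  shows "p * n \<in> Q_set A"
proof -
  have "1 \<le> p * n" using assms prime_gt_0_nat[of p] by (simp add: Q_set_def Suc_le_eq)
  moreover have "q \<notin> A" if q: "prime q" "q dvd p * n" for q
  proof (cases "q dvd p")
    case True
    then have "q = p" using q assms primes_dvd_imp_eq by blast
    then show ?thesis using assms by simp
  next
    case False
    then have "q dvd n" using q prime_dvd_multD by blast
    then show ?thesis using assms q by (auto simp: Q_set_def)
  qed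
  ultimately show ?thesis by (auto simp: Q_set_def)
qed

definition Q_count :: "nat set \<Rightarrow> nat \<Rightarrow> nat" where
  "Q_count P N = card (Q_set P \<inter> {1..N})"

lemma Q_count_le: "Q_count P N \<le> N"
  unfolding Q_count_def using card_mono[of "{1..N}" "Q_set P \<inter> {1..N}"] by simp

lemma density_scaled:
  assumes "(\<lambda>N. real (Q_count P N) / real N) \<longlonglongrightarrow> \<delta>" "q > 0"
  shows "(\<lambda>N. real (Q_count P (N div q)) / real N) \<longlonglongrightarrow> \<delta> / real q"
proof -
  have lim: "(\<lambda>N. real (Q_count P (N div q)) / real (N div q) * (real (N div q) / real N)) \<longlonglongrightarrow> \<delta> * (1 / real q)"
    by (intro tendsto_mult real_div_nat_tendsto assms filterlim_compose[OF assms(1)] filterlim_div_nat)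
  \<comment> \<open>Cancelling \<open>N div q\<close> is problematic only when it is 0, and then the
    count is 0 as well.\<close>
  have "(\<lambda>N. real (Q_count P (N div q)) / real (N div q) * (real (N div q) / real N)) =
      (\<lambda>N. real (Q_count P (N div q)) / real N)"
  proof
    fix N
    show "real (Q_count P (N div q)) / real (N div q) * (real (N div q) / real N) =
      real (Q_count P (N div q)) / real N"
      using Q_count_le[of P "N div q"] by (cases "N div q = 0") auto
  qed
  then show ?thesis using lim by simp
qed

text \<open>The Legendre sieve, one prime at a time: as q is not in \<open>P\<close>, the multiples
  of q free of \<open>P\<close> up to N are q times the integers free of \<open>P\<close> up to
  \<open>N div q\<close>.\<close>

lemma Q_density_finite:
  assumes "finite P" "\<And>p. p \<in> P \<Longrightarrow> prime p"
  shows "(\<lambda>N. real (Q_count P N) / real N) \<longlonglongrightarrow> (\<Prod>p\<in>P. 1 - 1 / real p)"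
  using assms
proof (induction P rule: finite_induct)
  case empty
  have "Q_count {} N = N" for N
  proof -
    have "Q_set {} \<inter> {1..N} = {1..N}" by (auto simp: Q_set_def)
    then show ?thesis by (simp add: Q_count_def)
  qed
  moreover have "\<forall>\<^sub>F N in sequentially. real N / real N = 1"
    using eventually_gt_at_top[of 0] by eventually_elim simp
  ultimately show ?case by (simp add: tendsto_eventually)
next
  case (insert q P)
  have q: "prime q" "q > 0" using insert prime_gt_0_nat by auto
  have IH: "(\<lambda>N. real (Q_count P N) / real N) \<longlonglongrightarrow> (\<Prod>p\<in>P. 1 - 1 / real p)" using insert by auto
  have cnt: "real (Q_count (insert q P) N) = real (Q_count P N) - real (Q_count P (N div q))" for N
  proof -
    have sub: "times q ` (Q_set P \<inter> {1..N div q}) \<subseteq> Q_set P \<inter> {1..N}"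
    proof clarify
      fix k assume k: "k \<in> Q_set P" "k \<in> {1..N div q}"
      have "q * k \<le> N" using k q by (auto simp: less_eq_div_iff_mult_less_eq mult.commute)
      moreover have "q * k \<in> Q_set P" using k(1) q(1) insert(2) by (rule Q_set_mult_prime)
      ultimately show "q * k \<in> Q_set P \<inter> {1..N}" by (auto simp: Q_set_def)
    qed
    have eq: "Q_set (insert q P) \<inter> {1..N} = Q_set P \<inter> {1..N} - times q ` (Q_set P \<inter> {1..N div q})"
    proof (intro equalityI subsetI)
      fix n assume n: "n \<in> Q_set P \<inter> {1..N} - times q ` (Q_set P \<inter> {1..N div q})"
      have "\<not> q dvd n"
      proof
        assume "q dvd n"
        then obtain k where k: "n = q * k" by (elim dvdE)
        have "k \<in> Q_set P" using n k by (auto simp: Q_set_def)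
        moreover have "1 \<le> k" using n k by (cases k) auto
        moreover have "k \<le> N div q" using n k q by (auto simp: less_eq_div_iff_mult_less_eq mult.commute)
        ultimately show False using n k by auto
      qed
      then show "n \<in> Q_set (insert q P) \<inter> {1..N}" using n by (auto simp: Q_set_def)
    qed (use q in \<open>auto simp: Q_set_def\<close>)
    have "card (Q_set (insert q P) \<inter> {1..N}) =
        card (Q_set P \<inter> {1..N}) - card (times q ` (Q_set P \<inter> {1..N div q}))"
      unfolding eq using sub by (intro card_Diff_subset) auto
    moreover have "card (times q ` (Q_set P \<inter> {1..N div q})) = Q_count P (N div q)"
      unfolding Q_count_def using q by (intro card_image) (auto simp: inj_on_def)
    moreover have "card (times q ` (Q_set P \<inter> {1..N div q})) \<le> card (Q_set P \<inter> {1..N})"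
      using sub by (intro card_mono) auto
    ultimately show ?thesis by (simp add: Q_count_def of_nat_diff)
  qed
  have "(\<lambda>N. real (Q_count P N) / real N - real (Q_count P (N div q)) / real N) \<longlonglongrightarrow>
      (\<Prod>p\<in>P. 1 - 1 / real p) - (\<Prod>p\<in>P. 1 - 1 / real p) / real q"
    using q by (intro tendsto_diff IH density_scaled)
  then show ?case using insert by (simp add: cnt diff_divide_distrib algebra_simps)
qed

text \<open>Truncate \<open>P\<close> at a bound K. The large primes of \<open>P\<close> remove at
  most N * sum 1 / p integers up to N, which is small uniformly in N; this justifies letting K grow
  after N. The factor 1 off \<open>P\<close> allows an ordinary product over all naturals.\<close>

lemma
  fixes P :: "nat set"
  assumes P: "P \<subseteq> {p. prime p}" and s: "(\<lambda>p. 1 / real p) summable_on P"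
  defines "fac \<equiv> \<lambda>p. if p \<in> P then 1 - 1 / real p else 1"
  shows convergent_prod_euler: "convergent_prod fac"
    and Q_density: "(\<lambda>N. real (Q_count P N) / real N) \<longlonglongrightarrow> (\<Prod>p. fac p)"
proof -
  define h where "h = (\<lambda>p. if p \<in> P then 1 / real p else 0)"
  have "h summable_on UNIV \<longleftrightarrow> (\<lambda>p. 1 / real p) summable_on P"
    by (rule summable_on_cong_neutral) (auto simp: h_def)
  then have "h summable_on UNIV" using s by simp
  then have sh: "summable h" using summable_on_UNIV_nonneg_real_iff[of h] by (auto simp: h_def)
  have "norm (fac p - 1) = h p" for p by (simp add: fac_def h_def)
  then have "summable (\<lambda>p. norm (fac p - 1))" using sh by simp
  then show cp: "convergent_prod fac"
    using abs_convergent_prod_conv_summable[of fac] abs_convergent_prod_imp_convergent_prod[of fac] by simp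
  have lim: "(\<lambda>n. \<Prod>i\<le>n. fac i) \<longlonglongrightarrow> (\<Prod>p. fac p)"
    by (rule convergent_prod_LIMSEQ[OF cp])
  show "(\<lambda>N. real (Q_count P N) / real N) \<longlonglongrightarrow> (\<Prod>p. fac p)"
  proof (rule LIMSEQ_I)
    fix e :: real assume e: "e > 0"
    have "\<exists>K. \<forall>m\<ge>K. \<forall>n. norm (sum h {m..<n}) < e / 3"
      using sh[unfolded summable_Cauchy, rule_format, of "e / 3"] e by simp
    then obtain K1 where K1: "\<And>m n. m \<ge> K1 \<Longrightarrow> norm (sum h {m..<n}) < e / 3" by metis
    have "\<exists>K. \<forall>n\<ge>K. norm ((\<Prod>i\<le>n. fac i) - (\<Prod>p. fac p)) < e / 3"
      by (rule LIMSEQ_D[OF lim]) (use e in simp)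
    then obtain K2 where K2: "\<And>n. n \<ge> K2 \<Longrightarrow> norm ((\<Prod>i\<le>n. fac i) - (\<Prod>p. fac p)) < e / 3" by metis
    define K where "K = max K1 K2"
    define PK where "PK = P \<inter> {..K}"
    have "(\<Prod>p\<in>PK. 1 - 1 / real p) = (\<Prod>i\<le>K. fac i)"
      unfolding PK_def fac_def by (subst prod.inter_restrict[symmetric]) (auto simp: Int_commute)
    moreover have "(\<lambda>N. real (Q_count PK N) / real N) \<longlonglongrightarrow> (\<Prod>p\<in>PK. 1 - 1 / real p)"
      using P by (intro Q_density_finite) (auto simp: PK_def)
    ultimately have "(\<lambda>N. real (Q_count PK N) / real N) \<longlonglongrightarrow> (\<Prod>i\<le>K. fac i)" by (simp only:)
    then have "\<exists>K'. \<forall>N\<ge>K'. norm (real (Q_count PK N) / real N - (\<Prod>i\<le>K. fac i)) < e / 3"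
      by (rule LIMSEQ_D) (use e in simp)
    then obtain N0 where N0: "\<And>N. N \<ge> N0 \<Longrightarrow> norm (real (Q_count PK N) / real N - (\<Prod>i\<le>K. fac i)) < e / 3" by metis
    have diff: "\<bar>real (Q_count P N) / real N - real (Q_count PK N) / real N\<bar> \<le> e / 3" if N: "N > 0" for N
    proof -
      have sub: "Q_set P \<inter> {1..N} \<subseteq> Q_set PK \<inter> {1..N}" by (auto simp: Q_set_def PK_def)
      \<comment> \<open>An integer lost in passing from the truncated set to \<open>P\<close> has a
        divisor in \<open>P\<close> that exceeds K and is at most N.\<close>
      have "Q_set PK \<inter> {1..N} - Q_set P \<inter> {1..N} \<subseteq> (\<Union>p\<in>P \<inter> {K<..N}. {n \<in> {1..N}. p dvd n})"
      proof
        fix n assume n: "n \<in> Q_set PK \<inter> {1..N} - Q_set P \<inter> {1..N}"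
        then obtain p where p: "prime p" "p dvd n" "p \<in> P" "p \<notin> PK" by (auto simp: Q_set_def)
        moreover have "p \<le> N" using n p by (auto dest!: dvd_imp_le)
        ultimately show "n \<in> (\<Union>p\<in>P \<inter> {K<..N}. {n \<in> {1..N}. p dvd n})" using n by (auto simp: PK_def)
      qed
      then have "card (Q_set PK \<inter> {1..N} - Q_set P \<inter> {1..N}) \<le> card (\<Union>p\<in>P \<inter> {K<..N}. {n \<in> {1..N}. p dvd n})"
        by (intro card_mono) auto
      also have "\<dots> \<le> (\<Sum>p\<in>P \<inter> {K<..N}. card {n \<in> {1..N}. p dvd n})"
        by (rule card_UN_le) simp
      also have "\<dots> = (\<Sum>p\<in>P \<inter> {K<..N}. N div p)"
      proof (rule sum.cong[OF refl])
        fix p assume "p \<in> P \<inter> {K<..N}"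
        then show "card {n \<in> {1..N}. p dvd n} = N div p"
          using sum_over_multiples[of p "\<lambda>_. 1::nat" N] by (simp add: sum.inter_filter[symmetric])
      qed
      finally have "real (card (Q_set PK \<inter> {1..N} - Q_set P \<inter> {1..N})) \<le> (\<Sum>p\<in>P \<inter> {K<..N}. real (N div p))"
        by (metis of_nat_le_iff of_nat_sum)
      also have "\<dots> \<le> (\<Sum>p\<in>P \<inter> {K<..N}. real N * h p)"
        by (intro sum_mono) (auto simp: h_def intro: order_trans[OF of_nat_div_le_of_nat])
      also have "\<dots> = real N * (\<Sum>p\<in>P \<inter> {K<..N}. h p)" by (simp add: sum_distrib_left)
      also have "(\<Sum>p\<in>P \<inter> {K<..N}. h p) \<le> sum h {K..<Suc N}"
        by (rule sum_mono2) (auto simp: h_def)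
      also have "sum h {K..<Suc N} \<le> e / 3" using K1[of K "Suc N"] by (auto simp: K_def)
      finally have "real (card (Q_set PK \<inter> {1..N} - Q_set P \<inter> {1..N})) \<le> real N * (e / 3)"
        by (simp add: mult_left_mono)
      moreover have "real (Q_count PK N) - real (Q_count P N) = real (card (Q_set PK \<inter> {1..N} - Q_set P \<inter> {1..N}))"
        unfolding Q_count_def using sub card_mono[OF _ sub] by (subst card_Diff_subset) (auto simp: of_nat_diff)
      ultimately show ?thesis using N by (simp add: field_simps abs_le_iff)
    qed
    have "K \<ge> K2" by (simp add: K_def)
    have "norm (real (Q_count P N) / real N - (\<Prod>p. fac p)) < e" if "N \<ge> max N0 1" for N
    proof -
      have N: "N > 0" "N \<ge> N0" using that by auto
      show ?thesis
        using diff[OF N(1)] N0[OF N(2)] K2[OF \<open>K \<ge> K2\<close>] unfolding real_norm_def by linarith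
    qed
    then show "\<exists>no. \<forall>N\<ge>no. norm (real (Q_count P N) / real N - (\<Prod>p. fac p)) < e" by blast
  qed
qed

section \<open>Splitting integers into a part built from P and a part free of P\<close>

lemma summable_inverse_smooth:
  fixes P :: "nat set"
  assumes P: "P \<subseteq> {p. prime p}" and s: "(\<lambda>p. 1 / real p) summable_on P"
  shows "(\<lambda>n. 1 / real n) summable_on Q_set ({p. prime p} - P)"
proof (rule nonneg_bdd_above_summable_on)
  define S where "S = (\<Sum>\<^sub>\<infinity>p\<in>P. 1 / real p)"
  show "bdd_above (sum (\<lambda>n. 1 / real n) ` {B. B \<subseteq> Q_set ({p. prime p} - P) \<and> finite B})"
  proof (rule bdd_aboveI2)
    fix B assume "B \<in> {B. B \<subseteq> Q_set ({p. prime p} - P) \<and> finite B}"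
    then have B: "B \<subseteq> Q_set ({p. prime p} - P)" "finite B" by auto
    define N where "N = Max (insert 0 B)"
    have N: "n \<le> N" if "n \<in> B" for n using that B by (auto simp: N_def)
    \<comment> \<open>A finite set of smooth integers involves only the primes of \<open>P\<close>
      up to its maximum, so the finite Euler product bounds its sum, with exp (2 * S) as a bound
      common to all finite sets.\<close>
    define PN where "PN = P \<inter> {..N}"
    have PN: "finite PN" "\<And>p. p \<in> PN \<Longrightarrow> prime p" using P by (auto simp: PN_def)
    have "B \<subseteq> Q_set ({p. prime p} - PN) \<inter> {..N}"
      using B N by (auto simp: Q_set_def PN_def subset_iff) (meson Suc_le_lessD dvd_imp_le le_trans)
    then have "sum (\<lambda>n. 1 / real n) B \<le> (\<Sum>n\<in>Q_set ({p. prime p} - PN) \<inter> {..N}. 1 / real n)"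
      by (intro sum_mono2) auto
    also have "\<dots> \<le> (\<Prod>p\<in>PN. 1 / (1 - 1 / real p))" using PN by (rule sum_inverse_smooth_le)
    also have "\<dots> \<le> exp (2 * (\<Sum>p\<in>PN. 1 / real p))" using PN by (rule prod_euler_le_exp)
    also have "(\<Sum>p\<in>PN. 1 / real p) \<le> S"
      unfolding S_def using s PN by (intro finite_sum_le_infsum) (auto simp: PN_def)
    finally show "sum (\<lambda>n. 1 / real n) B \<le> exp (2 * S)" by simp
  qed
qed auto

lemma Q_set_factorization:
  assumes "n \<ge> 1"
  obtains m l where "n = m * l" "m \<in> Q_set ({p. prime p} - P)" "l \<in> Q_set P"
proof -
  have "\<exists>m l. n = m * l \<and> m \<in> Q_set ({p. prime p} - P) \<and> l \<in> Q_set P"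
    using assms
  proof (induction n rule: less_induct)
    case (less n)
    show ?case
    proof (cases "n = 1")
      case True
      then show ?thesis by (intro exI[of _ 1]) (auto simp: Q_set_def)
    next
      case False
      then obtain p where p: "prime p" "p dvd n" using prime_factor_nat by blast
      then obtain k where k: "n = p * k" by (elim dvdE)
      have k1: "1 \<le> k" using k less.prems by (cases k) auto
      have "k < n" unfolding k using k1 prime_gt_1_nat[OF p(1)] by simp
      from less.IH[OF this k1] obtain m l where
        ml: "k = m * l" "m \<in> Q_set ({p. prime p} - P)" "l \<in> Q_set P" by blast
      show ?thesis
      proof (cases "p \<in> P")
        case True
        have "p * m \<in> Q_set ({p. prime p} - P)"
          using ml(2) p(1) by (rule Q_set_mult_prime) (use True in simp)
        then show ?thesis using ml k by (intro exI[of _ "p * m"] exI[of _ l]) auto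
      next
        case False
        have "p * l \<in> Q_set P"
          using ml(3) p(1) False by (rule Q_set_mult_prime)
        then show ?thesis using ml k by (intro exI[of _ m] exI[of _ "p * l"]) auto
      qed
    qed
  qed
  then show ?thesis using that by blast
qed

lemma coprime_Q_set:
  assumes "m \<in> Q_set ({p. prime p} - P)" "l \<in> Q_set P"
  shows "coprime m l"
proof (rule ccontr)
  assume "\<not> coprime m l"
  then have "gcd m l \<noteq> 1" by (simp add: coprime_iff_gcd_eq_1)
  then obtain p where "prime p" "p dvd gcd m l" using prime_factor_nat by blast
  then show False using assms by (auto simp: Q_set_def)
qed

lemma Q_set_factorization_unique:
  assumes "m \<in> Q_set ({p. prime p} - P)" "l \<in> Q_set P" "m' \<in> Q_set ({p. prime p} - P)" "l' \<in> Q_set P"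
    and eq: "m * l = m' * l'"
  shows "m = m'" "l = l'"
proof -
  have "m dvd m' * l'" "m' dvd m * l" using eq by (metis dvd_triv_left)+
  then have "m dvd m'" "m' dvd m"
    using coprime_Q_set assms coprime_dvd_mult_left_iff by blast+
  then show "m = m'" by (rule dvd_antisym)
  then show "l = l'" using eq assms(1) by (auto simp: Q_set_def)
qed

text \<open>Group the n by their part m built from \<open>P\<close>. The cofactor l is free of
  \<open>P\<close> and runs up to \<open>N div m\<close>, and y ignores it.\<close>

lemma sum_group_smooth_part:
  fixes y :: "nat \<Rightarrow> 'b::real_vector"
  assumes y: "\<And>m l. m \<in> Q_set ({p. prime p} - P) \<Longrightarrow> l \<in> Q_set P \<Longrightarrow> y (m * l) = y m"
  shows "(\<Sum>n\<in>{1..N}. y n) = (\<Sum>m\<in>Q_set ({p. prime p} - P) \<inter> {1..N}. real (Q_count P (N div m)) *\<^sub>R y m)"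
proof -
  let ?Q = "Q_set ({p. prime p} - P)"
  define D where "D = (SIGMA m:?Q \<inter> {1..N}. Q_set P \<inter> {1..N div m})"
  have "bij_betw (\<lambda>(m, l). m * l) D {1..N}"
  proof (rule bij_betwI')
    fix a b assume "a \<in> D" "b \<in> D"
    then show "((case a of (m, l) \<Rightarrow> m * l) = (case b of (m, l) \<Rightarrow> m * l)) = (a = b)"
      using Q_set_factorization_unique[of "fst a" P "snd a" "fst b" "snd b"]
      by (auto simp: D_def prod_eq_iff)
  next
    fix a assume "a \<in> D"
    then show "(case a of (m, l) \<Rightarrow> m * l) \<in> {1..N}"
      by (auto simp: D_def less_eq_div_iff_mult_less_eq mult.commute Suc_le_eq)
  next
    fix n assume n: "n \<in> {1..N}"
    then obtain m l where ml: "n = m * l" "m \<in> ?Q" "l \<in> Q_set P" using Q_set_factorization[of n P] by auto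
    then have pos: "m \<ge> 1" "l \<ge> 1" by (auto simp: Q_set_def)
    have "m \<le> n" using ml(1) pos by simp
    then have "m \<le> N" using n by simp
    moreover have "l \<le> N div m" using ml n pos by (auto simp: less_eq_div_iff_mult_less_eq mult.commute)
    ultimately have "(m, l) \<in> D" using ml n pos by (auto simp: D_def)
    then show "\<exists>a\<in>D. n = (case a of (m, l) \<Rightarrow> m * l)" using ml by force
  qed
  then have "(\<Sum>n\<in>{1..N}. y n) = (\<Sum>a\<in>D. y (case a of (m, l) \<Rightarrow> m * l))"
    by (rule sum.reindex_bij_betw[symmetric])
  also have "\<dots> = (\<Sum>a\<in>D. case a of (m, l) \<Rightarrow> y m)"
    using y by (intro sum.cong) (auto simp: D_def)
  also have "\<dots> = (\<Sum>m\<in>?Q \<inter> {1..N}. \<Sum>l\<in>Q_set P \<inter> {1..N div m}. y m)"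
    unfolding D_def by (rule sum.Sigma[symmetric]) auto
  also have "\<dots> = (\<Sum>m\<in>?Q \<inter> {1..N}. real (Q_count P (N div m)) *\<^sub>R y m)"
    by (simp add: Q_count_def sum_constant_scaleR)
  finally show ?thesis .
qed

text \<open>Dominated convergence for series: after grouping, the coefficient of y m is
  \<open>d m N\<close>, which tends to \<delta> / m and is dominated by the summable 1 / m.\<close>

theorem mean_value_light:
  fixes y :: "nat \<Rightarrow> 'b::real_normed_vector"
  assumes P: "P \<subseteq> {p. prime p}" and s: "(\<lambda>p. 1 / real p) summable_on P"
    and y: "\<And>m l. m \<in> Q_set ({p. prime p} - P) \<Longrightarrow> l \<in> Q_set P \<Longrightarrow> y (m * l) = y m"
    and bounded: "\<And>n. norm (y n) \<le> C"
    and Y: "((\<lambda>m. (1 / real m) *\<^sub>R y m) has_sum Y) (Q_set ({p. prime p} - P))"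
  defines "\<delta> \<equiv> \<Prod>p. if p \<in> P then 1 - 1 / real p else 1"
  shows "(\<lambda>N. (1 / real N) *\<^sub>R (\<Sum>n\<in>{1..N}. y n)) \<longlonglongrightarrow> \<delta> *\<^sub>R Y"
proof -
  define Q where "Q = Q_set ({p. prime p} - P)"
  have C: "C \<ge> 0" using bounded[of 0] norm_ge_zero order_trans by blast
  define d where "d = (\<lambda>m N. real (Q_count P (N div m)) / real N)"
  have d: "d m \<longlonglongrightarrow> \<delta> / real m" if "m \<in> Q" for m
    unfolding d_def \<delta>_def using that by (intro density_scaled Q_density P s) (auto simp: Q_def Q_set_def)
  have d_le: "\<bar>d m N\<bar> \<le> 1 / real m" for m N
  proof -
    have "d m N \<le> real (N div m) / real N" unfolding d_def by (intro divide_right_mono) (auto simp: Q_count_le)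
    also have "\<dots> \<le> real N / real m / real N" by (intro divide_right_mono of_nat_div_le_of_nat) auto
    also have "\<dots> \<le> 1 / real m" by simp
    finally show ?thesis by (simp add: d_def)
  qed
  have sQ: "(\<lambda>m. 1 / real m) summable_on Q" unfolding Q_def by (rule summable_inverse_smooth[OF P s])
  show ?thesis
  proof (rule LIMSEQ_I)
    fix e :: real assume e: "e > 0"
    define \<epsilon> where "\<epsilon> = e / (3 * (C + \<bar>\<delta>\<bar> + 1))"
    have \<epsilon>: "\<epsilon> > 0" "C * \<epsilon> < e / 3" "\<bar>\<delta>\<bar> * \<epsilon> < e / 3"
      using e C by (auto simp: \<epsilon>_def field_simps add_pos_nonneg intro!: add_nonneg_pos mult_pos_pos)
    have "\<forall>\<^sub>F B in finite_subsets_at_top Q. dist (\<Sum>m\<in>B. (1 / real m) *\<^sub>R y m) Y < \<epsilon>"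
      by (rule tendstoD[OF Y[unfolded has_sum_def Q_def[symmetric]] \<epsilon>(1)])
    then obtain B0 where B0: "finite B0" "B0 \<subseteq> Q"
      "\<And>B. finite B \<Longrightarrow> B0 \<subseteq> B \<Longrightarrow> B \<subseteq> Q \<Longrightarrow> norm ((\<Sum>m\<in>B. (1 / real m) *\<^sub>R y m) - Y) < \<epsilon>"
      unfolding eventually_finite_subsets_at_top by (auto simp: dist_norm)
    have "((\<lambda>m. 1 / real m) has_sum (\<Sum>\<^sub>\<infinity>m\<in>Q. 1 / real m)) Q" using sQ by (rule has_sum_infsum)
    then have "\<forall>\<^sub>F B in finite_subsets_at_top Q. dist (\<Sum>m\<in>B. 1 / real m) (\<Sum>\<^sub>\<infinity>m\<in>Q. 1 / real m) < \<epsilon>"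
      unfolding has_sum_def using \<epsilon>(1) by (rule tendstoD)
    then obtain B1 where B1: "finite B1" "B1 \<subseteq> Q"
      "\<And>B. finite B \<Longrightarrow> B1 \<subseteq> B \<Longrightarrow> B \<subseteq> Q \<Longrightarrow> \<bar>(\<Sum>m\<in>B. 1 / real m) - (\<Sum>\<^sub>\<infinity>m\<in>Q. 1 / real m)\<bar> < \<epsilon>"
      unfolding eventually_finite_subsets_at_top by (auto simp: dist_real_def)
    \<comment> \<open>\<open>B0\<close> makes the partial sum close to \<open>Y\<close>;
      \<open>B1\<close> makes the dominating series small off \<open>B\<close>.\<close>
    define B where "B = B0 \<union> B1"
    have B: "finite B" "B \<subseteq> Q" using B0 B1 by (auto simp: B_def)
    have tail: "(\<Sum>m\<in>A. 1 / real m) \<le> \<epsilon>" if A: "finite A" "A \<subseteq> Q" "A \<inter> B = {}" for A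
    proof -
      have "(\<Sum>m\<in>B \<union> A. 1 / real m) \<le> (\<Sum>\<^sub>\<infinity>m\<in>Q. 1 / real m)"
        using A B sQ by (intro finite_sum_le_infsum) auto
      moreover have "(\<Sum>m\<in>B \<union> A. 1 / real m) = (\<Sum>m\<in>B. 1 / real m) + (\<Sum>m\<in>A. 1 / real m)"
        using A B by (intro sum.union_disjoint) auto
      moreover have "\<bar>(\<Sum>m\<in>B. 1 / real m) - (\<Sum>\<^sub>\<infinity>m\<in>Q. 1 / real m)\<bar> < \<epsilon>"
        using B by (intro B1(3)) (auto simp: B_def)
      ultimately show ?thesis by linarith
    qed
    have "(\<lambda>N. \<Sum>m\<in>B. \<bar>d m N - \<delta> / real m\<bar> * C) \<longlonglongrightarrow> (\<Sum>m\<in>B. \<bar>\<delta> / real m - \<delta> / real m\<bar> * C)"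
      using B d by (intro tendsto_intros) auto
    then have "(\<lambda>N. \<Sum>m\<in>B. \<bar>d m N - \<delta> / real m\<bar> * C) \<longlonglongrightarrow> 0" by simp
    then have "\<forall>\<^sub>F N in sequentially. (\<Sum>m\<in>B. \<bar>d m N - \<delta> / real m\<bar> * C) < e / 3"
      by (rule order_tendstoD) (use e in simp)
    then obtain N0 where N0: "\<And>N. N \<ge> N0 \<Longrightarrow> (\<Sum>m\<in>B. \<bar>d m N - \<delta> / real m\<bar> * C) < e / 3"
      unfolding eventually_sequentially by blast
    have "norm ((1 / real N) *\<^sub>R (\<Sum>n\<in>{1..N}. y n) - \<delta> *\<^sub>R Y) < e" if N: "N \<ge> N0" for N
    proof -
      define A where "A = Q \<inter> {1..N} - B"
      have A: "finite A" "A \<subseteq> Q" "A \<inter> B = {}" by (auto simp: A_def)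
      have "(1 / real N) *\<^sub>R (\<Sum>n\<in>{1..N}. y n) = (\<Sum>m\<in>Q \<inter> {1..N}. d m N *\<^sub>R y m)"
        by (subst sum_group_smooth_part[OF y]) (auto simp: d_def Q_def scaleR_sum_right)
      also have "\<dots> = (\<Sum>m\<in>A \<union> B. d m N *\<^sub>R y m)"
      proof (rule sum.mono_neutral_left)
        \<comment> \<open>\<open>B\<close> was fixed before N and may contain m > N; for these
          \<open>N div m = 0\<close> and the coefficient vanishes.\<close>
        show "\<forall>m\<in>A \<union> B - Q \<inter> {1..N}. d m N *\<^sub>R y m = 0"
        proof
          fix m assume "m \<in> A \<union> B - Q \<inter> {1..N}"
          then have "m \<in> Q" "m \<notin> {1..N}" using B by (auto simp: A_def)
          then have "N div m = 0" by (auto simp: Q_def Q_set_def)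
          then show "d m N *\<^sub>R y m = 0" by (simp add: d_def Q_count_def)
        qed
      qed (use A B in \<open>auto simp: A_def\<close>)
      also have "\<dots> = (\<Sum>m\<in>A. d m N *\<^sub>R y m) + (\<Sum>m\<in>B. d m N *\<^sub>R y m)"
        using A B by (intro sum.union_disjoint) auto
      finally have "(1 / real N) *\<^sub>R (\<Sum>n\<in>{1..N}. y n) - \<delta> *\<^sub>R Y =
         (\<Sum>m\<in>A. d m N *\<^sub>R y m) + (\<Sum>m\<in>B. (d m N - \<delta> / real m) *\<^sub>R y m) + \<delta> *\<^sub>R ((\<Sum>m\<in>B. (1 / real m) *\<^sub>R y m) - Y)"
        by (simp add: scaleR_diff_left scaleR_diff_right sum_subtractf scaleR_sum_right)
      also have "norm \<dots> \<le> norm (\<Sum>m\<in>A. d m N *\<^sub>R y m) + norm (\<Sum>m\<in>B. (d m N - \<delta> / real m) *\<^sub>R y m) +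
          norm (\<delta> *\<^sub>R ((\<Sum>m\<in>B. (1 / real m) *\<^sub>R y m) - Y))"
        by (intro norm_triangle_le add_right_mono norm_triangle_ineq)
      also have "norm (\<Sum>m\<in>A. d m N *\<^sub>R y m) \<le> (\<Sum>m\<in>A. 1 / real m * C)"
      proof (rule sum_norm_le)
        fix m
        have "\<bar>d m N\<bar> * norm (y m) \<le> 1 / real m * C"
          using d_le bounded by (intro mult_mono) auto
        then show "norm (d m N *\<^sub>R y m) \<le> 1 / real m * C" by simp
      qed
      also have "\<dots> = (\<Sum>m\<in>A. 1 / real m) * C" by (rule sum_distrib_right[symmetric])
      also have "\<dots> \<le> \<epsilon> * C" using tail[OF A] C by (rule mult_right_mono)
      also have "norm (\<Sum>m\<in>B. (d m N - \<delta> / real m) *\<^sub>R y m) \<le> (\<Sum>m\<in>B. \<bar>d m N - \<delta> / real m\<bar> * C)"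
        using bounded by (intro sum_norm_le) (auto intro!: mult_left_mono)
      also have "norm (\<delta> *\<^sub>R ((\<Sum>m\<in>B. (1 / real m) *\<^sub>R y m) - Y)) \<le> \<bar>\<delta>\<bar> * \<epsilon>"
      proof -
        have "norm ((\<Sum>m\<in>B. (1 / real m) *\<^sub>R y m) - Y) \<le> \<epsilon>"
          by (rule less_imp_le[OF B0(3)]) (use B in \<open>auto simp: B_def\<close>)
        from mult_left_mono[OF this abs_ge_zero] show ?thesis by simp
      qed
      finally have "norm ((1 / real N) *\<^sub>R (\<Sum>n\<in>{1..N}. y n) - \<delta> *\<^sub>R Y) \<le>
          \<epsilon> * C + (\<Sum>m\<in>B. \<bar>d m N - \<delta> / real m\<bar> * C) + \<bar>\<delta>\<bar> * \<epsilon>" by this simp_all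
      then show ?thesis using N0[OF N] \<epsilon> by (simp add: mult.commute)
    qed
    then show "\<exists>no. \<forall>N\<ge>no. norm ((1 / real N) *\<^sub>R (\<Sum>n\<in>{1..N}. y n) - \<delta> *\<^sub>R Y) < e" by blast
  qed
qed

section \<open>The space of square-integrable functions\<close>

lemma L2_D [dest]: "F \<in> L2 M \<Longrightarrow> F \<in> borel_measurable M" "F \<in> L2 M \<Longrightarrow> integrable M (\<lambda>x. (cmod (F x))\<^sup>2)"
  by (auto simp: L2_def)

lemma L2_measurable [measurable_dest]: "F \<in> L2 M \<Longrightarrow> F \<in> borel_measurable M"
  by auto

lemma L2_cmult: "F \<in> L2 M \<Longrightarrow> (\<lambda>x. c * F x) \<in> L2 M"
  by (auto simp: L2_def norm_mult power_mult_distrib)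

lemma L2_zero: "(\<lambda>x. 0) \<in> L2 M"
  by (auto simp: L2_def)

lemma L2_add:
  assumes "F \<in> L2 M" "G \<in> L2 M"
  shows "(\<lambda>x. F x + G x) \<in> L2 M"
proof -
  have "integrable M (\<lambda>x. (cmod (F x + G x))\<^sup>2)"
  proof (rule Bochner_Integration.integrable_bound)
    show "integrable M (\<lambda>x. 2 * (cmod (F x))\<^sup>2 + 2 * (cmod (G x))\<^sup>2)"
      using assms by (intro Bochner_Integration.integrable_add integrable_mult_right L2_D)
    have "(cmod (F x + G x))\<^sup>2 \<le> 2 * (cmod (F x))\<^sup>2 + 2 * (cmod (G x))\<^sup>2" for x
    proof -
      have "(cmod (F x + G x))\<^sup>2 \<le> (cmod (F x) + cmod (G x))\<^sup>2"
        by (intro power_mono norm_triangle_ineq) auto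
      also have "\<dots> \<le> 2 * (cmod (F x))\<^sup>2 + 2 * (cmod (G x))\<^sup>2"
        using sum_squares_bound[of "cmod (F x)" "cmod (G x)"] by (simp add: power2_sum)
      finally show ?thesis .
    qed
    then show "AE x in M. norm ((cmod (F x + G x))\<^sup>2) \<le> norm (2 * (cmod (F x))\<^sup>2 + 2 * (cmod (G x))\<^sup>2)"
      by (intro AE_I2) (simp add: order_trans[OF _ abs_ge_self])
  qed (use assms in measurable)
  moreover have "(\<lambda>x. F x + G x) \<in> borel_measurable M" using assms by measurable
  ultimately show ?thesis by (auto simp: L2_def)
qed

lemma L2_diff:
  assumes "F \<in> L2 M" "G \<in> L2 M"
  shows "(\<lambda>x. F x - G x) \<in> L2 M"
  using L2_add[OF assms(1) L2_cmult[OF assms(2), of "-1"]] by simp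

lemma L2_sum: "(\<And>i. i \<in> I \<Longrightarrow> F i \<in> L2 M) \<Longrightarrow> (\<lambda>x. \<Sum>i\<in>I. F i x) \<in> L2 M"
  by (induction I rule: infinite_finite_induct) (auto simp: L2_zero L2_add)

lemma L2_norm_nonneg [simp]: "L2_norm M F \<ge> 0"
  by (simp add: L2_norm_def)

lemma L2_norm_sq: "(L2_norm M F)\<^sup>2 = (\<integral>x. (cmod (F x))\<^sup>2 \<partial>M)"
  by (simp add: L2_norm_def)

lemma L2_norm_cmult: "L2_norm M (\<lambda>x. c * F x) = cmod c * L2_norm M F"
  by (simp add: L2_norm_def norm_mult power_mult_distrib real_sqrt_mult)

lemma L2_norm_minus_commute: "L2_norm M (\<lambda>x. F x - G x) = L2_norm M (\<lambda>x. G x - F x)"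
  by (simp add: L2_norm_def norm_minus_commute)

lemma L2_norm_eq_0_iff:
  assumes "F \<in> L2 M"
  shows "L2_norm M F = 0 \<longleftrightarrow> (AE x in M. F x = 0)"
  unfolding L2_norm_def using assms by (subst real_sqrt_eq_0_iff, subst integral_nonneg_eq_0_iff_AE) auto

lemma L2_inner_integrable:
  assumes "F \<in> L2 M" "G \<in> L2 M"
  shows "integrable M (\<lambda>x. F x * cnj (G x))"
proof (rule Bochner_Integration.integrable_bound)
  show "integrable M (\<lambda>x. (cmod (F x))\<^sup>2 + (cmod (G x))\<^sup>2)" using assms by auto
  show "AE x in M. norm (F x * cnj (G x)) \<le> norm ((cmod (F x))\<^sup>2 + (cmod (G x))\<^sup>2)"
  proof (intro AE_I2)
    fix x
    have "2 * (cmod (F x) * cmod (G x)) \<le> (cmod (F x))\<^sup>2 + (cmod (G x))\<^sup>2"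
      using sum_squares_bound[of "cmod (F x)" "cmod (G x)"] by (simp add: mult.assoc)
    moreover have "cmod (F x) * cmod (G x) \<ge> 0" by simp
    ultimately have "cmod (F x) * cmod (G x) \<le> (cmod (F x))\<^sup>2 + (cmod (G x))\<^sup>2" by linarith
    then show "norm (F x * cnj (G x)) \<le> norm ((cmod (F x))\<^sup>2 + (cmod (G x))\<^sup>2)"
      by (simp add: norm_mult)
  qed
  have "(\<lambda>x. cnj (G x)) \<in> borel_measurable M"
    using measurable_compose[OF L2_measurable[OF assms(2)]
      borel_measurable_continuous_onI[OF continuous_on_cnj[OF continuous_on_id]]] .
  then show "(\<lambda>x. F x * cnj (G x)) \<in> borel_measurable M" using assms by measurable
qed

lemma L2_inner_add:
  assumes "F \<in> L2 M" "G \<in> L2 M" "H \<in> L2 M"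
  shows "L2_inner M (\<lambda>x. F x + G x) H = L2_inner M F H + L2_inner M G H"
  unfolding L2_inner_def
  using L2_inner_integrable[OF assms(1,3)] L2_inner_integrable[OF assms(2,3)] by (simp add: distrib_right)

lemma L2_inner_diff:
  assumes "F \<in> L2 M" "G \<in> L2 M" "H \<in> L2 M"
  shows "L2_inner M (\<lambda>x. F x - G x) H = L2_inner M F H - L2_inner M G H"
  unfolding L2_inner_def
  using L2_inner_integrable[OF assms(1,3)] L2_inner_integrable[OF assms(2,3)] by (simp add: left_diff_distrib)

lemma L2_inner_diff_right:
  assumes "F \<in> L2 M" "G \<in> L2 M" "H \<in> L2 M"
  shows "L2_inner M F (\<lambda>x. G x - H x) = L2_inner M F G - L2_inner M F H"
  unfolding L2_inner_def
  using L2_inner_integrable[OF assms(1,2)] L2_inner_integrable[OF assms(1,3)] by (simp add: right_diff_distrib)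

lemma L2_inner_cmult: "L2_inner M (\<lambda>x. c * F x) G = c * L2_inner M F G"
  unfolding L2_inner_def by (simp add: mult.assoc)

lemma L2_inner_self: "L2_inner M F F = of_real ((L2_norm M F)\<^sup>2)"
  unfolding L2_inner_def L2_norm_sq complex_norm_square[symmetric]
  by (simp flip: integral_complex_of_real)

lemma L2_inner_cnj: "L2_inner M G F = cnj (L2_inner M F G)"
  unfolding L2_inner_def by (simp add: mult.commute flip: Bochner_Integration.integral_cnj)

lemma L2_norm_diff_sq:
  assumes "F \<in> L2 M" "G \<in> L2 M"
  shows "(L2_norm M (\<lambda>x. F x - c * G x))\<^sup>2 =
     (L2_norm M F)\<^sup>2 - 2 * Re (cnj c * L2_inner M F G) + (cmod c)\<^sup>2 * (L2_norm M G)\<^sup>2"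
proof -
  have "(cmod (F x - c * G x))\<^sup>2 = (cmod (F x))\<^sup>2 - 2 * Re (cnj c * (F x * cnj (G x))) + (cmod c)\<^sup>2 * (cmod (G x))\<^sup>2" for x
    unfolding cmod_power2 by (simp add: algebra_simps power2_eq_square)
  moreover have "integrable M (\<lambda>x. cnj c * (F x * cnj (G x)))"
    using L2_inner_integrable[OF assms] by simp
  then have "integrable M (\<lambda>x. Re (cnj c * (F x * cnj (G x))))"
    "(\<integral>x. Re (cnj c * (F x * cnj (G x))) \<partial>M) = Re (\<integral>x. cnj c * (F x * cnj (G x)) \<partial>M)"
    by (simp_all only: integrable_Re integral_Re)
  moreover have "(\<integral>x. cnj c * (F x * cnj (G x)) \<partial>M) = cnj c * L2_inner M F G"
    unfolding L2_inner_def by simp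
  ultimately show ?thesis
    unfolding L2_norm_sq using L2_D(2)[OF assms(1)] L2_D(2)[OF assms(2)]
    by (simp only: Bochner_Integration.integral_add Bochner_Integration.integral_diff
      Bochner_Integration.integrable_add Bochner_Integration.integrable_diff
      integrable_mult_right integral_mult_right_zero)
qed

text \<open>Integrates the weighted inequality of arithmetic and geometric means. With the absolute
  values inside, it also bounds the L1 norm by the L2 norm on a probability space.\<close>

lemma L2_cauchy_schwarz_abs:
  assumes "F \<in> L2 M" "G \<in> L2 M"
  shows "(\<integral>x. cmod (F x) * cmod (G x) \<partial>M) \<le> L2_norm M F * L2_norm M G"
proof (cases "L2_norm M F = 0 \<or> L2_norm M G = 0")
  case True
  then have "AE x in M. cmod (F x) * cmod (G x) = 0"
    using L2_norm_eq_0_iff[OF assms(1)] L2_norm_eq_0_iff[OF assms(2)] by auto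
  then have "(\<integral>x. cmod (F x) * cmod (G x) \<partial>M) = (\<integral>x. 0 \<partial>M)"
    using assms by (intro integral_cong_AE) auto
  then show ?thesis by simp
next
  case False
  define a b where "a = L2_norm M F" and "b = L2_norm M G"
  have ab: "a > 0" "b > 0" using False by (auto simp: a_def b_def less_le)
  have "(\<integral>x. cmod (F x) * cmod (G x) \<partial>M) \<le>
      (\<integral>x. b / (2 * a) * (cmod (F x))\<^sup>2 + a / (2 * b) * (cmod (G x))\<^sup>2 \<partial>M)"
  proof (rule integral_mono)
    show "integrable M (\<lambda>x. cmod (F x) * cmod (G x))"
      using integrable_norm[OF L2_inner_integrable[OF assms]] by (simp add: norm_mult)
    show "integrable M (\<lambda>x. b / (2 * a) * (cmod (F x))\<^sup>2 + a / (2 * b) * (cmod (G x))\<^sup>2)"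
      using assms by (intro Bochner_Integration.integrable_add integrable_mult_right L2_D)
    fix x
    have "0 \<le> (b * cmod (F x) - a * cmod (G x))\<^sup>2 / (2 * a * b)" using ab by auto
    also have "\<dots> = b / (2 * a) * (cmod (F x))\<^sup>2 + a / (2 * b) * (cmod (G x))\<^sup>2 - cmod (F x) * cmod (G x)"
      using ab by (simp add: field_simps power2_eq_square)
    finally show "cmod (F x) * cmod (G x) \<le> b / (2 * a) * (cmod (F x))\<^sup>2 + a / (2 * b) * (cmod (G x))\<^sup>2" by simp
  qed
  also have "\<dots> = b / (2 * a) * a\<^sup>2 + a / (2 * b) * b\<^sup>2"
    unfolding a_def b_def L2_norm_sq using assms by (simp add: L2_D)
  also have "\<dots> = a * b" using ab by (simp add: power2_eq_square field_simps)
  finally show ?thesis by (simp add: a_def b_def)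
qed

lemma L2_cauchy_schwarz:
  assumes "F \<in> L2 M" "G \<in> L2 M"
  shows "cmod (L2_inner M F G) \<le> L2_norm M F * L2_norm M G"
proof -
  have "cmod (L2_inner M F G) \<le> (\<integral>x. cmod (F x * cnj (G x)) \<partial>M)"
    unfolding L2_inner_def by (rule integral_norm_bound)
  also have "\<dots> = (\<integral>x. cmod (F x) * cmod (G x) \<partial>M)" by (simp add: norm_mult)
  finally show ?thesis using L2_cauchy_schwarz_abs[OF assms] by linarith
qed

lemma L2_norm_triangle:
  assumes "F \<in> L2 M" "G \<in> L2 M"
  shows "L2_norm M (\<lambda>x. F x + G x) \<le> L2_norm M F + L2_norm M G"
proof (rule power2_le_imp_le)
  have "(L2_norm M (\<lambda>x. F x + G x))\<^sup>2 = (L2_norm M F)\<^sup>2 + 2 * Re (L2_inner M F G) + (L2_norm M G)\<^sup>2"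
    using L2_norm_diff_sq[OF assms, of "-1"] by simp
  also have "Re (L2_inner M F G) \<le> L2_norm M F * L2_norm M G"
    using L2_cauchy_schwarz[OF assms] complex_Re_le_cmod order_trans by blast
  finally show "(L2_norm M (\<lambda>x. F x + G x))\<^sup>2 \<le> (L2_norm M F + L2_norm M G)\<^sup>2"
    by (simp add: power2_sum)
qed auto

lemma L2_norm_triangle_diff:
  assumes "F \<in> L2 M" "G \<in> L2 M" "H \<in> L2 M"
  shows "L2_norm M (\<lambda>x. F x - H x) \<le> L2_norm M (\<lambda>x. F x - G x) + L2_norm M (\<lambda>x. G x - H x)"
  using L2_norm_triangle[OF L2_diff[OF assms(1,2)] L2_diff[OF assms(2,3)]] by simp

lemma L2_norm_sum_le:
  assumes "\<And>i. i \<in> I \<Longrightarrow> F i \<in> L2 M"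
  shows "L2_norm M (\<lambda>x. \<Sum>i\<in>I. F i x) \<le> (\<Sum>i\<in>I. L2_norm M (F i))"
  using assms
proof (induction I rule: infinite_finite_induct)
  case (insert i I)
  then have "L2_norm M (\<lambda>x. F i x + (\<Sum>i\<in>I. F i x)) \<le> L2_norm M (F i) + L2_norm M (\<lambda>x. \<Sum>i\<in>I. F i x)"
    by (intro L2_norm_triangle L2_sum) auto
  then show ?case using insert by auto
qed (auto simp: L2_norm_def)

lemma L2_compose:
  assumes "F \<in> L2 M" "T \<in> measurable M M" "distr M M T = M"
  shows "(\<lambda>x. F (T x)) \<in> L2 M" "L2_norm M (\<lambda>x. F (T x)) = L2_norm M F"
proof -
  have "integrable (distr M M T) (\<lambda>x. (cmod (F x))\<^sup>2)" using assms by (simp add: L2_D)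
  then have "integrable M (\<lambda>x. (cmod (F (T x)))\<^sup>2)"
    using assms by (subst (asm) integrable_distr_eq) auto
  moreover have "(\<lambda>x. F (T x)) \<in> borel_measurable M"
    using measurable_compose[OF assms(2) L2_measurable[OF assms(1)]] .
  ultimately show "(\<lambda>x. F (T x)) \<in> L2 M" by (auto simp: L2_def)
  have "(\<integral>x. (cmod (F x))\<^sup>2 \<partial>distr M M T) = (\<integral>x. (cmod (F (T x)))\<^sup>2 \<partial>M)"
    using assms by (intro integral_distr) auto
  then show "L2_norm M (\<lambda>x. F (T x)) = L2_norm M F" using assms by (simp add: L2_norm_def)
qed

context prob_space
begin

lemma L2_const: "(\<lambda>x. c) \<in> L2 M"
  by (auto simp: L2_def)

lemma L2_integrable:
  assumes "F \<in> L2 M"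
  shows "integrable M (\<lambda>x. cmod (F x))" "(\<integral>x. cmod (F x) \<partial>M) \<le> L2_norm M F"
proof -
  show "integrable M (\<lambda>x. cmod (F x))"
    using integrable_norm[OF L2_inner_integrable[OF assms L2_const[of 1]]] by simp
  show "(\<integral>x. cmod (F x) \<partial>M) \<le> L2_norm M F"
    using L2_cauchy_schwarz_abs[OF assms L2_const[of 1]] by (simp add: L2_norm_def prob_space)
qed

text \<open>Riesz-Fischer. A subsequence with summable steps converges almost everywhere because the
  L1 norm is at most the L2 norm; Fatou's lemma then shows that the whole sequence converges to its
  limit in L2.\<close>

theorem L2_complete:
  fixes u :: "nat \<Rightarrow> 'a \<Rightarrow> complex"
  assumes u: "\<And>n. u n \<in> L2 M"
    and cauchy: "\<And>\<epsilon>. \<epsilon> > 0 \<Longrightarrow> \<exists>N. \<forall>m\<ge>N. \<forall>n\<ge>N. L2_norm M (\<lambda>x. u m x - u n x) < \<epsilon>"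
  obtains G where "G \<in> L2 M" "(\<lambda>n. L2_norm M (\<lambda>x. u n x - G x)) \<longlonglongrightarrow> 0"
proof -
  have "\<exists>N. \<forall>m\<ge>N. \<forall>n\<ge>N. L2_norm M (\<lambda>x. u m x - u n x) < (1/2) ^ k" for k
    using cauchy by simp
  then obtain N where N: "\<And>k m n. m \<ge> N k \<Longrightarrow> n \<ge> N k \<Longrightarrow> L2_norm M (\<lambda>x. u m x - u n x) < (1/2) ^ k"
    by metis
  \<comment> \<open>Summing the N i makes r (k + 1) >= N k as well as r k >= N k, so consecutive
    terms of the subsequence are within (1/2)^k; adding k sends the indices to infinity.\<close>
  define r where "r k = (\<Sum>i\<le>k. N i) + k" for k
  have r: "r k \<ge> N k" "r k \<ge> k" "r (Suc k) \<ge> N k" for k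
    using member_le_sum[of k "{..k}" N] by (auto simp: r_def)
  define v where "v k = u (r k)" for k
  have v: "v k \<in> L2 M" for k using u by (simp add: v_def)
  have [measurable]: "v k \<in> borel_measurable M" "u k \<in> borel_measurable M" for k using v u by auto
  have dv: "(\<lambda>x. v (Suc k) x - v k x) \<in> L2 M" for k using v by (intro L2_diff)
  have "(\<integral>\<^sup>+x. (\<Sum>k. ennreal (cmod (v (Suc k) x - v k x))) \<partial>M) =
      (\<Sum>k. \<integral>\<^sup>+x. ennreal (cmod (v (Suc k) x - v k x)) \<partial>M)"
    by (intro nn_integral_suminf) measurable
  also have "\<dots> = (\<Sum>k. ennreal (\<integral>x. cmod (v (Suc k) x - v k x) \<partial>M))"
    using L2_integrable(1)[OF dv] by (intro suminf_cong nn_integral_eq_integral) auto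
  also have "\<dots> \<le> (\<Sum>k. ennreal ((1/2) ^ k))"
  proof (intro suminf_le ennreal_leI)
    fix k
    have "(\<integral>x. cmod (v (Suc k) x - v k x) \<partial>M) \<le> L2_norm M (\<lambda>x. v (Suc k) x - v k x)"
      by (rule L2_integrable(2)[OF dv])
    also have "\<dots> \<le> (1/2) ^ k" unfolding v_def by (rule less_imp_le[OF N]) (use r in auto)
    finally show "(\<integral>x. cmod (v (Suc k) x - v k x) \<partial>M) \<le> (1/2) ^ k" .
  qed auto
  also have "\<dots> = ennreal (\<Sum>k. (1/2) ^ k)"
    by (rule suminf_ennreal2) auto
  also have "\<dots> < \<infinity>" by simp
  finally have "AE x in M. (\<Sum>k. ennreal (cmod (v (Suc k) x - v k x))) \<noteq> \<infinity>"
    by (intro nn_integral_noteq_infinite) (auto simp: less_top)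
  then have conv: "AE x in M. convergent (\<lambda>k. v k x)"
  proof eventually_elim
    case (elim x)
    have "summable (\<lambda>k. cmod (v (Suc k) x - v k x))"
      by (rule summable_suminf_not_top) (use elim in auto)
    then have "summable (\<lambda>k. v (Suc k) x - v k x)" by (rule summable_norm_cancel)
    then have "convergent (\<lambda>n. \<Sum>k<n. v (Suc k) x - v k x)" by (simp add: summable_iff_convergent)
    then have "convergent (\<lambda>n. v n x - v 0 x)" by (simp add: sum_lessThan_telescope[of "\<lambda>n. v n x"])
    then show ?case by (simp add: convergent_diff_const_right_iff)
  qed
  define G where "G x = lim (\<lambda>k. v k x)" for x
  have [measurable]: "G \<in> borel_measurable M" unfolding G_def by measurable
  have est: "(\<integral>\<^sup>+x. ennreal ((cmod (u n x - G x))\<^sup>2) \<partial>M) \<le> ennreal (\<epsilon>\<^sup>2)"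
    if \<epsilon>: "\<epsilon> > 0" and n: "\<And>m. m \<ge> K \<Longrightarrow> L2_norm M (\<lambda>x. u n x - u m x) < \<epsilon>" for \<epsilon> n K
  proof -
    have "(\<integral>\<^sup>+x. ennreal ((cmod (u n x - G x))\<^sup>2) \<partial>M) = (\<integral>\<^sup>+x. liminf (\<lambda>k. ennreal ((cmod (u n x - v k x))\<^sup>2)) \<partial>M)"
    proof (rule nn_integral_cong_AE)
      show "AE x in M. ennreal ((cmod (u n x - G x))\<^sup>2) = liminf (\<lambda>k. ennreal ((cmod (u n x - v k x))\<^sup>2))"
        using conv
      proof eventually_elim
        case (elim x)
        then have "(\<lambda>k. v k x) \<longlonglongrightarrow> G x" by (simp add: G_def convergent_LIMSEQ_iff)
        then have "(\<lambda>k. ennreal ((cmod (u n x - v k x))\<^sup>2)) \<longlonglongrightarrow> ennreal ((cmod (u n x - G x))\<^sup>2)"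
          by (intro tendsto_intros tendsto_ennrealI)
        then show ?case by (rule lim_imp_Liminf[OF trivial_limit_sequentially, symmetric])
      qed
    qed
    also have "\<dots> \<le> liminf (\<lambda>k. \<integral>\<^sup>+x. ennreal ((cmod (u n x - v k x))\<^sup>2) \<partial>M)"
      by (rule nn_integral_liminf) measurable
    also have "\<dots> \<le> liminf (\<lambda>k. ennreal (\<epsilon>\<^sup>2))"
    proof (rule Liminf_mono)
      show "\<forall>\<^sub>F k in sequentially. (\<integral>\<^sup>+x. ennreal ((cmod (u n x - v k x))\<^sup>2) \<partial>M) \<le> ennreal (\<epsilon>\<^sup>2)"
        using eventually_ge_at_top[of K]
      proof eventually_elim
        case (elim k)
        have "(\<lambda>x. u n x - v k x) \<in> L2 M" by (intro L2_diff u v)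
        then have "(\<integral>\<^sup>+x. ennreal ((cmod (u n x - v k x))\<^sup>2) \<partial>M) = ennreal ((L2_norm M (\<lambda>x. u n x - v k x))\<^sup>2)"
          unfolding L2_norm_sq by (intro nn_integral_eq_integral) auto
        also have "\<dots> \<le> ennreal (\<epsilon>\<^sup>2)"
          using n[of "r k"] r(2)[of k] elim by (intro ennreal_leI power_mono) (auto simp: v_def)
        finally show ?case .
      qed
    qed
    also have "\<dots> = ennreal (\<epsilon>\<^sup>2)" by (simp add: Liminf_const)
    finally show ?thesis .
  qed
  have close: "(\<lambda>x. u n x - G x) \<in> L2 M \<and> L2_norm M (\<lambda>x. u n x - G x) \<le> \<epsilon>"
    if \<epsilon>: "\<epsilon> > 0" and n: "\<And>m. m \<ge> K \<Longrightarrow> L2_norm M (\<lambda>x. u n x - u m x) < \<epsilon>" for \<epsilon> n K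
  proof -
    have e: "(\<integral>\<^sup>+x. ennreal ((cmod (u n x - G x))\<^sup>2) \<partial>M) \<le> ennreal (\<epsilon>\<^sup>2)"
      by (rule est[OF \<epsilon>, of K]) (rule n)
    have int: "integrable M (\<lambda>x. (cmod (u n x - G x))\<^sup>2)"
      using e by (intro integrableI_bounded) (auto simp: le_less_trans)
    then have "ennreal ((L2_norm M (\<lambda>x. u n x - G x))\<^sup>2) \<le> ennreal (\<epsilon>\<^sup>2)"
      using e by (simp add: L2_norm_sq nn_integral_eq_integral)
    then have "(L2_norm M (\<lambda>x. u n x - G x))\<^sup>2 \<le> \<epsilon>\<^sup>2" using \<epsilon> by (simp add: ennreal_le_iff)
    then have "L2_norm M (\<lambda>x. u n x - G x) \<le> \<epsilon>" by (rule power2_le_imp_le) (use \<epsilon> in simp)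
    then show ?thesis using int by (auto simp: L2_def)
  qed
  show ?thesis
  proof (rule that)
    obtain K where K: "\<forall>m\<ge>K. \<forall>n\<ge>K. L2_norm M (\<lambda>x. u m x - u n x) < 1"
      using cauchy[of 1] zero_less_one by blast
    have "(\<lambda>x. u K x - G x) \<in> L2 M"
      by (rule conjunct1[OF close[of 1 K K]]) (use K in simp_all)
    from L2_diff[OF u[of K] this] show "G \<in> L2 M" by simp
    show "(\<lambda>n. L2_norm M (\<lambda>x. u n x - G x)) \<longlonglongrightarrow> 0"
    proof (rule LIMSEQ_I)
      fix e :: real assume e: "e > 0"
      then obtain K where K: "\<forall>m\<ge>K. \<forall>n\<ge>K. L2_norm M (\<lambda>x. u m x - u n x) < e / 2"
        using cauchy[of "e / 2"] half_gt_zero by blast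
      have "L2_norm M (\<lambda>x. u n x - G x) \<le> e / 2" if "n \<ge> K" for n
        by (rule conjunct2[OF close[of "e / 2" K n]]) (use K that e in simp_all)
      then have "L2_norm M (\<lambda>x. u n x - G x) < e" if "n \<ge> K" for n
        using that e by fastforce
      then show "\<exists>no. \<forall>n\<ge>no. norm (L2_norm M (\<lambda>x. u n x - G x) - 0) < e" by auto
    qed
  qed
qed

end


section \<open>Orthogonal projection onto closed subspaces\<close>

definition L2_subspace :: "'a measure \<Rightarrow> ('a \<Rightarrow> complex) set \<Rightarrow> bool" where
  "L2_subspace M V \<longleftrightarrow> V \<subseteq> L2 M \<and> (\<lambda>x. 0) \<in> V \<and>
     (\<forall>F\<in>V. \<forall>G\<in>V. (\<lambda>x. F x + G x) \<in> V) \<and> (\<forall>c. \<forall>F\<in>V. (\<lambda>x. c * F x) \<in> V)"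

lemma L2_subspaceD:
  assumes "L2_subspace M V"
  shows "F \<in> V \<Longrightarrow> F \<in> L2 M" "(\<lambda>x. 0) \<in> V" "F \<in> V \<Longrightarrow> G \<in> V \<Longrightarrow> (\<lambda>x. F x + G x) \<in> V"
    "F \<in> V \<Longrightarrow> (\<lambda>x. c * F x) \<in> V"
  using assms unfolding L2_subspace_def by auto

lemma L2_closureD:
  assumes "L2_closure M V \<subseteq> V" "G \<in> L2 M" "\<And>\<epsilon>. \<epsilon> > 0 \<Longrightarrow> \<exists>H\<in>V. L2_norm M (\<lambda>x. G x - H x) < \<epsilon>"
  shows "G \<in> V"
  using assms by (auto simp: L2_closure_def)

lemma L2_parallelogram:
  assumes "F \<in> L2 M" "G \<in> L2 M" "H \<in> L2 M"
  shows "(L2_norm M (\<lambda>x. G x - H x))\<^sup>2 = 2 * (L2_norm M (\<lambda>x. F x - G x))\<^sup>2 + 2 * (L2_norm M (\<lambda>x. F x - H x))\<^sup>2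
     - 4 * (L2_norm M (\<lambda>x. F x - (1 / 2 * G x + 1 / 2 * H x)))\<^sup>2"
proof -
  define A B where "A = (\<lambda>x. F x - G x)" and "B = (\<lambda>x. F x - H x)"
  have AB: "A \<in> L2 M" "B \<in> L2 M" using assms L2_diff[of F M G] L2_diff[of F M H]
    by (auto simp: A_def B_def)
  have "L2_norm M (\<lambda>x. G x - H x) = L2_norm M (\<lambda>x. B x - 1 * A x)"
    by (simp add: A_def B_def)
  moreover have "L2_norm M (\<lambda>x. F x - (1 / 2 * G x + 1 / 2 * H x)) = L2_norm M (\<lambda>x. 1 / 2 * (B x - (- 1) * A x))"
    by (intro arg_cong[of _ _ "L2_norm M"]) (auto simp: A_def B_def field_simps)
  moreover have "\<dots> = 1 / 2 * L2_norm M (\<lambda>x. B x - (- 1) * A x)"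
    by (subst L2_norm_cmult) simp
  ultimately show ?thesis
    unfolding L2_norm_diff_sq[OF AB(2,1)]
    by (simp only: power_mult_distrib L2_norm_diff_sq[OF AB(2,1)]) (simp add: A_def B_def power2_eq_square field_simps)
qed

context prob_space
begin

theorem L2_projection_exists:
  assumes V: "L2_subspace M V" "L2_closure M V \<subseteq> V" and F: "F \<in> L2 M"
  obtains G where "G \<in> V" "\<And>H. H \<in> V \<Longrightarrow> L2_inner M (\<lambda>x. F x - G x) H = 0"
proof -
  note V' = L2_subspaceD[OF V(1)]
  define d where "d = (INF H\<in>V. L2_norm M (\<lambda>x. F x - H x))"
  have bdd: "bdd_below ((\<lambda>H. L2_norm M (\<lambda>x. F x - H x)) ` V)"
    by (rule bdd_belowI[of _ 0]) auto
  have d: "d \<le> L2_norm M (\<lambda>x. F x - H x)" if "H \<in> V" for H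
    unfolding d_def by (rule cINF_lower[OF bdd that])
  have d0: "d \<ge> 0" unfolding d_def using V'(2) by (intro cINF_greatest) auto
  have "\<exists>H\<in>V. L2_norm M (\<lambda>x. F x - H x) < d + 1 / real (Suc n)" for n
  proof -
    have "d < d + 1 / real (Suc n)" by simp
    then show ?thesis unfolding d_def
      using V'(2) bdd by (subst (asm) cINF_less_iff) auto
  qed
  then obtain u where u: "\<And>n. u n \<in> V" "\<And>n. L2_norm M (\<lambda>x. F x - u n x) < d + 1 / real (Suc n)"
    by metis
  have uL: "u n \<in> L2 M" for n using u V' by auto
  \<comment> \<open>The parallelogram law: the midpoint of two near-minimisers lies in
    \<open>V\<close>, so its distance from F is at least d, which forces the two to be
    close.\<close>
  have diff: "(L2_norm M (\<lambda>x. u m x - u n x))\<^sup>2 \<le> 4 * (2 * d + 1) / real (Suc K)"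
    if "m \<ge> K" "n \<ge> K" for m n K
  proof -
    define \<delta> where "\<delta> = 1 / real (Suc K)"
    have \<delta>: "0 < \<delta>" "\<delta> \<le> 1" by (auto simp: \<delta>_def)
    have le: "L2_norm M (\<lambda>x. F x - u k x) \<le> d + \<delta>" if "k \<ge> K" for k
    proof -
      have "1 / real (Suc k) \<le> \<delta>" using that by (auto simp: \<delta>_def intro!: divide_left_mono)
      then show ?thesis using u(2)[of k] by linarith
    qed
    have mid: "(\<lambda>x. 1 / 2 * u m x + 1 / 2 * u n x) \<in> V" by (intro V'(3) V'(4) u(1))
    have "(L2_norm M (\<lambda>x. u m x - u n x))\<^sup>2 = 2 * (L2_norm M (\<lambda>x. F x - u m x))\<^sup>2 +
      2 * (L2_norm M (\<lambda>x. F x - u n x))\<^sup>2 - 4 * (L2_norm M (\<lambda>x. F x - (1 / 2 * u m x + 1 / 2 * u n x)))\<^sup>2"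
      by (intro L2_parallelogram F uL)
    also have "\<dots> \<le> 2 * (d + \<delta>)\<^sup>2 + 2 * (d + \<delta>)\<^sup>2 - 4 * d\<^sup>2"
      using le that d[OF mid] d0 by (intro diff_mono add_mono mult_left_mono power_mono) auto
    also have "\<dots> = 4 * \<delta> * (2 * d + \<delta>)" by (simp add: power2_eq_square algebra_simps)
    also have "\<dots> \<le> 4 * \<delta> * (2 * d + 1)" using \<delta> by (intro mult_left_mono) auto
    finally show ?thesis by (simp add: \<delta>_def)
  qed
  have "\<exists>N. \<forall>m\<ge>N. \<forall>n\<ge>N. L2_norm M (\<lambda>x. u m x - u n x) < \<epsilon>" if \<epsilon>: "\<epsilon> > 0" for \<epsilon>
  proof -
    obtain K where K: "4 * (2 * d + 1) / \<epsilon>\<^sup>2 < real K" using reals_Archimedean2 by blast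
    have "4 * (2 * d + 1) / real (Suc K) < \<epsilon>\<^sup>2"
    proof -
      have "4 * (2 * d + 1) < real K * \<epsilon>\<^sup>2" using K \<epsilon> by (simp add: field_simps)
      also have "\<dots> \<le> real (Suc K) * \<epsilon>\<^sup>2" by (intro mult_right_mono) auto
      finally show ?thesis by (simp add: field_simps)
    qed
    then have "(L2_norm M (\<lambda>x. u m x - u n x))\<^sup>2 < \<epsilon>\<^sup>2" if "m \<ge> K" "n \<ge> K" for m n
      using diff[OF that] by linarith
    then have "L2_norm M (\<lambda>x. u m x - u n x) < \<epsilon>" if "m \<ge> K" "n \<ge> K" for m n
      using power2_less_imp_less[of _ \<epsilon>] \<epsilon> that by auto
    then show ?thesis by auto
  qed
  from L2_complete[OF uL this] obtain G where G: "G \<in> L2 M" "(\<lambda>n. L2_norm M (\<lambda>x. u n x - G x)) \<longlonglongrightarrow> 0"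
    by blast
  have GV: "G \<in> V"
  proof (rule L2_closureD[OF V(2) G(1)])
    fix \<epsilon> :: real assume "\<epsilon> > 0"
    from order_tendstoD(2)[OF G(2) this] obtain n where "L2_norm M (\<lambda>x. u n x - G x) < \<epsilon>"
      by (meson eventually_sequentially order_refl)
    then show "\<exists>H\<in>V. L2_norm M (\<lambda>x. G x - H x) < \<epsilon>"
      using u(1) by (auto simp: L2_norm_minus_commute[of M G])
  qed
  have "L2_norm M (\<lambda>x. F x - G x) \<le> d"
  proof (rule LIMSEQ_le_const)
    have "(\<lambda>n. d + 1 / real (Suc n) + L2_norm M (\<lambda>x. u n x - G x)) \<longlonglongrightarrow> d + 0 + 0"
      by (intro tendsto_add G(2) tendsto_const LIMSEQ_Suc[OF lim_1_over_n])
    then show "(\<lambda>n. d + 1 / real (Suc n) + L2_norm M (\<lambda>x. u n x - G x)) \<longlonglongrightarrow> d" by simp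
    have "L2_norm M (\<lambda>x. F x - G x) \<le> d + 1 / real (Suc n) + L2_norm M (\<lambda>x. u n x - G x)" for n
      using L2_norm_triangle_diff[OF F uL[of n] G(1)] u(2)[of n] by linarith
    then show "\<exists>N. \<forall>n\<ge>N. L2_norm M (\<lambda>x. F x - G x) \<le> d + 1 / real (Suc n) + L2_norm M (\<lambda>x. u n x - G x)"
      by auto
  qed
  then have min: "L2_norm M (\<lambda>x. F x - G x) \<le> L2_norm M (\<lambda>x. F x - H x)" if "H \<in> V" for H
    using d[OF that] by linarith
  have FG: "(\<lambda>x. F x - G x) \<in> L2 M" using F G by (intro L2_diff)
  show ?thesis
  proof (rule that[OF GV])
    fix H assume H: "H \<in> V"
    define c where "c = L2_inner M (\<lambda>x. F x - G x) H"
    \<comment> \<open>Replacing G by G + s c H changes the squared distance by - 2 s |c|^2 + s^2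
      |c|^2 |H|^2. Any s > 0 with s |H|^2 < 1 forces c = 0 by minimality, and the \<open>+ 1\<close>
      covers H of norm 0.\<close>
    define s where "s = 1 / ((L2_norm M H)\<^sup>2 + 1)"
    have s: "s > 0" "s * (L2_norm M H)\<^sup>2 < 1"
      by (auto simp: s_def field_simps add_pos_nonneg)
    have "(\<lambda>x. G x + of_real s * c * H x) \<in> V" using V' GV H by auto
    from min[OF this] have "(L2_norm M (\<lambda>x. F x - G x))\<^sup>2 \<le> (L2_norm M (\<lambda>x. (F x - G x) - (of_real s * c) * H x))\<^sup>2"
      by (intro power_mono) (auto simp: algebra_simps)
    also have "\<dots> = (L2_norm M (\<lambda>x. F x - G x))\<^sup>2 - 2 * Re (cnj (of_real s * c) * c) + (cmod (of_real s * c))\<^sup>2 * (L2_norm M H)\<^sup>2"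
      using L2_norm_diff_sq[OF FG V'(1)[OF H], of "of_real s * c"] by (simp add: c_def)
    also have "cnj (of_real s * c) * c = of_real (s * (cmod c)\<^sup>2)"
      using complex_norm_square[of c] by (simp add: mult.commute mult.left_commute)
    also have "(cmod (of_real s * c))\<^sup>2 = s\<^sup>2 * (cmod c)\<^sup>2" by (simp add: norm_mult power_mult_distrib)
    finally have "2 * (s * (cmod c)\<^sup>2) \<le> (s * (cmod c)\<^sup>2) * (s * (L2_norm M H)\<^sup>2)"
      by (simp add: power2_eq_square algebra_simps)
    also have "\<dots> \<le> (s * (cmod c)\<^sup>2) * 1" using s by (intro mult_left_mono) auto
    finally have "s * (cmod c)\<^sup>2 \<le> 0" by simp
    then have "(cmod c)\<^sup>2 \<le> 0" using s by (simp add: mult_le_0_iff)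
    then show "L2_inner M (\<lambda>x. F x - G x) H = 0" by (simp add: c_def)
  qed
qed

end

text \<open>\<open>L2 M\<close> is not a type, so its functions are mapped isometrically to bounded functions on its
  unit ball (with the discrete topology), where the results on normed spaces apply.\<close>

definition L2_embed :: "'a measure \<Rightarrow> ('a \<Rightarrow> complex) \<Rightarrow> ('a \<Rightarrow> complex) discrete \<Rightarrow>\<^sub>C complex" where
  "L2_embed M F = Bcontfun (\<lambda>K. if of_discrete K \<in> L2 M \<and> L2_norm M (of_discrete K) \<le> 1
     then L2_inner M F (of_discrete K) else 0)"

lemma L2_embed_bcontfun:
  assumes "F \<in> L2 M"
  shows "(\<lambda>K. if of_discrete K \<in> L2 M \<and> L2_norm M (of_discrete K) \<le> 1
     then L2_inner M F (of_discrete K) else 0) \<in> bcontfun"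
proof (rule bcontfun_normI)
  show "continuous_on UNIV (\<lambda>K. if of_discrete K \<in> L2 M \<and> L2_norm M (of_discrete K) \<le> 1
     then L2_inner M F (of_discrete K) else 0)"
    by (auto simp: continuous_on_open_vimage intro: open_discrete)
  fix K :: "('a \<Rightarrow> complex) discrete"
  have "cmod (L2_inner M F (of_discrete K)) \<le> L2_norm M F"
    if "of_discrete K \<in> L2 M" "L2_norm M (of_discrete K) \<le> 1"
  proof -
    have "cmod (L2_inner M F (of_discrete K)) \<le> L2_norm M F * L2_norm M (of_discrete K)"
      by (rule L2_cauchy_schwarz[OF assms that(1)])
    also have "\<dots> \<le> L2_norm M F * 1" using that by (intro mult_left_mono) auto
    finally show ?thesis by simp
  qed
  then show "norm (if of_discrete K \<in> L2 M \<and> L2_norm M (of_discrete K) \<le> 1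
     then L2_inner M F (of_discrete K) else 0) \<le> L2_norm M F" by auto
qed

lemma L2_embed_apply:
  assumes "F \<in> L2 M"
  shows "apply_bcontfun (L2_embed M F) K = (if of_discrete K \<in> L2 M \<and> L2_norm M (of_discrete K) \<le> 1
     then L2_inner M F (of_discrete K) else 0)"
  unfolding L2_embed_def by (subst Bcontfun_inverse[OF L2_embed_bcontfun[OF assms]]) simp

lemma L2_embed_zero: "L2_embed M (\<lambda>x. 0) = 0"
  by (rule bcontfun_eqI) (simp add: L2_embed_apply[OF L2_zero] L2_inner_def)

lemma L2_embed_add:
  assumes "F \<in> L2 M" "G \<in> L2 M"
  shows "L2_embed M (\<lambda>x. F x + G x) = L2_embed M F + L2_embed M G"
  by (rule bcontfun_eqI) (auto simp: L2_embed_apply L2_add assms L2_inner_add)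

lemma L2_embed_scaleR:
  assumes "F \<in> L2 M"
  shows "L2_embed M (\<lambda>x. of_real r * F x) = r *\<^sub>R L2_embed M F"
  by (rule bcontfun_eqI) (auto simp: L2_embed_apply L2_cmult assms L2_inner_cmult scaleR_conv_of_real)

lemma L2_embed_diff:
  assumes "F \<in> L2 M" "G \<in> L2 M"
  shows "L2_embed M (\<lambda>x. F x - G x) = L2_embed M F - L2_embed M G"
  by (rule bcontfun_eqI) (auto simp: L2_embed_apply L2_diff assms L2_inner_diff)

lemma L2_embed_sum:
  assumes "\<And>i. i \<in> I \<Longrightarrow> F i \<in> L2 M"
  shows "L2_embed M (\<lambda>x. \<Sum>i\<in>I. F i x) = (\<Sum>i\<in>I. L2_embed M (F i))"
  using assms
  by (induction I rule: infinite_finite_induct) (auto simp: L2_embed_zero L2_embed_add L2_sum)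

text \<open>One inequality is Cauchy-Schwarz; for the other, the supremum over the unit ball is
  attained at F divided by its norm.\<close>

lemma norm_L2_embed:
  assumes "F \<in> L2 M"
  shows "norm (L2_embed M F) = L2_norm M F"
proof (rule antisym)
  show "norm (L2_embed M F) \<le> L2_norm M F"
  proof (rule norm_bound)
    fix K :: "('a \<Rightarrow> complex) discrete"
    have "cmod (L2_inner M F (of_discrete K)) \<le> L2_norm M F"
      if "of_discrete K \<in> L2 M" "L2_norm M (of_discrete K) \<le> 1"
    proof -
      have "cmod (L2_inner M F (of_discrete K)) \<le> L2_norm M F * L2_norm M (of_discrete K)"
        by (rule L2_cauchy_schwarz[OF assms that(1)])
      also have "\<dots> \<le> L2_norm M F * 1" using that by (intro mult_left_mono) auto
      finally show ?thesis by simp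
    qed
    then show "norm (apply_bcontfun (L2_embed M F) K) \<le> L2_norm M F"
      by (auto simp: L2_embed_apply[OF assms])
  qed
  show "L2_norm M F \<le> norm (L2_embed M F)"
  proof (cases "L2_norm M F = 0")
    case False
    define a where "a = L2_norm M F"
    have a: "a > 0" using False by (auto simp: a_def less_le)
    define K where "K = (\<lambda>x. of_real (1 / a) * F x)"
    have K: "K \<in> L2 M" "L2_norm M K = 1"
      using L2_cmult[OF assms, of "of_real (1 / a)"] a
      by (auto simp: K_def L2_norm_cmult a_def simp del: of_real_divide)
    have "L2_inner M F K = cnj (L2_inner M K F)" by (rule L2_inner_cnj)
    also have "\<dots> = of_real a"
      using a unfolding K_def L2_inner_cmult L2_inner_self a_def[symmetric]
      by (simp add: power2_eq_square)
    finally have "norm (apply_bcontfun (L2_embed M F) (discrete K)) = a"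
      using a K by (simp add: L2_embed_apply[OF assms] discrete_inverse)
    then show ?thesis using norm_bounded[of "L2_embed M F" "discrete K"] by (simp add: a_def)
  qed simp
qed

section \<open>Twisted multiplicative systems\<close>

lemma L2_norm_cong:
  assumes "\<And>x. x \<in> space M \<Longrightarrow> F x = G x"
  shows "L2_norm M F = L2_norm M G"
  unfolding L2_norm_def using assms
  by (intro arg_cong[of _ _ sqrt] Bochner_Integration.integral_cong) auto

text \<open>Vectors are functions, not classes; a closed space therefore absorbs changes on null
  sets.\<close>

lemma in_L2_closureI:
  assumes "G \<in> L2 M" "H \<in> V" "L2_norm M (\<lambda>x. G x - H x) = 0"
  shows "G \<in> L2_closure M V"
  unfolding L2_closure_def using assms by (auto intro!: bexI[of _ H])

lemma L2_inner_cong: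
  assumes "\<And>x. x \<in> space M \<Longrightarrow> F x = F' x" "\<And>x. x \<in> space M \<Longrightarrow> G x = G' x"
  shows "L2_inner M F G = L2_inner M F' G'"
  unfolding L2_inner_def using assms by (intro Bochner_Integration.integral_cong) auto

lemma L2_embed_cong:
  assumes "\<And>x. x \<in> space M \<Longrightarrow> F x = G x"
  shows "L2_embed M F = L2_embed M G"
proof -
  have "L2_inner M F K = L2_inner M G K" for K
    by (rule L2_inner_cong) (use assms in auto)
  then show ?thesis by (simp add: L2_embed_def cong: if_cong)
qed

lemma dist_L2_embed:
  assumes "F \<in> L2 M" "G \<in> L2 M"
  shows "norm (L2_embed M F - L2_embed M G) = L2_norm M (\<lambda>x. F x - G x)"
  using norm_L2_embed[OF L2_diff[OF assms]] L2_embed_diff[OF assms] by simp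

locale twisted_system = fg_multiplicative_system M S
  for M :: "'a::metric_space measure" and S :: "nat \<Rightarrow> 'a \<Rightarrow> 'a" +
  fixes f :: "nat \<Rightarrow> complex"
  assumes f: "f \<in> Mfg_c"
begin

lemma f_norm: "n \<ge> 1 \<Longrightarrow> cmod (f n) = 1"
  and f_mult: "m \<ge> 1 \<Longrightarrow> n \<ge> 1 \<Longrightarrow> f (m * n) = f m * f n"
  and f_finite: "finite (f ` {p. prime p})"
  using f by (auto simp: Mfg_c_def)

definition tw :: "('a \<Rightarrow> complex) \<Rightarrow> nat \<Rightarrow> 'a \<Rightarrow> complex" where
  "tw F n x = cnj (f n) * F (S n x)"

definition col :: "nat \<Rightarrow> ('a \<Rightarrow> 'a) \<times> complex" where
  "col p = (restrict (S p) (space M), f p)"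

definition heavy :: "nat \<Rightarrow> bool" where
  "heavy p \<longleftrightarrow> \<not> (\<lambda>q. 1 / real q) summable_on {q. prime q \<and> col q = col p}"

lemma finite_col: "finite (col ` {p. prime p})"
proof (rule finite_subset)
  show "col ` {p. prime p} \<subseteq> ((\<lambda>p. restrict (S p) (space M)) ` {p. prime p}) \<times> (f ` {p. prime p})"
    by (auto simp: col_def)
qed (use finitely_generated f_finite in blast)

lemma col_eqD:
  assumes "col p = col q"
  shows "f p = f q" "x \<in> space M \<Longrightarrow> S p x = S q x"
  using assms by (auto simp: col_def dest: fun_cong[of _ _ x])

lemma L2_S:
  assumes "F \<in> L2 M" "n \<ge> 1"
  shows "(\<lambda>x. F (S n x)) \<in> L2 M" "L2_norm M (\<lambda>x. F (S n x)) = L2_norm M F"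
  using L2_compose[OF assms(1) measurable[OF assms(2)] preserving[OF assms(2)]] by auto

lemma L2_tw:
  assumes "F \<in> L2 M" "n \<ge> 1"
  shows "tw F n \<in> L2 M" "L2_norm M (tw F n) = L2_norm M F"
  unfolding tw_def using L2_S[OF assms] f_norm[OF assms(2)]
  by (auto simp: L2_norm_cmult intro!: L2_cmult)

lemma tw_mult:
  assumes "m \<ge> 1" "n \<ge> 1" "x \<in> space M"
  shows "tw F (m * n) x = tw (tw F m) n x" 
  using assms f_mult[of m n] mult[of m n x] by (simp add: tw_def mult.commute mult.left_commute)

lemma tw_diff: "tw (\<lambda>x. F x - G x) n x = tw F n x - tw G n x"
  by (simp add: tw_def algebra_simps)

lemma tw_add: "tw (\<lambda>x. F x + G x) n x = tw F n x + tw G n x"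
  by (simp add: tw_def algebra_simps)

lemma tw_cmult: "tw (\<lambda>x. c * F x) n x = c * tw F n x"
  by (simp add: tw_def algebra_simps)

definition mean :: "('a \<Rightarrow> complex) \<Rightarrow> nat \<Rightarrow> 'a \<Rightarrow> complex" where
  "mean F N x = 1 / of_nat N * (\<Sum>n=1..N. tw F n x)"

lemma L2_mean:
  assumes "F \<in> L2 M"
  shows "mean F N \<in> L2 M" "L2_norm M (mean F N) \<le> L2_norm M F"
proof -
  have L: "(\<lambda>x. \<Sum>n\<in>{1..N}. tw F n x) \<in> L2 M" using L2_tw(1)[OF assms] by (intro L2_sum) auto
  then show "mean F N \<in> L2 M" unfolding mean_def by (rule L2_cmult)
  have "L2_norm M (mean F N) = cmod (1 / of_nat N) * L2_norm M (\<lambda>x. \<Sum>n\<in>{1..N}. tw F n x)"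
    unfolding mean_def by (rule L2_norm_cmult)
  also have "cmod (1 / of_nat N) = 1 / real N" by (simp add: norm_divide)
  also have "1 / real N * L2_norm M (\<lambda>x. \<Sum>n\<in>{1..N}. tw F n x) \<le> 1 / real N * (\<Sum>n\<in>{1..N}. L2_norm M (tw F n))"
    using L2_tw(1)[OF assms] by (intro mult_left_mono L2_norm_sum_le) auto
  also have "\<dots> \<le> L2_norm M F" using L2_tw(2)[OF assms] by simp
  finally show "L2_norm M (mean F N) \<le> L2_norm M F" .
qed

lemma mean_diff: "mean (\<lambda>x. F x - G x) N x = mean F N x - mean G N x"
  by (simp add: mean_def tw_diff sum_subtractf algebra_simps)

lemma mean_add: "mean (\<lambda>x. F x + G x) N x = mean F N x + mean G N x"
  by (simp add: mean_def tw_add sum.distrib algebra_simps)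

lemma mean_cmult: "mean (\<lambda>x. c * F x) N x = c * mean F N x"
  by (simp add: mean_def tw_cmult sum_distrib_left algebra_simps)

text \<open>\<open>S 0\<close> and \<open>f 0\<close> are arbitrary, so the orbit may leave
  \<open>L2 M\<close> at index 0. The value 0 there keeps the sequence bounded and never enters a
  mean.\<close>

lemma avg_L2_embed:
  assumes "\<And>n. n \<ge> 1 \<Longrightarrow> H n \<in> L2 M"
  shows "avg (\<lambda>n. if n = 0 then 0 else L2_embed M (H n)) x =
    L2_embed M (\<lambda>z. of_real (1 / x) * (\<Sum>n\<in>{1..nat \<lfloor>x\<rfloor>}. H n z))"
proof -
  have "(\<lambda>z. \<Sum>n\<in>{1..nat \<lfloor>x\<rfloor>}. H n z) \<in> L2 M" using assms by (intro L2_sum) auto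
  note scale = L2_embed_scaleR[OF this, symmetric]
  have "(\<Sum>n\<in>{1..nat \<lfloor>x\<rfloor>}. if n = 0 then 0 else L2_embed M (H n)) =
      (\<Sum>n\<in>{1..nat \<lfloor>x\<rfloor>}. L2_embed M (H n))"
    by (intro sum.cong) auto
  also have "\<dots> = L2_embed M (\<lambda>z. \<Sum>n\<in>{1..nat \<lfloor>x\<rfloor>}. H n z)"
    using assms by (intro L2_embed_sum[symmetric]) auto
  finally show ?thesis unfolding avg_def by (simp only: scale)
qed

text \<open>The embedded orbit is a \<open>multiplicative_sequence\<close>.
  \<open>avg_invariant\<close> says that T_p0 almost fixes the mean, and since the transformations
  commute, T_p0 of the mean is the mean of T_p0 F.\<close>

lemma mean_heavy_tendsto_0:
  assumes F: "F \<in> L2 M" and p0: "prime p0" "heavy p0"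
  shows "(\<lambda>N. L2_norm M (mean (\<lambda>x. tw F p0 x - F x) N)) \<longlonglongrightarrow> 0"
proof -
  define g where "g = (\<lambda>n. if n = 0 then 0 else L2_embed M (tw F n))"
  define A where "A = (\<lambda>x z. of_real (1 / x) * (\<Sum>n\<in>{1..nat \<lfloor>x\<rfloor>}. tw F n z))"
  have A: "A x \<in> L2 M" for x
    unfolding A_def using L2_tw(1)[OF F] by (intro L2_cmult L2_sum) auto
  have avg: "avg g x = L2_embed M (A x)" for x
    unfolding g_def A_def using L2_tw(1)[OF F] by (rule avg_L2_embed)
  \<comment> \<open>The mean along the multiples of p is T_p applied to the mean, by
    multiplicativity of both \<open>S\<close> and \<open>f\<close>.\<close>
  have avg_p: "avg (\<lambda>m. g (p * m)) x = L2_embed M (tw (A x) p)" if p: "prime p" for p x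
  proof -
    have p1: "p \<ge> 1" using p by (rule prime_ge_1_nat)
    have "g (p * m) = (if m = 0 then 0 else L2_embed M (tw F (p * m)))" for m
      using p1 by (simp add: g_def)
    moreover have "tw F (p * m) \<in> L2 M" if "m \<ge> 1" for m using that p1 by (intro L2_tw(1)[OF F]) auto
    ultimately have "avg (\<lambda>m. g (p * m)) x = L2_embed M (\<lambda>z. of_real (1 / x) * (\<Sum>m\<in>{1..nat \<lfloor>x\<rfloor>}. tw F (p * m) z))"
      using avg_L2_embed[of "\<lambda>m. tw F (p * m)" x] by simp
    also have "\<dots> = L2_embed M (tw (A x) p)"
    proof (rule L2_embed_cong)
      fix z assume z: "z \<in> space M"
      have "tw F (p * m) z = cnj (f p) * tw F m (S p z)" if "m \<ge> 1" for m
        using tw_mult[OF that p1 z, of F] by (simp add: tw_def[of "tw F m"] mult.commute)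
      then have "(\<Sum>m\<in>{1..nat \<lfloor>x\<rfloor>}. tw F (p * m) z) = (\<Sum>m\<in>{1..nat \<lfloor>x\<rfloor>}. cnj (f p) * tw F m (S p z))"
        by (intro sum.cong) auto
      moreover have "tw (A x) p z = cnj (f p) * A x (S p z)" by (rule tw_def)
      ultimately show "of_real (1 / x) * (\<Sum>m\<in>{1..nat \<lfloor>x\<rfloor>}. tw F (p * m) z) = tw (A x) p z"
        by (simp add: A_def flip: sum_distrib_left)
    qed
    finally show ?thesis .
  qed
  interpret multiplicative_sequence g "L2_norm M F" col
  proof
    show "norm (g n) \<le> L2_norm M F" for n
      using L2_tw[OF F, of n] by (auto simp: g_def norm_L2_embed)
    show "finite (col ` {p. prime p})" by (rule finite_col)
    fix p q x y assume pq: "prime p" "prime q" "col p = col q"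
    have p1: "p \<ge> 1" "q \<ge> 1" using pq prime_ge_1_nat[of p] prime_ge_1_nat[of q] by auto
    have "norm (avg (\<lambda>m. g (p * m)) x - avg (\<lambda>m. g (q * m)) y) = L2_norm M (\<lambda>z. tw (A x) p z - tw (A y) q z)"
      unfolding avg_p[OF pq(1)] avg_p[OF pq(2)] using L2_tw(1)[OF A] p1 by (intro dist_L2_embed) auto
    also have "\<dots> = L2_norm M (tw (\<lambda>z. A x z - A y z) p)"
      by (rule L2_norm_cong) (auto simp: tw_diff tw_def col_eqD[OF pq(3)] algebra_simps)
    also have "\<dots> = L2_norm M (\<lambda>z. A x z - A y z)" by (rule L2_tw(2)[OF L2_diff[OF A A] p1(1)])
    also have "\<dots> = norm (avg g x - avg g y)" unfolding avg by (rule dist_L2_embed[OF A A, symmetric])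
    finally show "norm (avg (\<lambda>m. g (p * m)) x - avg (\<lambda>m. g (q * m)) y) \<le> norm (avg g x - avg g y)" by simp
  qed
  have p1: "p0 \<ge> 1" using p0 by (intro prime_ge_1_nat)
  have "((\<lambda>x. avg (\<lambda>m. g (p0 * m)) x - avg g x) \<longlongrightarrow> 0) at_top"
    by (rule avg_invariant) (use p0 in \<open>auto simp: heavy_def\<close>)
  then have "(\<lambda>N. avg (\<lambda>m. g (p0 * m)) (real N) - avg g (real N)) \<longlonglongrightarrow> 0"
    by (rule filterlim_compose[OF _ filterlim_real_sequentially])
  then have "(\<lambda>N. norm (avg (\<lambda>m. g (p0 * m)) (real N) - avg g (real N))) \<longlonglongrightarrow> 0"
    by (rule tendsto_norm_zero)
  moreover have "norm (avg (\<lambda>m. g (p0 * m)) (real N) - avg g (real N)) = L2_norm M (mean (\<lambda>x. tw F p0 x - F x) N)" for N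
  proof -
    have "norm (avg (\<lambda>m. g (p0 * m)) (real N) - avg g (real N)) = L2_norm M (\<lambda>z. tw (A (real N)) p0 z - A (real N) z)"
      unfolding avg_p[OF p0(1)] avg by (intro dist_L2_embed L2_tw A p1)
    also have "\<dots> = L2_norm M (mean (\<lambda>x. tw F p0 x - F x) N)"
    proof (rule L2_norm_cong)
      fix z assume z: "z \<in> space M"
      have "tw (tw F p0) n z = cnj (f p0) * tw F n (S p0 z)" if "n \<ge> 1" for n
        using commute[OF that p1 z] by (simp add: tw_def)
      then have "(\<Sum>n=1..N. tw (tw F p0) n z) = (\<Sum>n=1..N. cnj (f p0) * tw F n (S p0 z))"
        by (intro sum.cong) auto
      moreover have "tw (A (real N)) p0 z = cnj (f p0) * A (real N) (S p0 z)" by (rule tw_def)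
      ultimately show "tw (A (real N)) p0 z - A (real N) z = mean (\<lambda>x. tw F p0 x - F x) N z"
        by (simp add: mean_diff mean_def[of "tw F p0"] mean_def[of F] A_def flip: sum_distrib_left)
    qed
    finally show ?thesis .
  qed
  ultimately show ?thesis by simp
qed

section \<open>Vectors whose twisted means tend to zero\<close>

definition null_space :: "('a \<Rightarrow> complex) set" where
  "null_space = {F \<in> L2 M. (\<lambda>N. L2_norm M (mean F N)) \<longlonglongrightarrow> 0}"

lemma L2_subspace_null_space: "L2_subspace M null_space"
  unfolding L2_subspace_def
proof (intro conjI ballI allI)
  show "(\<lambda>x. 0) \<in> null_space" by (simp add: null_space_def L2_zero mean_def tw_def L2_norm_def)
  show "(\<lambda>x. F x + G x) \<in> null_space" if "F \<in> null_space" "G \<in> null_space" for F G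
  proof -
    have FG: "F \<in> L2 M" "G \<in> L2 M" using that by (auto simp: null_space_def)
    have lim: "(\<lambda>N. L2_norm M (mean F N) + L2_norm M (mean G N)) \<longlonglongrightarrow> 0"
      using that by (intro tendsto_add_zero) (auto simp: null_space_def)
    have "(\<lambda>N. L2_norm M (mean (\<lambda>x. F x + G x) N)) \<longlonglongrightarrow> 0"
    proof (rule tendsto_0_le[OF lim, of _ 1], intro always_eventually allI)
      fix N
      have "L2_norm M (mean (\<lambda>x. F x + G x) N) = L2_norm M (\<lambda>x. mean F N x + mean G N x)"
        by (rule L2_norm_cong) (rule mean_add)
      also have "\<dots> \<le> L2_norm M (mean F N) + L2_norm M (mean G N)"
        using L2_mean(1) FG by (intro L2_norm_triangle)
      finally show "norm (L2_norm M (mean (\<lambda>x. F x + G x) N)) \<le> norm (L2_norm M (mean F N) + L2_norm M (mean G N)) * 1"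
        by simp
    qed
    then show ?thesis using FG by (simp add: null_space_def L2_add)
  qed
  show "(\<lambda>x. c * F x) \<in> null_space" if "F \<in> null_space" for c F
  proof -
    have "L2_norm M (mean (\<lambda>x. c * F x) N) = cmod c * L2_norm M (mean F N)" for N
      unfolding L2_norm_cmult[symmetric] by (rule L2_norm_cong) (rule mean_cmult)
    then show ?thesis using that by (auto simp: null_space_def L2_cmult intro: tendsto_mult_right_zero)
  qed
qed (auto simp: null_space_def)

text \<open>Every \<open>mean\<close> is a contraction of L2, so an approximation of G controls the
  means of G uniformly in N.\<close>

lemma null_space_closed: "L2_closure M null_space \<subseteq> null_space"
proof
  fix G assume G: "G \<in> L2_closure M null_space"
  then have GL: "G \<in> L2 M" by (simp add: L2_closure_def)
  have "(\<lambda>N. L2_norm M (mean G N)) \<longlonglongrightarrow> 0"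
  proof (rule tendstoI)
    fix e :: real assume e: "e > 0"
    have "\<exists>H\<in>null_space. L2_norm M (\<lambda>x. G x - H x) < e / 2"
      using G half_gt_zero[OF e] unfolding L2_closure_def by blast
    then obtain H where H: "H \<in> null_space" "L2_norm M (\<lambda>x. G x - H x) < e / 2" by blast
    then have HL: "H \<in> L2 M" "(\<lambda>N. L2_norm M (mean H N)) \<longlonglongrightarrow> 0" by (auto simp: null_space_def)
    have "\<forall>\<^sub>F N in sequentially. L2_norm M (mean H N) < e / 2"
      by (rule order_tendstoD(2)[OF HL(2)]) (use e in simp)
    then show "\<forall>\<^sub>F N in sequentially. dist (L2_norm M (mean G N)) 0 < e"
    proof eventually_elim
      case (elim N)
      have "L2_norm M (mean G N) = L2_norm M (\<lambda>x. mean (\<lambda>x. G x - H x) N x + mean H N x)"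
        by (rule L2_norm_cong) (simp add: mean_diff)
      also have "\<dots> \<le> L2_norm M (mean (\<lambda>x. G x - H x) N) + L2_norm M (mean H N)"
        using GL HL by (intro L2_norm_triangle L2_mean(1) L2_diff)
      also have "L2_norm M (mean (\<lambda>x. G x - H x) N) \<le> L2_norm M (\<lambda>x. G x - H x)"
        using GL HL by (intro L2_mean(2) L2_diff)
      finally show ?case using elim H(2) by simp
    qed
  qed
  then show "G \<in> null_space" using GL by (simp add: null_space_def)
qed

section \<open>The space H_f described by heavy primes, and its orthogonal complement\<close>

lemma light_primes_summable: "(\<lambda>p. 1 / real p) summable_on {p. prime p \<and> \<not> heavy p}"
proof (rule summable_on_finite_partition[OF finite_col])
  fix c assume "c \<in> col ` {p. prime p}"
  show "(\<lambda>p. 1 / real p) summable_on {p \<in> {p. prime p \<and> \<not> heavy p}. col p = c}"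
  proof (cases "\<exists>p. prime p \<and> \<not> heavy p \<and> col p = c")
    case True
    then obtain p where p: "prime p" "\<not> heavy p" "col p = c" by blast
    then have "(\<lambda>q. 1 / real q) summable_on {q. prime q \<and> col q = c}" by (simp add: heavy_def)
    then show ?thesis by (rule summable_on_subset) auto
  next
    case False
    then have "{p \<in> {p. prime p \<and> \<not> heavy p}. col p = c} = {}" by blast
    then show ?thesis by (simp only: summable_on_empty)
  qed
qed auto

text \<open>The numerator of the defining series depends only on the colour of p. The series thus
  splits into finitely many colour sums, each a constant times a sum of 1 / p: on a heavy colour the
  constant must vanish, on a light colour any constant is allowed.\<close>

lemma H_space_iff:
  "F \<in> H_space M S f \<longleftrightarrow> F \<in> L2 M \<and> (\<forall>p. prime p \<and> heavy p \<longrightarrow> L2_norm M (\<lambda>x. F (S p x) - f p * F x) = 0)"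
proof -
  define D where "D = (\<lambda>p. (L2_norm M (\<lambda>x. F (S p x) - f p * F x))\<^sup>2)"
  define t where "t = (\<lambda>p. D p / real p)"
  have H: "F \<in> H_space M S f \<longleftrightarrow> F \<in> L2 M \<and> t summable_on {p. prime p}"
    by (auto simp: H_space_def dist_D_def Let_def t_def D_def)
  have D_col: "D p = D q" if "col p = col q" for p q
    unfolding D_def using col_eqD[OF that] by (intro arg_cong[of _ _ "\<lambda>x. x\<^sup>2"] L2_norm_cong) auto
  have "t summable_on {p. prime p} \<longleftrightarrow> (\<forall>p. prime p \<and> heavy p \<longrightarrow> D p = 0)"
  proof
    assume t: "t summable_on {p. prime p}"
    show "\<forall>p. prime p \<and> heavy p \<longrightarrow> D p = 0"
    proof (intro allI impI)
      fix p assume p: "prime p \<and> heavy p"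
      have "t summable_on {q. prime q \<and> col q = col p}" using t by (rule summable_on_subset) auto
      then have "(\<lambda>q. D p * (1 / real q)) summable_on {q. prime q \<and> col q = col p}"
        by (rule summable_on_cong[THEN iffD1, rotated]) (auto simp: t_def dest: D_col)
      then have "(\<lambda>q. 1 / real q) summable_on {q. prime q \<and> col q = col p}" if "D p \<noteq> 0"
        using that by (simp add: summable_on_cmult_right' del: times_divide_eq_right)
      then show "D p = 0" using p by (auto simp: heavy_def)
    qed
  next
    assume z: "\<forall>p. prime p \<and> heavy p \<longrightarrow> D p = 0"
    have "t summable_on {p. prime p \<and> \<not> heavy p}"
    proof (rule summable_on_finite_partition[OF finite_col])
      fix c assume "c \<in> col ` {p. prime p}"
      then obtain p0 where p0: "col p0 = c" by auto
      have "(\<lambda>p. 1 / real p) summable_on {p \<in> {p. prime p \<and> \<not> heavy p}. col p = c}"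
        using light_primes_summable by (rule summable_on_subset) auto
      then have "(\<lambda>p. D p0 * (1 / real p)) summable_on {p \<in> {p. prime p \<and> \<not> heavy p}. col p = c}"
        by (rule summable_on_cmult_right)
      then show "t summable_on {p \<in> {p. prime p \<and> \<not> heavy p}. col p = c}"
      proof (rule summable_on_cong[THEN iffD1, rotated])
        fix p assume "p \<in> {p \<in> {p. prime p \<and> \<not> heavy p}. col p = c}"
        then have "D p = D p0" using D_col[of p p0] p0 by simp
        then show "D p0 * (1 / real p) = t p" by (simp add: t_def)
      qed
    qed auto
    moreover have "t summable_on {p. prime p \<and> \<not> heavy p} \<longleftrightarrow> t summable_on {p. prime p}"
      by (rule summable_on_cong_neutral) (use z in \<open>auto simp: t_def\<close>)
    ultimately show "t summable_on {p. prime p}" by simp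
  qed
  then show ?thesis by (auto simp: H D_def)
qed

lemma H_space_AE:
  assumes "F \<in> H_space M S f" "prime p" "heavy p"
  shows "AE x in M. F (S p x) = f p * F x"
proof -
  have F: "F \<in> L2 M" using assms by (simp add: H_space_iff)
  have "p \<ge> 1" using assms(2) by (rule prime_ge_1_nat)
  then have "(\<lambda>x. F (S p x) - f p * F x) \<in> L2 M" using F by (intro L2_diff L2_S L2_cmult)
  moreover have "L2_norm M (\<lambda>x. F (S p x) - f p * F x) = 0" using assms by (simp add: H_space_iff)
  ultimately have "AE x in M. F (S p x) - f p * F x = 0" using L2_norm_eq_0_iff by blast
  then show ?thesis by simp
qed

lemma L2_subspace_H_space: "L2_subspace M (H_space M S f)"
  unfolding L2_subspace_def
proof (intro conjI ballI allI)
  show "(\<lambda>x. 0) \<in> H_space M S f" by (simp add: H_space_iff L2_zero L2_norm_def)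
  show "(\<lambda>x. F x + G x) \<in> H_space M S f" if "F \<in> H_space M S f" "G \<in> H_space M S f" for F G
  proof -
    have FG: "F \<in> L2 M" "G \<in> L2 M" using that by (auto simp: H_space_iff)
    have "L2_norm M (\<lambda>x. F (S p x) + G (S p x) - f p * (F x + G x)) = 0" if p: "prime p" "heavy p" for p
    proof -
      have p1: "p \<ge> 1" using p(1) by (rule prime_ge_1_nat)
      have "L2_norm M (\<lambda>x. F (S p x) + G (S p x) - f p * (F x + G x)) =
        L2_norm M (\<lambda>x. (F (S p x) - f p * F x) + (G (S p x) - f p * G x))"
        by (simp add: algebra_simps)
      also have "\<dots> \<le> L2_norm M (\<lambda>x. F (S p x) - f p * F x) + L2_norm M (\<lambda>x. G (S p x) - f p * G x)"
        using FG p1 by (intro L2_norm_triangle L2_diff L2_S L2_cmult)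
      also have "\<dots> = 0" using \<open>F \<in> H_space M S f\<close> \<open>G \<in> H_space M S f\<close> p by (simp add: H_space_iff)
      finally show ?thesis using L2_norm_nonneg by (rule antisym)
    qed
    then show ?thesis using FG by (auto simp: H_space_iff L2_add)
  qed
  show "(\<lambda>x. c * F x) \<in> H_space M S f" if F: "F \<in> H_space M S f" for c F
  proof -
    have "L2_norm M (\<lambda>x. c * F (S p x) - f p * (c * F x)) = cmod c * L2_norm M (\<lambda>x. F (S p x) - f p * F x)" for p
      unfolding L2_norm_cmult[symmetric] by (simp add: algebra_simps)
    then show ?thesis using F by (auto simp: H_space_iff L2_cmult)
  qed
qed (auto simp: H_space_iff)

lemma H_space_closed: "L2_closure M (H_space M S f) = H_space M S f"
proof
  show "L2_closure M (H_space M S f) \<subseteq> H_space M S f"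
  proof
    fix G assume G: "G \<in> L2_closure M (H_space M S f)"
    then have GL: "G \<in> L2 M" by (simp add: L2_closure_def)
    have "L2_norm M (\<lambda>x. G (S p x) - f p * G x) = 0" if p: "prime p" "heavy p" for p
    proof -
      have p1: "p \<ge> 1" using p(1) by (rule prime_ge_1_nat)
      have "L2_norm M (\<lambda>x. G (S p x) - f p * G x) \<le> \<epsilon>" if \<epsilon>: "\<epsilon> > 0" for \<epsilon>
      proof -
        have "\<exists>H\<in>H_space M S f. L2_norm M (\<lambda>x. G x - H x) < \<epsilon> / 2"
          using G half_gt_zero[OF \<epsilon>] unfolding L2_closure_def by blast
        then obtain H where H: "H \<in> H_space M S f" "L2_norm M (\<lambda>x. G x - H x) < \<epsilon> / 2" by blast
        have HL: "H \<in> L2 M" using H(1) by (simp add: H_space_iff)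
        define K where "K = (\<lambda>x. G x - H x)"
        have K: "K \<in> L2 M" unfolding K_def using GL HL by (rule L2_diff)
        have "L2_norm M (\<lambda>x. G (S p x) - f p * G x) =
          L2_norm M (\<lambda>x. (K (S p x) - f p * K x) + (H (S p x) - f p * H x))"
          by (simp add: K_def algebra_simps)
        also have "\<dots> \<le> L2_norm M (\<lambda>x. K (S p x) - f p * K x) + L2_norm M (\<lambda>x. H (S p x) - f p * H x)"
          using K HL p1 by (intro L2_norm_triangle L2_diff L2_S L2_cmult)
        also have "L2_norm M (\<lambda>x. H (S p x) - f p * H x) = 0" using H(1) p by (simp add: H_space_iff)
        also have "L2_norm M (\<lambda>x. K (S p x) - f p * K x) = L2_norm M (\<lambda>x. K (S p x) + (- f p) * K x)" by simp
        also have "\<dots> \<le> L2_norm M (\<lambda>x. K (S p x)) + L2_norm M (\<lambda>x. (- f p) * K x)"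
          using K p1 by (intro L2_norm_triangle L2_S L2_cmult)
        also have "\<dots> = 2 * L2_norm M K" 
          using L2_S(2)[OF K p1] f_norm[OF p1] by (simp only: L2_norm_cmult norm_minus_cancel)
        finally show ?thesis using H(2) by (simp add: K_def)
      qed
      then have "L2_norm M (\<lambda>x. G (S p x) - f p * G x) \<le> 0" by (rule field_le_epsilon[of _ 0, simplified])
      then show ?thesis using L2_norm_nonneg by (rule antisym)
    qed
    then show "G \<in> H_space M S f" using GL by (simp add: H_space_iff)
  qed
  show "H_space M S f \<subseteq> L2_closure M (H_space M S f)"
  proof
    fix G assume G: "G \<in> H_space M S f"
    show "G \<in> L2_closure M (H_space M S f)"
      by (rule in_L2_closureI[OF _ G]) (use G in \<open>auto simp: H_space_iff L2_norm_def\<close>)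
  qed
qed

lemma P_proj_props:
  assumes "F \<in> L2 M"
  shows "P_proj M S f F \<in> H_space M S f"
    and "H \<in> H_space M S f \<Longrightarrow> L2_inner M (\<lambda>x. F x - P_proj M S f F x) H = 0"
proof -
  obtain G where "G \<in> H_space M S f" "\<And>H. H \<in> H_space M S f \<Longrightarrow> L2_inner M (\<lambda>x. F x - G x) H = 0"
    by (rule L2_projection_exists[OF L2_subspace_H_space equalityD1[OF H_space_closed] assms]) (rule that)
  then have "\<exists>G. G \<in> H_space M S f \<and> (\<forall>H\<in>H_space M S f. L2_inner M (\<lambda>x. F x - G x) H = 0)"
    by blast
  from someI_ex[OF this] show "P_proj M S f F \<in> H_space M S f"
    and "H \<in> H_space M S f \<Longrightarrow> L2_inner M (\<lambda>x. F x - P_proj M S f F x) H = 0"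
    unfolding P_proj_def L2_proj_def H_space_closed by auto
qed

text \<open>A vector orthogonal to all coboundaries \<open>tw F p - F\<close> with \<open>p\<close> heavy is fixed by the isometries \<open>\<lambda>F. tw F p\<close>.\<close>

theorem orthogonal_imp_null_space:
  assumes E: "E \<in> L2 M" and orth: "\<And>H. H \<in> H_space M S f \<Longrightarrow> L2_inner M E H = 0"
  shows "E \<in> null_space"
proof -
  \<comment> \<open>Split E = E1 + E2 with E1 in \<open>null_space\<close> and E2 orthogonal to it.
    The aim is to show that E2 has norm 0.\<close>
  obtain E1 where E1: "E1 \<in> null_space" "\<And>H. H \<in> null_space \<Longrightarrow> L2_inner M (\<lambda>x. E x - E1 x) H = 0"
    by (rule L2_projection_exists[OF L2_subspace_null_space null_space_closed E]) (rule that)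
  define E2 where "E2 = (\<lambda>x. E x - E1 x)"
  have E1L: "E1 \<in> L2 M" using E1 by (simp add: null_space_def)
  have E2L: "E2 \<in> L2 M" unfolding E2_def using E E1L by (rule L2_diff)
  have "L2_norm M (\<lambda>x. E2 (S p x) - f p * E2 x) = 0" if p: "prime p" "heavy p" for p
  proof -
    have p1: "p \<ge> 1" using p(1) by (rule prime_ge_1_nat)
    have T: "tw E2 p \<in> L2 M" by (rule L2_tw(1)[OF E2L p1])
    have "(\<lambda>x. tw E2 p x - E2 x) \<in> null_space"
      using mean_heavy_tendsto_0[OF E2L p] T E2L by (simp add: null_space_def L2_diff)
    then have "L2_inner M E2 (\<lambda>x. tw E2 p x - E2 x) = 0" using E1(2) by (simp add: E2_def)
    then have "L2_inner M E2 (tw E2 p) = L2_inner M E2 E2" using L2_inner_diff_right[OF E2L T E2L] by simp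
    then have inn: "L2_inner M (tw E2 p) E2 = of_real ((L2_norm M E2)\<^sup>2)"
      using L2_inner_cnj[of M "tw E2 p" E2] by (simp add: L2_inner_self)
    \<comment> \<open>Equality in Cauchy-Schwarz: T_p E2 has the same norm as E2, and its inner
      product with E2 is the square of that norm, so the two coincide in L2.\<close>
    have "(L2_norm M (\<lambda>x. tw E2 p x - 1 * E2 x))\<^sup>2 = 0"
      unfolding L2_norm_diff_sq[OF T E2L] inn using L2_tw(2)[OF E2L p1] by simp
    then have z: "L2_norm M (\<lambda>x. tw E2 p x - E2 x) = 0" by simp
    have "f p * cnj (f p) = 1" using f_norm[OF p1] complex_norm_square[of "f p"] by simp
    then have "E2 (S p x) - f p * E2 x = f p * (tw E2 p x - E2 x)" for x
      by (simp add: tw_def right_diff_distrib flip: mult.assoc)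
    then have "L2_norm M (\<lambda>x. E2 (S p x) - f p * E2 x) = cmod (f p) * L2_norm M (\<lambda>x. tw E2 p x - E2 x)"
      by (simp only: L2_norm_cmult)
    then show ?thesis using z by simp
  qed
  then have E2H: "E2 \<in> H_space M S f" using E2L by (simp add: H_space_iff)
  have "L2_inner M E2 E1 = 0" using E1 by (simp add: E2_def)
  then have "L2_inner M E1 E2 = 0" using L2_inner_cnj[of M E1 E2] by simp
  \<comment> \<open>E2 lies in \<open>H_space\<close>, so it is orthogonal to E by assumption and to
    E1 by construction, hence to their difference, which is E2 itself.\<close>
  then have "L2_inner M E2 E2 = 0"
    using orth[OF E2H] L2_inner_diff[OF E E1L E2L] by (simp add: E2_def)
  then have "L2_norm M (\<lambda>x. E x - E1 x) = 0" by (simp add: L2_inner_self E2_def)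
  then have "E \<in> L2_closure M null_space" by (rule in_L2_closureI[OF E E1(1)])
  then show ?thesis using null_space_closed by blast
qed

end


section \<open>Unordered sums in L2 and evaluation of the mean\<close>

instance bcontfun :: (metric_space, banach) banach ..

context twisted_system
begin

text \<open>Absolute convergence in the complete space of functionals; completeness of \<open>L2 M\<close> puts the sum
  into the image of the embedding.\<close>

lemma L2_sum_exists:
  fixes u :: "nat \<Rightarrow> 'a \<Rightarrow> complex"
  assumes u: "\<And>n. n \<in> A \<Longrightarrow> u n \<in> L2 M"
    and s: "(\<lambda>n. L2_norm M (u n)) summable_on A"
  obtains U where "U \<in> L2 M" "((\<lambda>n. L2_embed M (u n)) has_sum L2_embed M U) A"
proof -
  have "(\<lambda>n. norm (L2_embed M (u n))) summable_on A"
    using s by (rule summable_on_cong[THEN iffD1, rotated]) (simp add: norm_L2_embed u)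
  then have "(\<lambda>n. L2_embed M (u n)) summable_on A" by (rule abs_summable_summable)
  then obtain Y where Y: "((\<lambda>n. L2_embed M (u n)) has_sum Y) A" by (auto simp: summable_on_def)
  \<comment> \<open>The unordered sum is already known to exist among the functionals, so its limit
    can be identified along the initial segments; this turns the question into one about a Cauchy
    sequence in \<open>L2 M\<close>.\<close>
  define v where "v = (\<lambda>N x. \<Sum>n\<in>A \<inter> {..N}. u n x)"
  have v: "v N \<in> L2 M" for N unfolding v_def using u by (intro L2_sum) auto
  have "filterlim (\<lambda>N. A \<inter> {..N}) (finite_subsets_at_top A) sequentially"
    unfolding filterlim_finite_subsets_at_top
  proof (intro allI impI)
    fix X assume X: "finite X \<and> X \<subseteq> A"
    show "\<forall>\<^sub>F N in sequentially. finite (A \<inter> {..N}) \<and> X \<subseteq> A \<inter> {..N} \<and> A \<inter> {..N} \<subseteq> A"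
      using eventually_ge_at_top[of "Max (insert 0 X)"]
    proof eventually_elim
      case (elim N)
      have "x \<le> N" if "x \<in> X" for x
        using X that elim Max_ge[of "insert 0 X" x] by auto
      then show ?case using X by auto
    qed
  qed
  from filterlim_compose[OF Y[unfolded has_sum_def] this]
  moreover have "L2_embed M (v N) = (\<Sum>n\<in>A \<inter> {..N}. L2_embed M (u n))" for N
    unfolding v_def using u by (intro L2_embed_sum) auto
  ultimately have lim: "(\<lambda>N. L2_embed M (v N)) \<longlonglongrightarrow> Y" by simp
  then have "Cauchy (\<lambda>N. L2_embed M (v N))" by (rule LIMSEQ_imp_Cauchy)
  then have "\<exists>K. \<forall>m\<ge>K. \<forall>n\<ge>K. L2_norm M (\<lambda>x. v m x - v n x) < \<epsilon>" if "\<epsilon> > 0" for \<epsilon>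
    using that v unfolding Cauchy_def by (simp add: dist_norm dist_L2_embed)
  from L2_complete[OF v this] obtain U where U: "U \<in> L2 M" "(\<lambda>N. L2_norm M (\<lambda>x. v N x - U x)) \<longlonglongrightarrow> 0"
    by blast
  have "(\<lambda>N. norm (L2_embed M (v N) - L2_embed M U)) \<longlonglongrightarrow> 0"
    using U v by (simp add: dist_L2_embed)
  then have "(\<lambda>N. L2_embed M (v N)) \<longlonglongrightarrow> L2_embed M U"
    by (simp add: LIM_zero_iff tendsto_norm_zero_iff)
  then have "Y = L2_embed M U" using lim LIMSEQ_unique by blast
  then show ?thesis using that U Y by simp
qed

lemma has_L2_sum_iff:
  assumes u: "\<And>n. n \<in> A \<Longrightarrow> u n \<in> L2 M"
  shows "has_L2_sum M u U A \<longleftrightarrow> U \<in> L2 M \<and> ((\<lambda>n. L2_embed M (u n)) has_sum L2_embed M U) A"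
proof -
  have sumL: "(\<lambda>x. \<Sum>i\<in>B. u i x) \<in> L2 M" if "B \<subseteq> A" for B
    using u that by (intro L2_sum) auto
  have ev: "\<forall>\<^sub>F B in finite_subsets_at_top A. (\<lambda>x. \<Sum>i\<in>B. u i x) \<in> L2 M"
    using eventually_finite_subsets_at_top_weakI[of A "\<lambda>B. (\<lambda>x. \<Sum>i\<in>B. u i x) \<in> L2 M"] sumL by blast
  have "((\<lambda>B. L2_norm M (\<lambda>x. (\<Sum>i\<in>B. u i x) - U x)) \<longlongrightarrow> 0) (finite_subsets_at_top A) \<longleftrightarrow>
      ((\<lambda>n. L2_embed M (u n)) has_sum L2_embed M U) A" if U: "U \<in> L2 M"
  proof -
    have eq: "L2_norm M (\<lambda>x. (\<Sum>i\<in>B. u i x) - U x) = norm ((\<Sum>i\<in>B. L2_embed M (u i)) - L2_embed M U)"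
      if "B \<subseteq> A" for B
    proof -
      have "(\<Sum>i\<in>B. L2_embed M (u i)) = L2_embed M (\<lambda>x. \<Sum>i\<in>B. u i x)"
        using u that by (intro L2_embed_sum[symmetric]) auto
      then show ?thesis using dist_L2_embed[OF sumL[OF that] U] by simp
    qed
    have "((\<lambda>B. L2_norm M (\<lambda>x. (\<Sum>i\<in>B. u i x) - U x)) \<longlongrightarrow> 0) (finite_subsets_at_top A) \<longleftrightarrow>
      ((\<lambda>B. norm ((\<Sum>i\<in>B. L2_embed M (u i)) - L2_embed M U)) \<longlongrightarrow> 0) (finite_subsets_at_top A)"
      by (rule tendsto_cong, rule eventually_finite_subsets_at_top_weakI) (rule eq)
    then show ?thesis by (simp add: has_sum_def LIM_zero_iff tendsto_norm_zero_iff)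
  qed
  then show ?thesis using ev by (auto simp: has_L2_sum_def L2_tendsto_def)
qed

lemma mean_value:
  assumes F: "F \<in> L2 M"
  defines "G \<equiv> P_proj M S f F"
  defines "P \<equiv> {p. prime p \<and> \<not> (AE x in M. G (S p x) = f p * G x)}"
  defines "Q \<equiv> Q_set ({p. prime p} - P)"
  defines "fac \<equiv> \<lambda>p. if p \<in> P then 1 - 1 / of_nat p else 1 :: complex"
  defines "u \<equiv> \<lambda>n x. cnj (f n) / of_nat n * G (S n x)"
  shows "convergent_prod fac" "L2_summable_on M u Q"
    "L2_tendsto M (mean F) (\<lambda>x. (\<Prod>p. fac p) * L2_infsum M u Q x) sequentially"
proof -
  have GH: "G \<in> H_space M S f" and orth: "\<And>H. H \<in> H_space M S f \<Longrightarrow> L2_inner M (\<lambda>x. F x - G x) H = 0"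
    using P_proj_props[OF F] by (auto simp: G_def)
  have G: "G \<in> L2 M" using GH by (simp add: H_space_iff)
  have P: "P \<subseteq> {p. prime p}" by (auto simp: P_def)
  \<comment> \<open>A heavy prime fixes \<open>G\<close> up to the twist, so every prime in
    \<open>P\<close> is light.\<close>
  have "P \<subseteq> {p. prime p \<and> \<not> heavy p}" using H_space_AE[OF GH] by (auto simp: P_def)
  with light_primes_summable have s: "(\<lambda>p. 1 / real p) summable_on P" by (rule summable_on_subset)
  define \<delta> where "\<delta> = (\<Prod>p. if p \<in> P then 1 - 1 / real p else 1)"
  have cp: "convergent_prod (\<lambda>p. if p \<in> P then 1 - 1 / real p else 1)" by (rule convergent_prod_euler[OF P s])
  have fac_eq: "fac = complex_of_real \<circ> (\<lambda>p. if p \<in> P then 1 - 1 / real p else 1)"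
    by (auto simp: fac_def)
  show cfac: "convergent_prod fac" unfolding fac_eq convergent_prod_of_real_iff by (rule cp)
  \<comment> \<open>The complex product is identified with the real density by uniqueness of limits
    of the partial products.\<close>
  have "(\<lambda>n. \<Prod>i\<le>n. fac i) \<longlonglongrightarrow> (\<Prod>p. fac p)" by (rule convergent_prod_LIMSEQ[OF cfac])
  moreover have "(\<lambda>n. complex_of_real (\<Prod>i\<le>n. if i \<in> P then 1 - 1 / real i else 1)) \<longlonglongrightarrow> of_real \<delta>"
    unfolding \<delta>_def by (intro tendsto_of_real convergent_prod_LIMSEQ[OF cp])
  ultimately have prodinf: "(\<Prod>p. fac p) = of_real \<delta>"
    unfolding fac_eq by (intro LIMSEQ_unique) (auto simp: o_def)
  define y where "y = (\<lambda>n. if n = 0 then 0 else L2_embed M (tw G n))"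
  have Q1: "n \<ge> 1" if "n \<in> Q" for n using that by (simp add: Q_def Q_set_def)
  have uL: "u n \<in> L2 M" if "n \<ge> 1" for n
    unfolding u_def by (intro L2_cmult L2_S(1) G that)
  have u_eq: "u n = (\<lambda>x. of_real (1 / real n) * tw G n x)" for n
    by (rule ext) (simp add: u_def tw_def)
  have embed_u: "L2_embed M (u n) = (1 / real n) *\<^sub>R y n" if "n \<ge> 1" for n
    unfolding u_eq using that by (subst L2_embed_scaleR[OF L2_tw(1)[OF G that]]) (simp add: y_def)
  have "L2_norm M (u n) = L2_norm M G * (1 / real n)" if "n \<ge> 1" for n
    unfolding u_eq L2_norm_cmult using L2_tw(2)[OF G that] by (simp add: norm_divide)
  then have "(\<lambda>n. L2_norm M (u n)) summable_on Q \<longleftrightarrow> (\<lambda>n. L2_norm M G * (1 / real n)) summable_on Q"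
    using Q1 by (intro summable_on_cong) auto
  moreover have "(\<lambda>n. L2_norm M G * (1 / real n)) summable_on Q"
    unfolding Q_def by (intro summable_on_cmult_right summable_inverse_smooth P s)
  ultimately have "(\<lambda>n. L2_norm M (u n)) summable_on Q" by simp
  then obtain U0 where "U0 \<in> L2 M" "((\<lambda>n. L2_embed M (u n)) has_sum L2_embed M U0) Q"
    using L2_sum_exists[of Q u] uL Q1 by blast
  then have "has_L2_sum M u U0 Q" using has_L2_sum_iff[of Q u U0] uL Q1 by blast
  then show "L2_summable_on M u Q" by (auto simp: L2_summable_on_def)
  \<comment> \<open>Whichever representative \<open>SOME\<close> selects, it is a sum of the series,
    and this is all that the argument uses.\<close>
  define U where "U = L2_infsum M u Q"
  have "has_L2_sum M u U Q" unfolding U_def L2_infsum_def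
    using someI[of "\<lambda>U. has_L2_sum M u U Q", OF \<open>has_L2_sum M u U0 Q\<close>] .
  then have U: "U \<in> L2 M" "((\<lambda>n. L2_embed M (u n)) has_sum L2_embed M U) Q"
    using has_L2_sum_iff[of Q u U] uL Q1 by blast+
  \<comment> \<open>For p outside \<open>P\<close>, T_p G equals G almost everywhere. Applying the
    isometry T_n, the vectors T_(p n) G and T_n G differ by norm 0, and the embedding identifies
    them.\<close>
  have y_prime: "y (p * n) = y n" if p: "prime p" "p \<notin> P" for p n
  proof (cases "n = 0")
    case False
    then have n: "n \<ge> 1" by simp
    have p1: "p \<ge> 1" using p(1) by (rule prime_ge_1_nat)
    have T: "tw G p \<in> L2 M" by (rule L2_tw(1)[OF G p1])
    have "AE x in M. G (S p x) = f p * G x" using p by (auto simp: P_def)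
    then have "AE x in M. tw G p x - G x = 0"
    proof eventually_elim
      case (elim x)
      have "cnj (f p) * f p = 1" using f_norm[OF p1] complex_norm_square[of "f p"] by (simp add: mult.commute)
      then show ?case using elim by (simp add: tw_def flip: mult.assoc)
    qed
    then have z: "L2_norm M (\<lambda>x. tw G p x - G x) = 0" using L2_norm_eq_0_iff[OF L2_diff[OF T G]] by simp
    have pn: "p * n \<ge> 1" using n p1 by simp
    have "norm (L2_embed M (tw G (p * n)) - L2_embed M (tw G n)) = L2_norm M (\<lambda>x. tw G (p * n) x - tw G n x)"
      by (intro dist_L2_embed L2_tw(1) G n pn)
    also have "\<dots> = L2_norm M (tw (\<lambda>x. tw G p x - G x) n)"
      by (rule L2_norm_cong) (simp add: tw_diff tw_mult[OF p1 n])
    also have "\<dots> = 0" using L2_tw(2)[OF L2_diff[OF T G] n] z by simp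
    finally show ?thesis using n p1 by (simp add: y_def)
  qed (simp add: y_def)
  have y_mult: "y (m * l) = y m" if "l \<in> Q_set P" for m l
    using that
  proof (induction l arbitrary: m rule: less_induct)
    case (less l)
    show ?case
    proof (cases "l = 1")
      case False
      then obtain p where p: "prime p" "p dvd l" using prime_factor_nat by blast
      then obtain k where k: "l = p * k" by (elim dvdE)
      have k1: "k \<ge> 1" using k less.prems by (cases k) (auto simp: Q_set_def)
      have "k < l" unfolding k using k1 prime_gt_1_nat[OF p(1)] by simp
      moreover have "k \<in> Q_set P" using less.prems k k1 by (auto simp: Q_set_def)
      ultimately have "y (m * k) = y m" by (rule less.IH)
      moreover have "p \<notin> P" using less.prems p by (auto simp: Q_set_def)
      then have "y (p * (m * k)) = y (m * k)" by (rule y_prime[OF p(1)])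
      moreover have "y (m * l) = y (p * (m * k))" by (simp add: k mult.left_commute)
      ultimately show ?thesis by simp
    qed simp
  qed
  have Y: "((\<lambda>m. (1 / real m) *\<^sub>R y m) has_sum L2_embed M U) Q"
    using U(2) by (rule has_sum_cong[THEN iffD1, rotated]) (rule embed_u[OF Q1])
  have lim: "(\<lambda>N. (1 / real N) *\<^sub>R (\<Sum>n\<in>{1..N}. y n)) \<longlonglongrightarrow> \<delta> *\<^sub>R L2_embed M U"
    unfolding \<delta>_def
  proof (rule mean_value_light[OF P s _ _ Y[unfolded Q_def]])
    show "y (m * l) = y m" if "l \<in> Q_set P" for m l
      using that by (rule y_mult)
    show "norm (y n) \<le> L2_norm M G" for n
      using L2_tw[OF G, of n] by (auto simp: y_def norm_L2_embed)
  qed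
  have mean_G: "L2_embed M (mean G N) = (1 / real N) *\<^sub>R (\<Sum>n\<in>{1..N}. y n)" for N
  proof -
    have L: "(\<lambda>x. \<Sum>n\<in>{1..N}. tw G n x) \<in> L2 M" using L2_tw(1)[OF G] by (intro L2_sum) auto
    have "L2_embed M (mean G N) = L2_embed M (\<lambda>x. of_real (1 / real N) * (\<Sum>n\<in>{1..N}. tw G n x))"
      by (rule L2_embed_cong) (simp add: mean_def)
    also have "\<dots> = (1 / real N) *\<^sub>R L2_embed M (\<lambda>x. \<Sum>n\<in>{1..N}. tw G n x)"
      by (rule L2_embed_scaleR[OF L])
    also have "L2_embed M (\<lambda>x. \<Sum>n\<in>{1..N}. tw G n x) = (\<Sum>n\<in>{1..N}. L2_embed M (tw G n))"
      using L2_tw(1)[OF G] by (intro L2_embed_sum) auto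
    also have "\<dots> = (\<Sum>n\<in>{1..N}. y n)" by (intro sum.cong) (auto simp: y_def)
    finally show ?thesis .
  qed
  define E where "E = (\<lambda>x. F x - G x)"
  have EL: "E \<in> L2 M" unfolding E_def using F G by (rule L2_diff)
  have "E \<in> null_space" using EL orth by (intro orthogonal_imp_null_space) (auto simp: E_def)
  then have E0: "(\<lambda>N. L2_norm M (mean E N)) \<longlonglongrightarrow> 0" by (simp add: null_space_def)
  define T where "T = (\<lambda>x. of_real \<delta> * U x)"
  have TL: "T \<in> L2 M" unfolding T_def by (rule L2_cmult[OF U(1)])
  have ET: "L2_embed M T = \<delta> *\<^sub>R L2_embed M U" unfolding T_def by (rule L2_embed_scaleR[OF U(1)])
  have "(\<lambda>N. norm (L2_embed M (mean G N) - L2_embed M T)) \<longlonglongrightarrow> 0"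
    using lim unfolding mean_G ET by (simp add: LIM_zero_iff tendsto_norm_zero_iff)
  then have G0: "(\<lambda>N. L2_norm M (\<lambda>x. mean G N x - T x)) \<longlonglongrightarrow> 0"
    using dist_L2_embed[OF L2_mean(1)[OF G] TL] by simp
  have "(\<lambda>N. L2_norm M (\<lambda>x. mean F N x - T x)) \<longlonglongrightarrow> 0"
  proof (rule tendsto_0_le[OF tendsto_add_zero[OF E0 G0], of _ 1], intro always_eventually allI)
    fix N
    have "L2_norm M (\<lambda>x. mean F N x - T x) = L2_norm M (\<lambda>x. mean E N x + (mean G N x - T x))"
      by (rule L2_norm_cong) (simp add: E_def mean_diff)
    also have "\<dots> \<le> L2_norm M (mean E N) + L2_norm M (\<lambda>x. mean G N x - T x)"
      using EL G TL by (intro L2_norm_triangle L2_mean(1) L2_diff)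
    finally show "norm (L2_norm M (\<lambda>x. mean F N x - T x)) \<le>
        norm (L2_norm M (mean E N) + L2_norm M (\<lambda>x. mean G N x - T x)) * 1" by simp
  qed
  then show "L2_tendsto M (mean F) (\<lambda>x. (\<Prod>p. fac p) * L2_infsum M u Q x) sequentially"
    using TL L2_mean(1)[OF F] by (simp add: L2_tendsto_def prodinf T_def U_def)
qed

end

theorem theorem1p14:
  fixes M :: "'a::metric_space measure"
    and S :: "nat \<Rightarrow> 'a \<Rightarrow> 'a"
    and F :: "'a \<Rightarrow> complex"
    and f :: "nat \<Rightarrow> complex"
  assumes "fg_multiplicative_system M S"
    and "F \<in> L2 M"
    and "f \<in> Mfg_c"
  shows "let G = P_proj M S f F;
             P = {p. prime p \<and> \<not> (AE x in M. G (S p x) = f p * G x)};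
             Q = Q_set ({p. prime p} - P);
             fac = (\<lambda>p. if p \<in> P then 1 - 1 / of_nat p else 1 :: complex);
             u = (\<lambda>n x. cnj (f n) / of_nat n * G (S n x))
         in convergent_prod fac \<and> L2_summable_on M u Q \<and>
            L2_tendsto M (\<lambda>N x. 1 / of_nat N * (\<Sum>n=1..N. cnj (f n) * F (S n x)))
              (\<lambda>x. (\<Prod>p. fac p) * L2_infsum M u Q x) sequentially"
proof -
  interpret fg_multiplicative_system M S by fact
  interpret twisted_system M S f by unfold_locales fact
  have mean: "mean F = (\<lambda>N x. 1 / of_nat N * (\<Sum>n=1..N. cnj (f n) * F (S n x)))"
    by (intro ext) (simp add: mean_def tw_def)
  show ?thesis
    using mean_value[OF assms(2)] unfolding mean Let_def by blast
qed

end
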